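(* Let $T\in(0,\infty)$, and let $\alpha\in(0,1)$ and $p,q\in(1,\infty)$ be such that $$\frac1\alpha<p<d,\qquad p<q\le p+\frac{p^2}{d}.$$ Then, for $\psi\in\mathbb H_{p,0}^{\alpha,1}(\mathbb R^d_T)$, $$\|\psi\|_{L_q(\mathbb R^d_T)}\le N\,T^{\alpha\left(1-\frac pq\right)-\frac1p+\frac1q}\,\|\partial_t^\alpha\psi\|_{L_p(\mathbb R^d_T)}^{1-p/q}\,\|D_x\psi\|_{L_p(\mathbb R^d_T)}^{\theta p/q}\,\|\psi\|_{L_p(\mathbb R^d_T)}^{(1-\theta)p/q},$$ where $N=N(d,\alpha,p,q)$ and $\theta=d(q-p)/p^2\in(0,1]$.
   Context: $\mathbb R^d_T=(0,T)\times\mathbb R^d$; $D_x\psi$ is the spatial gradient. $N=N(\cdots)$ is a constant depending only on the listed quantities. For $\mathcal D\subset\mathbb R^k$, $C_0^\infty(\mathcal D)$ denotes infinitely differentiable functions on $\mathcal D$ with compact support contained in $\mathcal D$. $I_0^{1-\alpha}u(t,x)=\frac1{\Gamma(1-\alpha)}\int_0^t(t-s)^{-\alpha}u(s,x)\,ds$. For a domain $\Omega\subset\mathbb R^d$, $\mathbb H_p^{\alpha,1}((0,T)\times\Omega)$ is the set of $u\in L_p((0,T)\times\Omega)$ with $D_xu\in L_p$ and for which there is $g\in L_p((0,T)\times\Omega)$, denoted $\partial_tI_0^{1-\alpha}u$, such that $\int_0^T\!\int_\Omega g\varphi\,dx\,dt=-\int_0^T\!\int_\Omega I_0^{1-\alpha}u\,\partial_t\varphi\,dx\,dt$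 for all $\varphi\in C_0^\infty([0,T)\times\Omega)$. Its norm is $\|\partial_tI_0^{1-\alpha}u\|_{L_p}+\|u\|_{L_p}+\|D_xu\|_{L_p}$. $\mathbb H_{p,0}^{\alpha,1}((0,T)\times\Omega)$ is the set of $u\in\mathbb H_p^{\alpha,1}((0,T)\times\Omega)$ that are limits in this norm of functions $u_n\in C^\infty([0,T]\times\Omega)$ which vanish for large $|x|$ and satisfy $u_n(0,x)=0$. For such $u$, $\partial_t^\alpha u=\partial_tI_0^{1-\alpha}u$. *)

theory Defs
  imports "HOL-Analysis.Analysis"
begin

definition Lp_space :: "real \<Rightarrow> 'z::euclidean_space set \<Rightarrow> ('z \<Rightarrow> 'b::euclidean_space) set" where
  "Lp_space p D = {f. f \<in> borel_measurable (lebesgue_on D) \<and>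
     integrable (lebesgue_on D) (\<lambda>z. norm (f z) powr p)}"

text \<open>The Bochner integral of a non-integrable function is 0, so this is the norm of
  \<open>f\<close> only when \<open>f \<in> Lp_space p D\<close>.\<close>

definition Lp_norm :: "real \<Rightarrow> 'z::euclidean_space set \<Rightarrow> ('z \<Rightarrow> 'b::euclidean_space) \<Rightarrow> real" where
  "Lp_norm p D f = (LINT z|lebesgue_on D. norm (f z) powr p) powr (1 / p)"

text \<open>Derivatives are taken within \<open>S\<close>, so on sets such as \<open>{0..<T} \<times> \<Omega>\<close>
  smoothness extends up to the part of the boundary contained in \<open>S\<close>; on the sets used
  below such derivatives are unique.\<close>

primrec Ck_on :: "nat \<Rightarrow> 'z::euclidean_space set \<Rightarrow> ('z \<Rightarrow> real) \<Rightarrow> bool" where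
  "Ck_on 0 S f = continuous_on S f"
| "Ck_on (Suc k) S f = (\<exists>f'. (\<forall>z\<in>S. (f has_derivative f' z) (at z within S)) \<and>
     (\<forall>v. Ck_on k S (\<lambda>z. f' z v)))"

definition smooth_functions :: "'z::euclidean_space set \<Rightarrow> ('z \<Rightarrow> real) set" where
  "smooth_functions S = {f. \<forall>k. Ck_on k S f}"

text \<open>Values outside \<open>S\<close> are irrelevant: the support is that of \<open>f\<close> restricted to \<open>S\<close>.\<close>

definition test_functions :: "'z::euclidean_space set \<Rightarrow> ('z \<Rightarrow> real) set" where
  "test_functions S = {f \<in> smooth_functions S.
     compact (closure {z \<in> S. f z \<noteq> 0}) \<and> closure {z \<in> S. f z \<noteq> 0} \<subseteq> S}"

definition cylinder :: "real \<Rightarrow> 'a::euclidean_space set \<Rightarrow> (real \<times> 'a) set" where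
  "cylinder T \<Omega> = {0<..<T} \<times> \<Omega>"

definition time_deriv :: "(real \<times> 'a \<Rightarrow> real) \<Rightarrow> real \<times> 'a \<Rightarrow> real" where
  "time_deriv \<phi> = (\<lambda>(t, x). deriv (\<lambda>s. \<phi> (s, x)) t)"

definition space_deriv ::
  "'a::euclidean_space \<Rightarrow> (real \<times> 'a \<Rightarrow> real) \<Rightarrow> real \<times> 'a \<Rightarrow> real" where
  "space_deriv b \<phi> = (\<lambda>(t, x). deriv (\<lambda>h. \<phi> (t, x + h *\<^sub>R b)) 0)"

text \<open>The fractional integral of order \<open>1 - \<alpha>\<close> in time, started at 0.\<close>

definition frac_integral :: "real \<Rightarrow> (real \<times> 'a \<Rightarrow> real) \<Rightarrow> real \<times> 'a \<Rightarrow> real" where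
  "frac_integral \<alpha> u = (\<lambda>(t, x).
     1 / Gamma (1 - \<alpha>) * (LINT s|lebesgue_on {0<..<t}. (t - s) powr (- \<alpha>) * u (s, x)))"

text \<open>Test functions need not vanish at \<open>t = 0\<close>.\<close>

definition has_frac_deriv :: "real \<Rightarrow> real \<Rightarrow> real \<Rightarrow> 'a::euclidean_space set \<Rightarrow>
    (real \<times> 'a \<Rightarrow> real) \<Rightarrow> (real \<times> 'a \<Rightarrow> real) \<Rightarrow> bool" where
  "has_frac_deriv p \<alpha> T \<Omega> u g \<longleftrightarrow> g \<in> Lp_space p (cylinder T \<Omega>) \<and>
     (\<forall>\<phi> \<in> test_functions ({0..<T} \<times> \<Omega>).
        (LINT z|lebesgue_on (cylinder T \<Omega>). g z * \<phi> z) =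
        - (LINT z|lebesgue_on (cylinder T \<Omega>). frac_integral \<alpha> u z * time_deriv \<phi> z))"

definition has_weak_gradient :: "real \<Rightarrow> real \<Rightarrow> 'a::euclidean_space set \<Rightarrow>
    (real \<times> 'a \<Rightarrow> real) \<Rightarrow> (real \<times> 'a \<Rightarrow> 'a) \<Rightarrow> bool" where
  "has_weak_gradient p T \<Omega> u G \<longleftrightarrow> G \<in> Lp_space p (cylinder T \<Omega>) \<and>
     (\<forall>\<phi> \<in> test_functions (cylinder T \<Omega>). \<forall>b \<in> Basis.
        (LINT z|lebesgue_on (cylinder T \<Omega>). (G z \<bullet> b) * \<phi> z) =
        - (LINT z|lebesgue_on (cylinder T \<Omega>). u z * space_deriv b \<phi> z))"

text \<open>The two weak derivatives are unique up to null sets; \<open>SOME\<close> picks a representative.\<close>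

definition frac_deriv :: "real \<Rightarrow> real \<Rightarrow> real \<Rightarrow> 'a::euclidean_space set \<Rightarrow>
    (real \<times> 'a \<Rightarrow> real) \<Rightarrow> real \<times> 'a \<Rightarrow> real" where
  "frac_deriv p \<alpha> T \<Omega> u = (SOME g. has_frac_deriv p \<alpha> T \<Omega> u g)"

definition weak_gradient :: "real \<Rightarrow> real \<Rightarrow> 'a::euclidean_space set \<Rightarrow>
    (real \<times> 'a \<Rightarrow> real) \<Rightarrow> real \<times> 'a \<Rightarrow> 'a" where
  "weak_gradient p T \<Omega> u = (SOME G. has_weak_gradient p T \<Omega> u G)"

definition H_space :: "real \<Rightarrow> real \<Rightarrow> real \<Rightarrow> 'a::euclidean_space set \<Rightarrow>
    (real \<times> 'a \<Rightarrow> real) set" where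
  "H_space p \<alpha> T \<Omega> = {u \<in> Lp_space p (cylinder T \<Omega>).
     (\<exists>G. has_weak_gradient p T \<Omega> u G) \<and> (\<exists>g. has_frac_deriv p \<alpha> T \<Omega> u g)}"

definition H_norm :: "real \<Rightarrow> real \<Rightarrow> real \<Rightarrow> 'a::euclidean_space set \<Rightarrow>
    (real \<times> 'a \<Rightarrow> real) \<Rightarrow> real" where
  "H_norm p \<alpha> T \<Omega> u = Lp_norm p (cylinder T \<Omega>) (frac_deriv p \<alpha> T \<Omega> u)
     + Lp_norm p (cylinder T \<Omega>) u + Lp_norm p (cylinder T \<Omega>) (weak_gradient p T \<Omega> u)"

text \<open>The approximants are required to lie in \<open>H_space\<close>, so that the norm of the difference is
  meaningful; for \<open>\<Omega> = UNIV\<close> this follows from the other conditions.\<close>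

definition H0_space :: "real \<Rightarrow> real \<Rightarrow> real \<Rightarrow> 'a::euclidean_space set \<Rightarrow>
    (real \<times> 'a \<Rightarrow> real) set" where
  "H0_space p \<alpha> T \<Omega> = {u \<in> H_space p \<alpha> T \<Omega>. \<exists>v :: nat \<Rightarrow> real \<times> 'a \<Rightarrow> real.
     (\<forall>n. v n \<in> H_space p \<alpha> T \<Omega> \<and>
          v n \<in> smooth_functions ({0..T} \<times> \<Omega>) \<and>
          (\<exists>R. \<forall>t\<in>{0..T}. \<forall>x\<in>\<Omega>. norm x > R \<longrightarrow> v n (t, x) = 0) \<and>
          (\<forall>x\<in>\<Omega>. v n (0, x) = 0)) \<and>
     (\<lambda>n. H_norm p \<alpha> T \<Omega> (\<lambda>z. v n z - u z)) \<longlonglongrightarrow> 0}"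

end

theory Submission
  imports Defs
begin

text \<open>
  Fix \<open>x\<close>. Since \<open>\<psi>\<close> starts from zero, it is the Riemann-Liouville integral of order \<open>\<alpha>\<close> of
  \<open>\<partial>\<^sub>t\<^sup>\<alpha>\<psi>\<close>, and as \<open>\<alpha> p > 1\<close> the kernel \<open>s \<mapsto> s powr (\<alpha> - 1)\<close> lies in the dual Lebesgue space on \<open>(0, T)\<close>. The
  Hoelder inequality in time therefore gives
  \<open>sup\<^sub>t |\<psi>(t,x)| \<le> K T powr (\<alpha> - 1/p) F(x) powr (1/p)\<close> with \<open>F(x) = \<integral> |\<partial>\<^sub>t\<^sup>\<alpha>\<psi>(s,x)| powr p ds\<close>
  (\<open>RL_bound\<close>). Writing \<open>|\<psi>| powr q = |\<psi>| powr (q - p) * |\<psi>| powr p\<close> and spending this bound on the first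
  factor leaves, for each \<open>t\<close>, the spatial integral of \<open>F powr ((q-p)/p) * |\<psi>(t,\<cdot>)| powr p\<close>. With
  \<open>P = dp/(d-p)\<close> the second factor is split into powers of \<open>|\<psi>| powr p\<close> and \<open>|\<psi>| powr P\<close> so that
  the three exponents add up to 1; the Hoelder inequality in \<open>x\<close>, the Sobolev inequality
  for the \<open>L\<^sub>P\<close> part and the Hoelder inequality in \<open>t\<close> finish the proof for smooth functions
  (\<open>interpolation_inequality\<close>). The number \<open>\<theta>\<close> is the exponent that the gradient receives.

  The Sobolev inequality is proved in the manner of Gagliardo: a function is bounded by
  the integral of its derivative along each coordinate line, and the product of these \<open>d\<close> bounds
  is integrated one coordinate at a time (\<open>marginal_prod_le\<close>). All these estimates are carried out
  with integrals of extended nonnegative functions, which are allowed to be infinite.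

  The weak derivatives in the statement are arbitrary representatives. For a smooth approximant
  they agree almost everywhere with the classical ones (\<open>frac_deriv_unique\<close>,
  \<open>weak_gradient_unique\<close>), which follows from a fundamental lemma based on explicit smooth
  cut-off functions. Since weak derivatives are additive, those of an approximant are those of \<open>\<psi>\<close>
  plus those of a difference that is small in norm, and Fatou's lemma transfers the
  inequality to \<open>\<psi>\<close> (\<open>interpolation_inequality_H0\<close>).
\<close>

section \<open>Real powers of extended nonnegative reals and the Hoelder inequality\<close>

text \<open>The convention \<open>x\<^sup>0 = 1\<close>, also for \<open>x = 0\<close> and \<open>x = \<infinity>\<close>, lets a factor with exponent
  \<open>0\<close> drop out of the Hoelder inequality below.\<close>

definition epow :: "ennreal \<Rightarrow> real \<Rightarrow> ennreal" where
  "epow x a = (if a = 0 then 1 else if x = \<infinity> then \<infinity> else ennreal (enn2real x powr a))"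

lemma epow_0 [simp]: "epow x 0 = 1"
  by (simp add: epow_def)

lemma epow_ennreal: "0 < a \<Longrightarrow> 0 \<le> x \<Longrightarrow> epow (ennreal x) a = ennreal (x powr a)"
  by (simp add: epow_def)

lemma epow_ennreal_pos: "0 < x \<Longrightarrow> 0 \<le> a \<Longrightarrow> epow (ennreal x) a = ennreal (x powr a)"
  by (cases "a = 0") (auto simp: epow_ennreal)

lemma epow_1 [simp]: "epow x 1 = x"
  by (cases x) (auto simp: epow_def)

lemma epow_one [simp]: "epow 1 a = 1"
  by (simp add: epow_def)

lemma epow_zero [simp]: "a \<noteq> 0 \<Longrightarrow> epow 0 a = 0"
  by (simp add: epow_def)

lemma epow_top [simp]: "a \<noteq> 0 \<Longrightarrow> epow top a = top"
  by (simp add: epow_def)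

lemma epow_eq_0_iff: "a \<noteq> 0 \<Longrightarrow> epow x a = 0 \<longleftrightarrow> x = 0"
  by (cases x) (auto simp: epow_def)

lemma epow_mono: "x \<le> y \<Longrightarrow> 0 \<le> a \<Longrightarrow> epow x a \<le> epow y a"
  by (cases x; cases y) (auto simp: epow_def top_unique intro!: ennreal_leI powr_mono2)

lemma epow_mult: "0 \<le> a \<Longrightarrow> epow (x * y) a = epow x a * epow y a"
  by (cases x; cases y)
     (auto simp: epow_def powr_mult ennreal_top_mult ennreal_mult_top simp flip: ennreal_mult)

lemma epow_epow: "0 \<le> a \<Longrightarrow> 0 \<le> b \<Longrightarrow> epow (epow x a) b = epow x (a * b)"
  by (cases x) (auto simp: epow_def powr_powr)

lemma epow_add: "0 \<le> a \<Longrightarrow> 0 \<le> b \<Longrightarrow> epow x (a + b) = epow x a * epow x b"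
  by (cases x) (auto simp: epow_def powr_add ennreal_mult'')

lemma measurable_epow [measurable (raw)]:
  "f \<in> borel_measurable M \<Longrightarrow> (\<lambda>x. epow (f x) a) \<in> borel_measurable M"
proof -
  assume [measurable]: "f \<in> borel_measurable M"
  have "f -` {\<infinity>} \<inter> space M \<in> sets M" by measurable
  then have [measurable]: "Measurable.pred M (\<lambda>x. f x = \<infinity>)"
    by (simp add: pred_def vimage_def Int_def conj_commute)
  show ?thesis
    by (cases "a = 0") (simp_all add: epow_def)
qed

text \<open>When both integrals are finite and positive, this is the weighted arithmetic-geometric mean
  inequality for the normalised functions; the degenerate cases are consistent with
  \<open>0 * \<infinity> = 0\<close>.\<close>

lemma nn_integral_Holder2:
  assumes [measurable]: "f \<in> borel_measurable M" "g \<in> borel_measurable M"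
    and ab: "0 < a" "0 < b" "a + b = 1"
  shows "(\<integral>\<^sup>+x. epow (f x) a * epow (g x) b \<partial>M) \<le> epow (\<integral>\<^sup>+x. f x \<partial>M) a * epow (\<integral>\<^sup>+x. g x \<partial>M) b"
proof -
  consider "(\<integral>\<^sup>+x. f x \<partial>M) = 0" | "(\<integral>\<^sup>+x. g x \<partial>M) = 0"
    | "(\<integral>\<^sup>+x. f x \<partial>M) \<noteq> 0" "(\<integral>\<^sup>+x. g x \<partial>M) \<noteq> 0"
      "(\<integral>\<^sup>+x. f x \<partial>M) = \<infinity> \<or> (\<integral>\<^sup>+x. g x \<partial>M) = \<infinity>"
    | A B where "A > 0" "B > 0" "(\<integral>\<^sup>+x. f x \<partial>M) = ennreal A" "(\<integral>\<^sup>+x. g x \<partial>M) = ennreal B"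
    by (cases "\<integral>\<^sup>+x. f x \<partial>M"; cases "\<integral>\<^sup>+x. g x \<partial>M")
       (force simp: ennreal_eq_0_iff not_le)+
  then show ?thesis
  proof cases
    case 1
    then have "AE x in M. f x = 0" by (simp add: nn_integral_0_iff_AE)
    then have "(\<integral>\<^sup>+x. epow (f x) a * epow (g x) b \<partial>M) = (\<integral>\<^sup>+x. 0 \<partial>M)"
      using ab by (intro nn_integral_cong_AE) (auto elim!: eventually_mono)
    then show ?thesis by simp
  next
    case 2
    then have "AE x in M. g x = 0" by (simp add: nn_integral_0_iff_AE)
    then have "(\<integral>\<^sup>+x. epow (f x) a * epow (g x) b \<partial>M) = (\<integral>\<^sup>+x. 0 \<partial>M)"
      using ab by (intro nn_integral_cong_AE) (auto elim!: eventually_mono)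
    then show ?thesis by simp
  next
    case 3
    then have "epow (\<integral>\<^sup>+x. f x \<partial>M) a * epow (\<integral>\<^sup>+x. g x \<partial>M) b = \<infinity>"
      using ab by (auto simp: epow_eq_0_iff ennreal_top_mult ennreal_mult_top)
    then show ?thesis by simp
  next
    case (4 A B)
    let ?K = "ennreal (A powr a * B powr b)"
    have K: "0 < A powr a * B powr b" using 4 by simp
    have pw: "epow (f x) a * epow (g x) b \<le> ?K * (ennreal (a / A) * f x + ennreal (b / B) * g x)" for x
    proof (cases "f x = \<infinity> \<or> g x = \<infinity>")
      case True
      have "ennreal (a / A) \<noteq> 0" "ennreal (b / B) \<noteq> 0" using 4 ab by auto
      then have "?K * (ennreal (a / A) * f x + ennreal (b / B) * g x) = \<infinity>"
        using True K by (auto simp: ennreal_mult_top ennreal_mult_eq_top_iff)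
      then show ?thesis by simp
    next
      case False
      then obtain u v where u: "f x = ennreal u" "u \<ge> 0" and v: "g x = ennreal v" "v \<ge> 0"
        by (cases "f x"; cases "g x") auto
      have "u powr a * v powr b \<le> (A powr a * B powr b) * (a / A * u + b / B * v)"
      proof (cases "u = 0 \<or> v = 0")
        case False
        then have "(u/A) powr a * (v/B) powr b \<le> a * (u/A) + b * (v/B)"
          using ab 4 u v by (intro Youngs_inequality_0) auto
        then show ?thesis using 4 u v by (simp add: powr_divide field_simps)
      qed (use ab 4 u v in auto)
      then have "ennreal (u powr a * v powr b) \<le> ennreal ((A powr a * B powr b) * (a / A * u + b / B * v))"
        by (rule ennreal_leI)
      then show ?thesis using u v ab 4
        by (simp add: epow_ennreal flip: ennreal_plus ennreal_mult)
    qed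
    have "(\<integral>\<^sup>+x. epow (f x) a * epow (g x) b \<partial>M) \<le> (\<integral>\<^sup>+x. ?K * (ennreal (a / A) * f x + ennreal (b / B) * g x) \<partial>M)"
      by (intro nn_integral_mono pw)
    also have "\<dots> = ?K * (ennreal (a / A) * ennreal A + ennreal (b / B) * ennreal B)"
      by (simp add: nn_integral_cmult nn_integral_add 4)
    also have "\<dots> = ?K"
      using 4 ab by (simp flip: ennreal_mult ennreal_plus)
    also have "\<dots> = epow (\<integral>\<^sup>+x. f x \<partial>M) a * epow (\<integral>\<^sup>+x. g x \<partial>M) b"
      using 4 ab by (simp add: epow_ennreal ennreal_mult)
    finally show ?thesis .
  qed
qed

lemma nn_integral_Holder:
  assumes "finite J" "\<And>i. i \<in> J \<Longrightarrow> f i \<in> borel_measurable M"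
    and "\<And>i. i \<in> J \<Longrightarrow> 0 \<le> a i" "(\<Sum>i\<in>J. a i) = 1"
  shows "(\<integral>\<^sup>+x. (\<Prod>i\<in>J. epow (f i x) (a i)) \<partial>M) \<le> (\<Prod>i\<in>J. epow (\<integral>\<^sup>+x. f i x \<partial>M) (a i))"
  using assms
proof (induction J arbitrary: a)
  case empty
  then show ?case by simp
next
  case (insert j J)
  note [measurable] = insert.prems(1)
  have s: "a j + (\<Sum>i\<in>J. a i) = 1" using insert by simp
  have s0: "(\<Sum>i\<in>J. a i) \<ge> 0" using insert by (intro sum_nonneg) auto
  consider "a j = 0" | "a j = 1" | "0 < a j" "a j < 1"
    using s s0 insert.prems(2)[of j] by fastforce
  then show ?case
  proof cases
    case 1
    then show ?thesis using insert s by simp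
  next
    case 2
    then have "\<forall>i\<in>J. a i = 0"
      using s insert.prems by (subst sum_nonneg_eq_0_iff[symmetric]) (use insert in auto)
    then show ?thesis using insert 2 by simp
  next
    case 3
    define b where "b = 1 - a j"
    have b: "b > 0" "a j + b = 1" "(\<Sum>i\<in>J. a i) = b" using 3 s by (auto simp: b_def)
    have fold: "(\<Prod>i\<in>J. epow (h i) (a i)) = epow (\<Prod>i\<in>J. epow (h i) (a i / b)) b" for h
    proof -
      have "epow (\<Prod>i\<in>I. epow (h i) (a i / b)) b = (\<Prod>i\<in>I. epow (epow (h i) (a i / b)) b)" if "finite I" for I
        using that by (induction I) (use b in \<open>auto simp: epow_mult\<close>)
      moreover have "(\<Prod>i\<in>J. epow (epow (h i) (a i / b)) b) = (\<Prod>i\<in>J. epow (h i) (a i))"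
        using b insert by (intro prod.cong) (auto simp: epow_epow)
      ultimately show ?thesis using insert by simp
    qed
    have "(\<integral>\<^sup>+x. (\<Prod>i\<in>insert j J. epow (f i x) (a i)) \<partial>M)
        = (\<integral>\<^sup>+x. epow (f j x) (a j) * epow (\<Prod>i\<in>J. epow (f i x) (a i / b)) b \<partial>M)"
      using insert by (simp add: fold)
    also have "\<dots> \<le> epow (\<integral>\<^sup>+x. f j x \<partial>M) (a j) * epow (\<integral>\<^sup>+x. (\<Prod>i\<in>J. epow (f i x) (a i / b)) \<partial>M) b"
      using 3 b insert.hyps by (intro nn_integral_Holder2) auto
    also have "\<dots> \<le> epow (\<integral>\<^sup>+x. f j x \<partial>M) (a j) * epow (\<Prod>i\<in>J. epow (\<integral>\<^sup>+x. f i x \<partial>M) (a i / b)) b"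
    proof (intro mult_left_mono epow_mono insert.IH)
      show "(\<Sum>i\<in>J. a i / b) = 1" using b by (simp flip: sum_divide_distrib)
    qed (use b insert.prems in auto)
    also have "\<dots> = (\<Prod>i\<in>insert j J. epow (\<integral>\<^sup>+x. f i x \<partial>M) (a i))"
      using insert by (simp add: fold)
    finally show ?thesis .
  qed
qed

lemma nn_integral_Holder3:
  assumes [measurable]: "f \<in> borel_measurable M" "g \<in> borel_measurable M" "k \<in> borel_measurable M"
    and abc: "0 \<le> a" "0 \<le> b" "0 \<le> c" "a + b + c = 1"
  shows "(\<integral>\<^sup>+x. epow (f x) a * (epow (g x) b * epow (k x) c) \<partial>M) \<le>
    epow (\<integral>\<^sup>+x. f x \<partial>M) a * (epow (\<integral>\<^sup>+x. g x \<partial>M) b * epow (\<integral>\<^sup>+x. k x \<partial>M) c)"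
proof -
  let ?F = "\<lambda>i::nat. if i = 0 then f else if i = 1 then g else k"
  let ?e = "\<lambda>i::nat. if i = 0 then a else if i = 1 then b else c"
  have "(\<integral>\<^sup>+x. (\<Prod>i\<in>{0, 1, 2}. epow (?F i x) (?e i)) \<partial>M) \<le> (\<Prod>i\<in>{0, 1, 2}. epow (\<integral>\<^sup>+x. ?F i x \<partial>M) (?e i))"
    by (rule nn_integral_Holder) (use abc in auto)
  then show ?thesis by simp
qed

section \<open>Marginals and the Loomis-Whitney inequality\<close>

text \<open>A marginal is kept as a function on the whole space, constant in the coordinates of \<open>S\<close>, so
  that marginals over different sets can be multiplied pointwise.\<close>

definition marginal :: "'a::euclidean_space set \<Rightarrow> ('a \<Rightarrow> ennreal) \<Rightarrow> 'a \<Rightarrow> ennreal" where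
  "marginal S f x =
     (\<integral>\<^sup>+y. f (\<Sum>b\<in>Basis. (if b \<in> S then y b else x \<bullet> b) *\<^sub>R b) \<partial>(\<Pi>\<^sub>M b\<in>S. lborel))"

interpretation lborel_product: product_sigma_finite "\<lambda>_. lborel :: real measure"
  by standard

lemma measurable_marginal [measurable (raw)]:
  assumes [measurable]: "f \<in> borel_measurable borel" and S: "finite S"
  shows "marginal S f \<in> borel_measurable borel"
proof -
  interpret finite_product_sigma_finite "\<lambda>_. lborel :: real measure" S by standard (rule S)
  have [measurable]: "(\<lambda>z. (if b \<in> S then snd z b else fst z \<bullet> b) *\<^sub>R b)
      \<in> borel_measurable (borel \<Otimes>\<^sub>M (\<Pi>\<^sub>M b\<in>S. lborel))" for b :: 'a
    by (cases "b \<in> S") (simp_all, measurable)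
  have "(\<lambda>z. f (\<Sum>b\<in>Basis. (if b \<in> S then snd z b else fst z \<bullet> b) *\<^sub>R b))
      \<in> borel_measurable (borel \<Otimes>\<^sub>M (\<Pi>\<^sub>M b\<in>S. lborel))"
    by measurable
  then show ?thesis
    unfolding marginal_def[abs_def]
    by (intro borel_measurable_nn_integral) (simp add: case_prod_beta)
qed

lemma marginal_empty [simp]: "marginal {} f x = f x"
  by (simp add: marginal_def PiM_empty nn_integral_count_space_finite euclidean_representation)

lemma marginal_Basis:
  fixes f :: "'a::euclidean_space \<Rightarrow> ennreal"
  assumes [measurable]: "f \<in> borel_measurable borel"
  shows "marginal Basis f x = (\<integral>\<^sup>+y. f y \<partial>lborel)"
proof -
  have "(\<integral>\<^sup>+y. f y \<partial>lborel) = (\<integral>\<^sup>+y. f (\<Sum>b\<in>Basis. y b *\<^sub>R b) \<partial>(\<Pi>\<^sub>M b\<in>(Basis :: 'a set). lborel))"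
    by (subst lborel_eq, subst nn_integral_distr) auto
  then show ?thesis by (simp add: marginal_def cong: sum.cong)
qed

lemma marginal_insert:
  fixes f :: "'a::euclidean_space \<Rightarrow> ennreal"
  assumes [measurable]: "f \<in> borel_measurable borel"
    and S: "finite S" "j \<notin> S" and j: "j \<in> Basis"
  shows "marginal (insert j S) f x = (\<integral>\<^sup>+t. marginal S f (x + (t - x \<bullet> j) *\<^sub>R j) \<partial>lborel)"
proof -
  have [measurable]: "(\<lambda>y. (if b \<in> insert j S then y b else x \<bullet> b) *\<^sub>R b)
      \<in> borel_measurable (\<Pi>\<^sub>M b\<in>insert j S. lborel)" for b :: 'a
    by (cases "b \<in> insert j S") (simp_all, measurable)
  have meas: "(\<lambda>y. f (\<Sum>b\<in>Basis. (if b \<in> insert j S then y b else x \<bullet> b) *\<^sub>R b))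
      \<in> borel_measurable (\<Pi>\<^sub>M b\<in>insert j S. lborel)"
    by measurable
  have "marginal (insert j S) f x =
      (\<integral>\<^sup>+t. \<integral>\<^sup>+y. f (\<Sum>b\<in>Basis. (if b \<in> insert j S then (y(j := t)) b else x \<bullet> b) *\<^sub>R b)
         \<partial>(\<Pi>\<^sub>M b\<in>S. lborel) \<partial>lborel)"
    unfolding marginal_def
    by (rule lborel_product.product_nn_integral_insert_rev[OF S meas])
  also have "\<dots> = (\<integral>\<^sup>+t. marginal S f (x + (t - x \<bullet> j) *\<^sub>R j) \<partial>lborel)"
    unfolding marginal_def using S j
    by (intro nn_integral_cong arg_cong[where f = f] sum.cong)
       (auto simp: inner_simps inner_Basis)
  finally show ?thesis .
qed

lemma marginal_shift:
  assumes "j \<in> S" "j \<in> Basis"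
  shows "marginal S f (x + c *\<^sub>R j) = marginal S f x"
  unfolding marginal_def using assms
  by (intro nn_integral_cong arg_cong[where f = f] sum.cong) (auto simp: inner_simps inner_Basis)

text \<open>Integrating out one more coordinate \<open>j\<close> leaves the factor that already ignores \<open>j\<close>
  untouched; the remaining \<open>n - 1\<close> factors carry exponents adding up to \<open>1\<close>, so the Hoelder
  inequality applies.\<close>

lemma marginal_prod_le:
  fixes f :: "'a::euclidean_space \<Rightarrow> ennreal"
  assumes f [measurable]: "f \<in> borel_measurable borel" and dim: "DIM('a) \<ge> 2"
    and S: "S \<subseteq> Basis"
  defines "a \<equiv> 1 / (real DIM('a) - 1)"
  shows "marginal S (\<lambda>y. \<Prod>i\<in>Basis. epow (marginal {i} f y) a) x
    \<le> epow (marginal S f x) (real (card S) * a) * (\<Prod>i\<in>Basis - S. epow (marginal (insert i S) f x) a)"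
proof -
  have "finite S" by (rule finite_subset[OF S finite_Basis])
  then show ?thesis using S
  proof (induction S arbitrary: x)
    case empty
    then show ?case by simp
  next
    case (insert j S)
    have a0: "0 \<le> a" using dim by (simp add: a_def)
    have j: "j \<in> Basis" "j \<notin> S" and SB: "S \<subseteq> Basis" and fS: "finite S" using insert by auto
    have fin: "finite (insert i S)" for i using fS by simp
    note [measurable] = measurable_marginal[OF f fS] measurable_marginal[OF f fin]
    define P where "P = (\<lambda>t. x + (t - x \<bullet> j) *\<^sub>R j)"
    have [measurable]: "P \<in> borel_measurable borel" unfolding P_def by measurable
    define F where "F = (\<lambda>i t. if i = j then marginal S f (P t) else marginal (insert i S) f (P t))"
    define A where "A = (\<lambda>i. if i = j then real (card S) * a else a)"
    have [measurable]: "F i \<in> borel_measurable borel" for i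
      unfolding F_def by (cases "i = j") (simp_all, measurable)
    have B: "Basis - S = insert j (Basis - insert j S)" using j by auto
    have cB: "card (Basis - insert j S) = DIM('a) - Suc (card S)"
      using j SB fS by (subst card_Diff_subset) auto
    have cS: "Suc (card S) \<le> DIM('a)"
      using card_mono[of Basis "insert j S"] j SB fS by auto
    have sumA: "(\<Sum>i\<in>Basis - S. A i) = 1"
    proof -
      have "(\<Sum>i\<in>Basis - S. A i) = real (card S) * a + (\<Sum>i\<in>Basis - insert j S. A i)"
        by (subst B, subst sum.insert) (auto simp: A_def)
      also have "(\<Sum>i\<in>Basis - insert j S. A i) = real (DIM('a) - Suc (card S)) * a"
        by (simp add: A_def flip: cB cong: sum.cong) (auto intro!: sum.cong simp flip: sum_constant)
      also have "real (card S) * a + real (DIM('a) - Suc (card S)) * a = (real DIM('a) - 1) * a"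
        using cS by (simp add: of_nat_diff algebra_simps)
      also have "\<dots> = 1" using dim by (simp add: a_def)
      finally show ?thesis .
    qed
    have intF: "(\<integral>\<^sup>+t. F i t \<partial>lborel) =
        (if i = j then marginal (insert j S) f x else marginal (insert i (insert j S)) f x)"
      if "i \<in> Basis - S" for i
    proof (cases "i = j")
      case True
      then show ?thesis using marginal_insert[OF f fS j(2) j(1)] by (simp add: F_def P_def)
    next
      case False
      then have "marginal (insert j (insert i S)) f x = (\<integral>\<^sup>+t. F i t \<partial>lborel)"
        using marginal_insert[OF f fin, of j i x] j by (simp add: F_def P_def)
      then show ?thesis using False by (simp add: insert_commute)
    qed
    have "marginal (insert j S) (\<lambda>y. \<Prod>i\<in>Basis. epow (marginal {i} f y) a) x
        = (\<integral>\<^sup>+t. marginal S (\<lambda>y. \<Prod>i\<in>Basis. epow (marginal {i} f y) a) (P t) \<partial>lborel)"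
      unfolding P_def
      by (rule marginal_insert) (use j fS in \<open>auto intro!: borel_measurable_prod_ennreal measurable_epow measurable_marginal f\<close>)
    also have "\<dots> \<le> (\<integral>\<^sup>+t. epow (marginal S f (P t)) (real (card S) * a) *
        (\<Prod>i\<in>Basis - S. epow (marginal (insert i S) f (P t)) a) \<partial>lborel)"
      by (intro nn_integral_mono insert.IH SB)
    also have "\<dots> = (\<integral>\<^sup>+t. epow (marginal (insert j S) f x) a * (\<Prod>i\<in>Basis - S. epow (F i t) (A i)) \<partial>lborel)"
    proof (intro nn_integral_cong)
      fix t
      have "marginal (insert j S) f (P t) = marginal (insert j S) f x"
        unfolding P_def by (rule marginal_shift) (use j in auto)
      then have "(\<Prod>i\<in>Basis - S. epow (marginal (insert i S) f (P t)) a) =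
          epow (marginal (insert j S) f x) a * (\<Prod>i\<in>Basis - insert j S. epow (marginal (insert i S) f (P t)) a)"
        by (subst B, subst prod.insert) auto
      moreover have "(\<Prod>i\<in>Basis - S. epow (F i t) (A i)) = epow (marginal S f (P t)) (real (card S) * a) *
          (\<Prod>i\<in>Basis - insert j S. epow (marginal (insert i S) f (P t)) a)"
        by (subst B, subst prod.insert) (auto simp: F_def A_def intro!: arg_cong2[where f = times] prod.cong)
      ultimately show "epow (marginal S f (P t)) (real (card S) * a) *
        (\<Prod>i\<in>Basis - S. epow (marginal (insert i S) f (P t)) a) =
        epow (marginal (insert j S) f x) a * (\<Prod>i\<in>Basis - S. epow (F i t) (A i))"
        by (simp add: mult.left_commute)
    qed
    also have "\<dots> = epow (marginal (insert j S) f x) a * (\<integral>\<^sup>+t. (\<Prod>i\<in>Basis - S. epow (F i t) (A i)) \<partial>lborel)"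
      by (intro nn_integral_cmult borel_measurable_prod_ennreal) measurable
    also have "\<dots> \<le> epow (marginal (insert j S) f x) a * (\<Prod>i\<in>Basis - S. epow (\<integral>\<^sup>+t. F i t \<partial>lborel) (A i))"
      by (intro mult_left_mono nn_integral_Holder sumA) (use a0 in \<open>auto simp: A_def\<close>)
    also have "(\<Prod>i\<in>Basis - S. epow (\<integral>\<^sup>+t. F i t \<partial>lborel) (A i)) =
        epow (marginal (insert j S) f x) (real (card S) * a) *
        (\<Prod>i\<in>Basis - insert j S. epow (marginal (insert i (insert j S)) f x) a)"
      using j by (subst B, subst prod.insert)
        (auto simp: intF A_def intro!: arg_cong2[where f = times] prod.cong)
    also have "epow (marginal (insert j S) f x) a * (epow (marginal (insert j S) f x) (real (card S) * a) *
        (\<Prod>i\<in>Basis - insert j S. epow (marginal (insert i (insert j S)) f x) a)) =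
        epow (marginal (insert j S) f x) (real (card (insert j S)) * a) *
        (\<Prod>i\<in>Basis - insert j S. epow (marginal (insert i (insert j S)) f x) a)"
      using a0 fS j by (simp add: epow_add distrib_right mult.assoc)
    finally show ?case .
  qed
qed

text \<open>The Sobolev inequality with exponent 1, in the form in which the derivative enters only
  through the integrals of \<open>f\<close> along the coordinate lines.\<close>

lemma nn_integral_epow_le_of_marginals:
  fixes f w :: "'a::euclidean_space \<Rightarrow> ennreal"
  assumes f [measurable]: "f \<in> borel_measurable borel" and dim: "DIM('a) \<ge> 2"
    and w: "\<And>x b. b \<in> Basis \<Longrightarrow> w x \<le> marginal {b} f x"
  defines "m \<equiv> real DIM('a) / (real DIM('a) - 1)"
  shows "(\<integral>\<^sup>+x. epow (w x) m \<partial>lborel) \<le> epow (\<integral>\<^sup>+x. f x \<partial>lborel) m"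
proof -
  define a where "a = 1 / (real DIM('a) - 1)"
  have a0: "0 \<le> a" and m: "m = real DIM('a) * a" using dim by (auto simp: a_def m_def)
  have pow: "epow (w x) (real k * a) = epow (w x) a ^ k" for x k
    by (induction k) (use a0 in \<open>auto simp: epow_add distrib_right\<close>)
  have "epow (w x) m \<le> (\<Prod>i\<in>Basis. epow (marginal {i} f x) a)" for x
  proof -
    have "epow (w x) m = (\<Prod>i\<in>(Basis::'a set). epow (w x) a)" by (simp add: m pow)
    also have "\<dots> \<le> (\<Prod>i\<in>Basis. epow (marginal {i} f x) a)"
    proof -
      have "(\<Prod>i\<in>I. epow (w x) a) \<le> (\<Prod>i\<in>I. epow (marginal {i} f x) a)" if "I \<subseteq> Basis" for I
        using finite_subset[OF that finite_Basis] that
        by (induction I) (auto intro!: mult_mono epow_mono w a0 simp del: prod_constant)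
      then show ?thesis by blast
    qed
    finally show ?thesis .
  qed
  then have "(\<integral>\<^sup>+x. epow (w x) m \<partial>lborel) \<le> (\<integral>\<^sup>+x. (\<Prod>i\<in>Basis. epow (marginal {i} f x) a) \<partial>lborel)"
    by (intro nn_integral_mono)
  also have "\<dots> = marginal Basis (\<lambda>x. \<Prod>i\<in>Basis. epow (marginal {i} f x) a) 0"
    by (rule marginal_Basis[symmetric])
       (auto intro!: borel_measurable_prod_ennreal measurable_epow measurable_marginal f)
  also have "\<dots> \<le> epow (\<integral>\<^sup>+x. f x \<partial>lborel) m"
    using marginal_prod_le[OF f dim, of Basis 0] by (simp add: marginal_Basis m a_def)
  finally show ?thesis .
qed

section \<open>The Sobolev inequality\<close>

lemma compact_continuous_abs_bound:
  fixes f :: "'a::euclidean_space \<Rightarrow> real"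
  assumes "compact K" "continuous_on K f"
  obtains M where "0 \<le> M" "\<And>x. x \<in> K \<Longrightarrow> \<bar>f x\<bar> \<le> M"
  using continuous_on_compact_bound[OF assms] by auto

lemma signed_powr_eq:
  assumes "0 < (e::real)"
  shows "sgn y * \<bar>y\<bar> powr e = (max y 0) powr e - (max (- y) 0) powr e"
  using assms by (cases "y > 0"; cases "y = 0") (auto simp: max_def sgn_if)

lemma continuous_on_signed_powr:
  assumes "0 < (e::real)"
  shows "continuous_on UNIV (\<lambda>y. sgn y * \<bar>y\<bar> powr e)"
  unfolding signed_powr_eq[OF assms]
  by (intro continuous_intros continuous_on_powr') (use assms in auto)

lemma has_real_derivative_abs_powr:
  assumes "1 < (c::real)"
  shows "((\<lambda>y. \<bar>y\<bar> powr c) has_real_derivative c * (sgn y * \<bar>y\<bar> powr (c - 1))) (at y)"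
proof -
  consider "y > 0" | "y < 0" | "y = 0" by linarith
  then show ?thesis
  proof cases
    case 1
    have "((\<lambda>y. y powr c) has_real_derivative c * (sgn y * \<bar>y\<bar> powr (c - 1))) (at y)"
      using 1 by (auto intro!: derivative_eq_intros)
    then show ?thesis
      by (rule has_field_derivative_transform_within_open[where S = "{0<..}"]) (use 1 in auto)
  next
    case 2
    have "((\<lambda>y. (- y) powr c) has_real_derivative c * (sgn y * \<bar>y\<bar> powr (c - 1))) (at y)"
      using 2 by (auto intro!: derivative_eq_intros)
    then show ?thesis
      by (rule has_field_derivative_transform_within_open[where S = "{..<0}"]) (use 2 in auto)
  next
    case 3
    have "isCont (\<lambda>y. sgn y * \<bar>y\<bar> powr (c - 1)) 0"
      using continuous_on_signed_powr[of "c - 1"] assms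
      by (auto simp: continuous_on_eq_continuous_at)
    then have *: "((\<lambda>y. sgn y * \<bar>y\<bar> powr (c - 1)) \<longlongrightarrow> 0) (at 0)"
      by (simp add: isCont_def)
    have eq: "sgn h * \<bar>h\<bar> powr (c - 1) = (\<bar>0 + h\<bar> powr c - \<bar>0\<bar> powr c) / h" if "h \<noteq> 0" for h :: real
      using that assms by (auto simp: powr_diff sgn_if)
    have "((\<lambda>h. (\<bar>0 + h\<bar> powr c - \<bar>0\<bar> powr c) / h) \<longlongrightarrow> 0) (at 0)"
      by (rule Lim_transform_within[OF * zero_less_one]) (use eq in auto)
    then show ?thesis using 3 by (simp add: DERIV_def)
  qed
qed

text \<open>The fundamental theorem of calculus along the coordinate line through \<open>x\<close>, starting outside the
  support; \<open>|u|\<^sup>c\<close> is differentiable everywhere because \<open>c > 1\<close>.\<close>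

lemma abs_powr_le_marginal:
  fixes u :: "'a::euclidean_space \<Rightarrow> real"
  assumes der: "\<And>x. (u has_derivative u' x) (at x)"
    and cont: "\<And>v. continuous_on UNIV (\<lambda>x. u' x v)"
    and supp: "\<And>x. R < norm x \<Longrightarrow> u x = 0"
    and D [measurable]: "D \<in> borel_measurable borel" "\<And>x b. b \<in> Basis \<Longrightarrow> \<bar>u' x b\<bar> \<le> D x"
    and c: "1 < c" and b: "b \<in> Basis"
  shows "ennreal (\<bar>u x\<bar> powr c) \<le> marginal {b} (\<lambda>x. ennreal (c * \<bar>u x\<bar> powr (c - 1) * D x)) x"
proof -
  have contu: "continuous_on UNIV u"
    by (intro continuous_at_imp_continuous_on ballI has_derivative_continuous[OF der])
  then have [measurable]: "u \<in> borel_measurable borel" by (rule borel_measurable_continuous_onI)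
  define P where "P = (\<lambda>t. x + (t - x \<bullet> b) *\<^sub>R b)"
  have P0: "P (x \<bullet> b) = x" by (simp add: P_def)
  have contP: "continuous_on UNIV P" unfolding P_def by (intro continuous_intros)
  define f where "f = (\<lambda>x. ennreal (c * \<bar>u x\<bar> powr (c - 1) * D x))"
  have [measurable]: "f \<in> borel_measurable borel" unfolding f_def by measurable
  define w where "w = (\<lambda>t. \<bar>u (P t)\<bar> powr c)"
  define w' where "w' = (\<lambda>t. c * (sgn (u (P t)) * \<bar>u (P t)\<bar> powr (c - 1)) * u' (P t) b)"
  have derP: "((\<lambda>t. u (P t)) has_real_derivative u' (P t) b) (at t)" for t
  proof -
    have 1: "(P has_derivative (\<lambda>h. h *\<^sub>R b)) (at t)"
      unfolding P_def by (auto intro!: derivative_eq_intros)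
    have "((\<lambda>t. u (P t)) has_derivative (\<lambda>h. u' (P t) (h *\<^sub>R b))) (at t)"
      by (rule has_derivative_compose[OF 1 der])
    moreover have "linear (u' (P t))" using der has_derivative_linear by blast
    ultimately show ?thesis
      by (simp add: has_field_derivative_def linear_cmul mult_commute_abs)
  qed
  have derw: "(w has_real_derivative w' t) (at t)" for t
    unfolding w_def w'_def
    by (rule DERIV_chain2[where f = "\<lambda>y. \<bar>y\<bar> powr c", OF has_real_derivative_abs_powr[OF c] derP])
  have contw': "continuous_on UNIV w'"
    unfolding w'_def
    by (intro continuous_intros continuous_on_compose2[OF continuous_on_signed_powr]
        continuous_on_compose2[OF contu contP] continuous_on_compose2[OF cont contP]) (use c in auto)
  have [measurable]: "w' \<in> borel_measurable borel" by (rule borel_measurable_continuous_onI[OF contw'])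
  define L where "L = \<bar>R\<bar> + 1 + \<bar>x \<bullet> b\<bar>"
  have "norm (P (- L)) \<ge> \<bar>P (- L) \<bullet> b\<bar>" using Basis_le_norm b by blast
  moreover have "P (- L) \<bullet> b = - L" using b by (simp add: P_def inner_simps)
  ultimately have "R < norm (P (- L))" unfolding L_def by linarith
  then have "w (- L) = 0" using c by (simp add: w_def supp)
  moreover have "has_bochner_integral lborel (\<lambda>t. w' t * indicator {- L .. x \<bullet> b} t) (w (x \<bullet> b) - w (- L))"
    by (rule has_bochner_integral_FTC_Icc_real)
       (use derw contw' in \<open>auto simp: L_def continuous_on_eq_continuous_at\<close>)
  ultimately have I: "has_bochner_integral lborel (\<lambda>t. w' t * indicator {- L .. x \<bullet> b} t) (\<bar>u x\<bar> powr c)"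
    by (simp add: w_def P0)
  have "ennreal (\<bar>u x\<bar> powr c) = ennreal (norm (LINT t|lborel. w' t * indicator {- L .. x \<bullet> b} t))"
    using I by (simp add: has_bochner_integral_iff)
  also have "\<dots> \<le> (\<integral>\<^sup>+t. norm (w' t * indicator {- L .. x \<bullet> b} t) \<partial>lborel)"
    by (rule integral_norm_bound_ennreal) (use I in \<open>simp add: has_bochner_integral_iff\<close>)
  also have "\<dots> \<le> (\<integral>\<^sup>+t. f (P t) \<partial>lborel)"
  proof (rule nn_integral_mono)
    fix t
    have "\<bar>w' t * indicator {- L .. x \<bullet> b} t\<bar> \<le> \<bar>w' t\<bar>"
      by (auto simp: indicator_def)
    also have "\<dots> \<le> c * \<bar>u (P t)\<bar> powr (c - 1) * \<bar>u' (P t) b\<bar>"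
      using c by (auto simp: w'_def abs_mult sgn_if)
    also have "\<dots> \<le> c * \<bar>u (P t)\<bar> powr (c - 1) * D (P t)"
      using D(2)[OF b] c by (intro mult_left_mono) auto
    finally show "ennreal (norm (w' t * indicator {- L .. x \<bullet> b} t)) \<le> f (P t)"
      unfolding f_def by (intro ennreal_leI) simp
  qed
  also have "\<dots> = marginal {b} f x"
    using marginal_insert[of f "{}" b x] b by (simp add: P_def)
  finally show ?thesis by (simp add: f_def)
qed

text \<open>Applying the exponent-1 inequality to \<open>|u|\<^sup>c\<close>, where \<open>c\<close> is chosen so that both sides contain
  the same power \<open>P\<close> of \<open>u\<close>, and then absorbing that power (which is finite) on the left.\<close>

lemma Sobolev_inequality:
  fixes u :: "'a::euclidean_space \<Rightarrow> real" and p :: real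
  assumes der: "\<And>x. (u has_derivative u' x) (at x)"
    and cont: "\<And>v. continuous_on UNIV (\<lambda>x. u' x v)"
    and supp: "\<And>x. R < norm x \<Longrightarrow> u x = 0"
    and D [measurable]: "D \<in> borel_measurable borel"
    and Dge: "\<And>x b. b \<in> Basis \<Longrightarrow> \<bar>u' x b\<bar> \<le> D x" and D0: "\<And>x. 0 \<le> D x"
    and p: "1 < p" "p < real DIM('a)"
  defines "n \<equiv> real DIM('a)"
  defines "c \<equiv> p * (n - 1) / (n - p)" and "P \<equiv> n * p / (n - p)"
  shows "(\<integral>\<^sup>+x. ennreal (\<bar>u x\<bar> powr P) \<partial>lborel) \<le>
    ennreal (c powr P) * epow (\<integral>\<^sup>+x. ennreal (D x powr p) \<partial>lborel) (P / p)"
proof -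
  have np: "1 < p" "p < n" "1 < n" using p by (auto simp: n_def)
  have dim: "DIM('a) \<ge> 2" using p by linarith
  have contu: "continuous_on UNIV u"
    by (intro continuous_at_imp_continuous_on ballI has_derivative_continuous[OF der])
  then have [measurable]: "u \<in> borel_measurable borel" by (rule borel_measurable_continuous_onI)
  define m where "m = n / (n - 1)"
  have c1: "1 < c" using np mult_strict_right_mono[of 1 p n] by (simp add: c_def field_simps)
  have P0: "0 < P" using np by (simp add: P_def)
  have m0: "0 < m" using np by (simp add: m_def)
  have cm: "c * m = P" using np by (simp add: c_def m_def P_def)
  have e1: "c - 1 = P * (1 - 1/p)" using np by (simp add: c_def P_def field_simps)
  have e2: "m * (1 - 1/p) = 1 - 1/c"
    using np by (simp add: c_def m_def) (simp add: field_simps)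
  define X where "X = (\<integral>\<^sup>+x. ennreal (\<bar>u x\<bar> powr P) \<partial>lborel)"
  define Y where "Y = (\<integral>\<^sup>+x. ennreal (D x powr p) \<partial>lborel)"
  have X_fin: "X < \<infinity>"
  proof -
    obtain B where B: "\<And>x. x \<in> cball 0 R \<Longrightarrow> \<bar>u x\<bar> \<le> B"
      using compact_continuous_abs_bound[OF compact_cball[of 0 R] continuous_on_subset[OF contu subset_UNIV]] by blast
    have bd: "ennreal (\<bar>u x\<bar> powr P) \<le> ennreal (\<bar>B\<bar> powr P) * indicator (cball 0 R) x" for x
      using B[of x] supp[of x] P0
      by (cases "x \<in> cball 0 R") (auto intro!: ennreal_leI powr_mono2)
    have "X \<le> (\<integral>\<^sup>+x. ennreal (\<bar>B\<bar> powr P) * indicator (cball (0::'a) R) x \<partial>lborel)"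
      unfolding X_def by (rule nn_integral_mono) (rule bd)
    also have "\<dots> = ennreal (\<bar>B\<bar> powr P) * emeasure lborel (cball (0::'a) R)"
      by (simp add: nn_integral_cmult_indicator)
    also have "\<dots> < \<infinity>"
      using emeasure_bounded_finite[of "cball (0::'a) R"]
      by (simp add: ennreal_mult_less_top)
    finally show ?thesis .
  qed
  define f where "f = (\<lambda>x. ennreal (c * \<bar>u x\<bar> powr (c - 1) * D x))"
  have [measurable]: "f \<in> borel_measurable borel" unfolding f_def by measurable
  have "X = (\<integral>\<^sup>+x. epow (ennreal (\<bar>u x\<bar> powr c)) m \<partial>lborel)"
    unfolding X_def using m0 by (intro nn_integral_cong) (simp add: epow_ennreal powr_powr cm)
  also have "\<dots> \<le> epow (\<integral>\<^sup>+x. f x \<partial>lborel) m"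
    unfolding m_def n_def f_def
    by (rule nn_integral_epow_le_of_marginals)
       (use dim abs_powr_le_marginal[OF der cont supp D Dge c1] in auto)
  also have "(\<integral>\<^sup>+x. f x \<partial>lborel) =
      (\<integral>\<^sup>+x. ennreal c * (epow (ennreal (\<bar>u x\<bar> powr P)) (1 - 1/p) * epow (ennreal (D x powr p)) (1/p)) \<partial>lborel)"
  proof (intro nn_integral_cong)
    fix x
    have "epow (ennreal (\<bar>u x\<bar> powr P)) (1 - 1/p) = ennreal (\<bar>u x\<bar> powr (c - 1))"
      using np by (simp add: epow_ennreal powr_powr e1)
    moreover have "epow (ennreal (D x powr p)) (1/p) = ennreal (D x)"
      using np D0[of x] by (simp add: epow_ennreal powr_powr)
    ultimately show "f x = ennreal c * (epow (ennreal (\<bar>u x\<bar> powr P)) (1 - 1/p) * epow (ennreal (D x powr p)) (1/p))"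
      using c1 D0[of x] by (simp add: f_def mult.assoc flip: ennreal_mult)
  qed
  also have "\<dots> = ennreal c * (\<integral>\<^sup>+x. epow (ennreal (\<bar>u x\<bar> powr P)) (1 - 1/p) * epow (ennreal (D x powr p)) (1/p) \<partial>lborel)"
    by (intro nn_integral_cmult) measurable
  also have "epow \<dots> m \<le> epow (ennreal c * (epow X (1 - 1/p) * epow Y (1/p))) m"
    unfolding X_def Y_def
    by (intro epow_mono mult_left_mono nn_integral_Holder2) (use np m0 in auto)
  finally have main: "X \<le> epow (ennreal c * (epow X (1 - 1/p) * epow Y (1/p))) m"
    using m0 by (simp add: epow_mono)
  consider "X = 0" | "Y = \<infinity>" | x y where "X = ennreal x" "x > 0" "Y = ennreal y" "y \<ge> 0"
    using X_fin by (cases X; cases Y) (auto simp: less_le)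
  then have "X \<le> ennreal (c powr P) * epow Y (P / p)"
  proof cases
    case 2
    then show ?thesis using c1 P0 np by (simp add: ennreal_mult_top)
  next
    case (3 x y)
    have "ennreal x \<le> ennreal ((c * (x powr (1 - 1/p) * y powr (1/p))) powr m)"
      using main 3 np m0 c1 by (simp add: epow_ennreal flip: ennreal_mult)
    then have "x \<le> (c * (x powr (1 - 1/p) * y powr (1/p))) powr m"
      by (subst (asm) ennreal_le_iff) auto
    also have "\<dots> = c powr m * (x powr (1 - 1/c)) * y powr (m / p)"
      using 3 c1 e2 by (simp add: powr_mult powr_powr mult_ac)
    finally have "x * x powr (1/c - 1) \<le> c powr m * x powr (1 - 1/c) * y powr (m / p) * x powr (1/c - 1)"
      by (intro mult_right_mono) auto
    moreover have "x * x powr (1/c - 1) = x powr (1/c)"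
      using 3 by (simp add: powr_diff)
    moreover have "x powr (1 - 1/c) * x powr (1/c - 1) = 1"
      using 3 by (simp flip: powr_add)
    ultimately have "x powr (1/c) \<le> c powr m * y powr (m / p)"
      by (metis (no_types, lifting) mult.assoc mult.commute mult_1)
    then have "(x powr (1/c)) powr c \<le> (c powr m * y powr (m / p)) powr c"
      using c1 by (intro powr_mono2) auto
    then have "x \<le> c powr P * y powr (P / p)"
      using 3 c1 cm by (simp add: powr_mult powr_powr mult.commute)
    then show ?thesis
      using 3 P0 np by (simp add: epow_ennreal flip: ennreal_mult)
  qed simp
  then show ?thesis by (simp add: X_def Y_def)
qed

section \<open>Riemann-Liouville integrals of functions of one variable\<close>

text \<open>The normalising factor \<open>1 / Gamma a\<close> is left out, so the semigroup law below carries a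
  Beta function.\<close>

definition RL :: "real \<Rightarrow> (real \<Rightarrow> real) \<Rightarrow> real \<Rightarrow> real" where
  "RL a w t = (LINT s|lborel. indicator {0<..<t} s * ((t - s) powr (a - 1) * w s))"

lemma has_bochner_integral_Beta_interval:
  fixes a b r t :: real
  assumes ab: "0 < a" "0 < b" and rt: "r < t"
  shows "has_bochner_integral lborel
    (\<lambda>s. indicator {r<..<t} s * ((t - s) powr (a - 1) * (s - r) powr (b - 1)))
    (Beta a b * (t - r) powr (a + b - 1))"
proof -
  let ?k = "\<lambda>x. x powr (b - 1) * (1 - x) powr (a - 1) :: real"
  have 1: "set_integrable lborel {0..1} ?k" using integrable_Beta[of b a] ab by simp
  have 2: "(LINT x:{0..1}|lborel. ?k x) = Beta a b"
    using set_borel_integral_eq_integral(2)[OF 1] has_integral_Beta_real[of b a] ab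
    by (simp add: integral_unique Beta_commute)
  have AE01: "AE x in lborel. x \<noteq> 0 \<and> x \<noteq> (1::real)"
    using AE_lborel_singleton[of 0] AE_lborel_singleton[of "1::real"] by auto
  have "has_bochner_integral lborel (\<lambda>x. indicator {0..1} x *\<^sub>R ?k x) (Beta a b)"
    using 1 2 by (simp add: has_bochner_integral_iff set_integrable_def set_lebesgue_integral_def)
  then have "has_bochner_integral lborel (\<lambda>x. indicator {0<..<1} x * ?k x) (Beta a b)"
    by (rule has_bochner_integral_cong_AE[THEN iffD1, rotated -1])
       (use AE01 in \<open>auto simp: indicator_def elim!: eventually_mono\<close>)
  then have "has_bochner_integral lborel
      (\<lambda>x. (t - r) powr (a + b - 2) * (indicator {0<..<1} x * ?k x)) ((t - r) powr (a + b - 2) * Beta a b)"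
    by (intro has_bochner_integral_mult_right) auto
  moreover have "(t - r) powr (a + b - 2) * (indicator {0<..<1} x * ?k x) =
      indicator {r<..<t} (r + (t - r) * x) * ((t - (r + (t - r) * x)) powr (a - 1) * (r + (t - r) * x - r) powr (b - 1))" for x
  proof (cases "x \<in> {0<..<1}")
    case True
    have "t - (r + (t - r) * x) = (t - r) * (1 - x)" by (simp add: algebra_simps)
    moreover have "r + (t - r) * x < t"
    proof -
      have "r + (t - r) * x < r + (t - r) * 1"
        by (intro add_strict_left_mono mult_strict_left_mono) (use True rt in auto)
      then show ?thesis by simp
    qed
    moreover have "(t - r) powr (a + b - 2) = (t - r) powr (a - 1) * (t - r) powr (b - 1)"
      by (simp flip: powr_add)
    ultimately show ?thesis using True rt by (simp add: powr_mult)
  next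
    case False
    have "r + (t - r) * x \<notin> {r<..<t}"
    proof
      assume A: "r + (t - r) * x \<in> {r<..<t}"
      then have 0: "0 < (t - r) * x" and "r + (t - r) * x < r + (t - r) * 1" by simp_all
      then have 1: "(t - r) * x < (t - r) * 1" by (simp only: add_less_cancel_left)
      have "0 < x" using 0 rt by (simp add: zero_less_mult_iff)
      moreover have "x < 1" using 1 rt by (simp only: mult_less_cancel_left_pos diff_gt_0_iff_gt)
      ultimately
      show False using False by simp
    qed
    then show ?thesis using False by simp
  qed
  ultimately have "has_bochner_integral lborel
      (\<lambda>x. indicator {r<..<t} (r + (t - r) * x) * ((t - (r + (t - r) * x)) powr (a - 1) * (r + (t - r) * x - r) powr (b - 1)))
      (((t - r) powr (a + b - 1) * Beta a b) /\<^sub>R \<bar>t - r\<bar>)"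
    using rt by (simp add: powr_diff[of _ _ 1] powr_diff[of _ _ 2] power2_eq_square field_simps)
  then show ?thesis
    using lborel_has_bochner_integral_real_affine_iff[of "t - r"
      "\<lambda>s. indicator {r<..<t} s * ((t - s) powr (a - 1) * (s - r) powr (b - 1))" _ r] rt
    by (simp add: mult.commute)
qed

lemma nn_integral_Beta_interval:
  fixes a b r t :: real
  assumes ab: "0 < a" "0 < b" and rt: "r < t"
  shows "(\<integral>\<^sup>+s. ennreal (indicator {r<..<t} s * ((t - s) powr (a - 1) * (s - r) powr (b - 1))) \<partial>lborel)
    = ennreal (Beta a b * (t - r) powr (a + b - 1))"
  using has_bochner_integral_Beta_interval[OF assms]
  by (subst nn_integral_eq_integral) (auto simp: has_bochner_integral_iff)

lemma Beta_1_right: "0 < a \<Longrightarrow> Beta a 1 = 1 / (a :: real)"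
  using less_imp_neq[OF Gamma_real_pos, of a] by (auto simp: Beta_def Gamma_plus1 nonpos_Ints_def)

lemma nn_integral_powr_kernel:
  fixes a t :: real
  assumes "0 < a" "0 \<le> t"
  shows "(\<integral>\<^sup>+s. ennreal (indicator {0<..<t} s * (t - s) powr (a - 1)) \<partial>lborel) = ennreal (t powr a / a)"
proof (cases "t = 0")
  case False
  have "(\<integral>\<^sup>+s. ennreal (indicator {0<..<t} s * (t - s) powr (a - 1)) \<partial>lborel) =
     (\<integral>\<^sup>+s. ennreal (indicator {0<..<t} s * ((t - s) powr (a - 1) * (s - 0) powr (1 - 1))) \<partial>lborel)"
    by (intro nn_integral_cong) (auto simp: indicator_def)
  then show ?thesis
    using False assms nn_integral_Beta_interval[of a 1 0 t] by (simp add: Beta_1_right)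
qed simp

lemma RL_measurable [measurable (raw)]:
  fixes h :: "'b \<Rightarrow> real \<Rightarrow> real"
  assumes [measurable]: "case_prod h \<in> borel_measurable (M \<Otimes>\<^sub>M borel)" "g \<in> borel_measurable M"
  shows "(\<lambda>x. RL a (h x) (g x)) \<in> borel_measurable M"
  unfolding RL_def greaterThanLessThan_def lessThan_def greaterThan_def by measurable

lemma RL_cong: "(\<And>s. 0 < s \<Longrightarrow> s < t \<Longrightarrow> f s = g s) \<Longrightarrow> RL a f t = RL a g t"
  unfolding RL_def by (intro Bochner_Integration.integral_cong refl) (auto simp: indicator_def)

lemma RL_cmult: "RL a (\<lambda>s. c * f s) t = c * RL a f t"
proof -
  have "RL a (\<lambda>s. c * f s) t = (LINT s|lborel. c * (indicator {0<..<t} s * ((t - s) powr (a - 1) * f s)))"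
    unfolding RL_def by (intro Bochner_Integration.integral_cong refl) (simp add: mult_ac)
  then show ?thesis by (simp add: RL_def)
qed

lemma ennreal_abs_RL_le:
  "ennreal \<bar>RL a w t\<bar> \<le> (\<integral>\<^sup>+s. ennreal (norm (indicator {0<..<t} s * ((t - s) powr (a - 1) * w s))) \<partial>lborel)"
proof (cases "integrable lborel (\<lambda>s. indicator {0<..<t} s * ((t - s) powr (a - 1) * w s))")
  case True
  then show ?thesis
    unfolding RL_def using integral_norm_bound_ennreal[OF True] by simp
next
  case False
  then show ?thesis by (simp add: RL_def not_integrable_integral_eq)
qed

lemma RL_abs_le:
  assumes [measurable]: "w \<in> borel_measurable borel" and W: "\<And>s. \<bar>w s\<bar> \<le> W"
    and a: "0 < a" and t: "0 \<le> t"
  shows "\<bar>RL a w t\<bar> \<le> W * (t powr a / a)"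
proof -
  let ?f = "\<lambda>s. indicator {0<..<t} s * ((t - s) powr (a - 1) * w s)"
  have W0: "0 \<le> W" using W[of 0] by linarith
  have "ennreal \<bar>RL a w t\<bar> \<le> (\<integral>\<^sup>+s. ennreal (norm (?f s)) \<partial>lborel)"
    by (rule ennreal_abs_RL_le)
  also have "\<dots> \<le> (\<integral>\<^sup>+s. ennreal W * ennreal (indicator {0<..<t} s * (t - s) powr (a - 1)) \<partial>lborel)"
  proof (rule nn_integral_mono)
    fix s
    have "norm (?f s) = (indicator {0<..<t} s * (t - s) powr (a - 1)) * \<bar>w s\<bar>"
      by (simp add: abs_mult)
    also have "\<dots> \<le> (indicator {0<..<t} s * (t - s) powr (a - 1)) * W"
      by (intro mult_left_mono W) auto
    finally show "ennreal (norm (?f s)) \<le> ennreal W * ennreal (indicator {0<..<t} s * (t - s) powr (a - 1))"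
      using W0 by (simp add: mult.commute ennreal_leI flip: ennreal_mult)
  qed
  also have "\<dots> = ennreal (W * (t powr a / a))"
    using a t W0 by (subst nn_integral_cmult, measurable)
      (simp add: nn_integral_powr_kernel flip: ennreal_mult)
  finally show ?thesis using a t W0 by (subst (asm) ennreal_le_iff) auto
qed

text \<open>The semigroup law: after exchanging the integrals, the inner one is a Beta integral. It
  serves three times below: to invert the fractional derivative (orders \<open>\<alpha>\<close> and \<open>1 - \<alpha>\<close>) and to
  commute fractional and ordinary integration.\<close>

lemma RL_RL:
  fixes w :: "real \<Rightarrow> real"
  assumes [measurable]: "w \<in> borel_measurable borel" and W: "\<And>s. \<bar>w s\<bar> \<le> W"
    and ab: "0 < a" "0 < b"
  shows "RL a (RL b w) t = Beta a b * RL (a + b) w t"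
proof (cases "t > 0")
  case True
  define F where "F = (\<lambda>s r. indicator {0<..<t} s * (t - s) powr (a - 1) *
     (indicator {0<..<s} r * ((s - r) powr (b - 1) * w r)))"
  have W0: "0 \<le> W" using W[of 0] by linarith
  have Fm [measurable]: "case_prod F \<in> borel_measurable (lborel \<Otimes>\<^sub>M lborel)"
    unfolding F_def greaterThanLessThan_def lessThan_def greaterThan_def by measurable
  have inner: "(\<integral>\<^sup>+r. ennreal (norm (F s r)) \<partial>lborel) \<le>
      ennreal (W * (t powr b / b)) * ennreal (indicator {0<..<t} s * (t - s) powr (a - 1))" for s
  proof (cases "s \<in> {0<..<t}")
    case True
    have "(\<integral>\<^sup>+r. ennreal (norm (F s r)) \<partial>lborel) \<le>
        (\<integral>\<^sup>+r. ennreal (W * (t - s) powr (a - 1)) * ennreal (indicator {0<..<s} r * (s - r) powr (b - 1)) \<partial>lborel)"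
    proof (intro nn_integral_mono)
      fix r
      have "norm (F s r) = (t - s) powr (a - 1) * (indicator {0<..<s} r * (s - r) powr (b - 1)) * \<bar>w r\<bar>"
        using True by (simp add: F_def abs_mult)
      also have "\<dots> \<le> (t - s) powr (a - 1) * (indicator {0<..<s} r * (s - r) powr (b - 1)) * W"
        by (intro mult_left_mono W) auto
      finally have "ennreal (norm (F s r)) \<le> ennreal \<dots>" by (rule ennreal_leI)
      also have "\<dots> = ennreal (W * (t - s) powr (a - 1)) * ennreal (indicator {0<..<s} r * (s - r) powr (b - 1))"
        using W0 by (simp add: mult_ac flip: ennreal_mult)
      finally show "ennreal (norm (F s r)) \<le> \<dots>" .
    qed
    also have "\<dots> = ennreal (W * (t - s) powr (a - 1)) * ennreal (s powr b / b)"
      using True ab by (subst nn_integral_cmult) (auto simp: nn_integral_powr_kernel)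
    also have "\<dots> \<le> ennreal (W * (t - s) powr (a - 1)) * ennreal (t powr b / b)"
      using True ab by (intro mult_left_mono ennreal_leI divide_right_mono powr_mono2) auto
    also have "\<dots> = ennreal (W * (t powr b / b)) * ennreal (indicator {0<..<t} s * (t - s) powr (a - 1))"
      using True ab W0 by (simp add: mult_ac flip: ennreal_mult)
    finally show ?thesis .
  qed (simp add: F_def)
  have int: "integrable (lborel \<Otimes>\<^sub>M lborel) (case_prod F)"
  proof (rule integrableI_bounded[OF Fm])
    have "(\<integral>\<^sup>+z. ennreal (norm (case_prod F z)) \<partial>(lborel \<Otimes>\<^sub>M lborel)) =
        (\<integral>\<^sup>+s. \<integral>\<^sup>+r. ennreal (norm (F s r)) \<partial>lborel \<partial>lborel)"
      by (subst lborel.nn_integral_fst[symmetric]) auto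
    also have "\<dots> \<le> (\<integral>\<^sup>+s. ennreal (W * (t powr b / b)) * ennreal (indicator {0<..<t} s * (t - s) powr (a - 1)) \<partial>lborel)"
      by (intro nn_integral_mono inner)
    also have "\<dots> = ennreal (W * (t powr b / b)) * ennreal (t powr a / a)"
      using True ab by (subst nn_integral_cmult) (auto simp: nn_integral_powr_kernel)
    also have "\<dots> < \<infinity>" by (simp add: ennreal_mult_less_top)
    finally show "(\<integral>\<^sup>+z. ennreal (norm (case_prod F z)) \<partial>(lborel \<Otimes>\<^sub>M lborel)) < \<infinity>" .
  qed
  have "RL a (RL b w) t = (LINT s|lborel. LINT r|lborel. F s r)"
    unfolding RL_def F_def by (simp add: mult.assoc)
  also have "\<dots> = (LINT r|lborel. LINT s|lborel. F s r)"
    using lborel_pair.Fubini_integral[OF int] by simp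
  also have "\<dots> = (LINT r|lborel. Beta a b * (indicator {0<..<t} r * ((t - r) powr (a + b - 1) * w r)))"
  proof (intro Bochner_Integration.integral_cong refl)
    fix r
    show "(LINT s|lborel. F s r) = Beta a b * (indicator {0<..<t} r * ((t - r) powr (a + b - 1) * w r))"
    proof (cases "r \<in> {0<..<t}")
      case True
      have "(LINT s|lborel. F s r) =
          (LINT s|lborel. w r * (indicator {r<..<t} s * ((t - s) powr (a - 1) * (s - r) powr (b - 1))))"
        by (intro Bochner_Integration.integral_cong refl) (use True in \<open>auto simp: F_def indicator_def\<close>)
      also have "\<dots> = w r * (Beta a b * (t - r) powr (a + b - 1))"
        using has_bochner_integral_Beta_interval[OF ab, of r t] True
        by (simp add: has_bochner_integral_iff)
      finally show ?thesis using True by simp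
    next
      case False
      then have "F s r = 0" for s by (auto simp: F_def indicator_def)
      then show ?thesis using False by simp
    qed
  qed
  also have "\<dots> = Beta a b * RL (a + b) w t"
    by (simp add: RL_def)
  finally show ?thesis .
next
  case False
  then have "{0<..<t} = {}" by auto
  then show ?thesis by (simp add: RL_def)
qed

text \<open>The Hoelder inequality against the kernel; \<open>1 < a * p\<close> makes the conjugate power of the
  kernel integrable.\<close>

lemma RL_bound:
  fixes h :: "real \<Rightarrow> real"
  assumes [measurable]: "h \<in> borel_measurable borel"
    and a: "0 < a" and p: "1 < p" "1 < a * p" and t: "0 < t" "t < T"
  shows "ennreal \<bar>RL a h t\<bar> \<le>
    ennreal (((p - 1) / (a * p - 1)) powr (1 - 1/p) * T powr (a - 1/p)) *
    epow (\<integral>\<^sup>+s. ennreal (indicator {0<..<T} s * \<bar>h s\<bar> powr p) \<partial>lborel) (1/p)"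
proof -
  define a' where "a' = (a * p - 1) / (p - 1)"
  have a': "0 < a'" using p by (simp add: a'_def)
  have e: "(a' - 1) * (1 - 1/p) = a - 1" "a' * (1 - 1/p) = a - 1/p"
    using p by (simp_all add: a'_def divide_simps) (simp_all add: algebra_simps)
  let ?H = "\<integral>\<^sup>+s. ennreal (indicator {0<..<T} s * \<bar>h s\<bar> powr p) \<partial>lborel"
  have "ennreal \<bar>RL a h t\<bar> \<le> (\<integral>\<^sup>+s. ennreal (norm (indicator {0<..<t} s * ((t - s) powr (a - 1) * h s))) \<partial>lborel)"
    by (rule ennreal_abs_RL_le)
  also have "\<dots> \<le> (\<integral>\<^sup>+s. epow (ennreal (indicator {0<..<t} s * (t - s) powr (a' - 1))) (1 - 1/p) *
      epow (ennreal (indicator {0<..<T} s * \<bar>h s\<bar> powr p)) (1/p) \<partial>lborel)"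
  proof (intro nn_integral_mono)
    fix s
    show "ennreal (norm (indicator {0<..<t} s * ((t - s) powr (a - 1) * h s))) \<le>
      epow (ennreal (indicator {0<..<t} s * (t - s) powr (a' - 1))) (1 - 1/p) *
      epow (ennreal (indicator {0<..<T} s * \<bar>h s\<bar> powr p)) (1/p)"
    proof (cases "s \<in> {0<..<t}")
      case True
      then have "s \<in> {0<..<T}" using t by auto
      then show ?thesis using True p e
        by (simp add: epow_ennreal powr_powr abs_mult flip: ennreal_mult)
    qed simp
  qed
  also have "\<dots> \<le> epow (\<integral>\<^sup>+s. ennreal (indicator {0<..<t} s * (t - s) powr (a' - 1)) \<partial>lborel) (1 - 1/p) * epow ?H (1/p)"
    by (intro nn_integral_Holder2) (use p in auto)
  also have "\<dots> = ennreal ((t powr a' / a') powr (1 - 1/p)) * epow ?H (1/p)"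
    using a' t p by (simp add: nn_integral_powr_kernel epow_ennreal)
  also have "\<dots> \<le> ennreal ((T powr a' / a') powr (1 - 1/p)) * epow ?H (1/p)"
    using a' t p by (intro mult_right_mono ennreal_leI powr_mono2 divide_right_mono) auto
  also have "(T powr a' / a') powr (1 - 1/p) = ((p - 1) / (a * p - 1)) powr (1 - 1/p) * T powr (a - 1/p)"
  proof -
    have *: "T powr a' / a' = ((p - 1) / (a * p - 1)) * T powr a'" by (simp add: a'_def)
    show ?thesis unfolding * using p t by (subst powr_mult) (simp_all add: powr_powr e)
  qed
  finally show ?thesis .
qed

section \<open>Smooth cut-off functions and the fundamental lemma\<close>

lemma Ck_on_SucE:
  assumes "Ck_on (Suc k) S f"
  obtains f' where "\<And>z. z \<in> S \<Longrightarrow> (f has_derivative f' z) (at z within S)"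
    "\<And>v. Ck_on k S (\<lambda>z. f' z v)"
  using assms by auto

lemma Ck_on_subset: "Ck_on k S f \<Longrightarrow> T \<subseteq> S \<Longrightarrow> Ck_on k T f"
proof (induction k arbitrary: f)
  case 0
  then show ?case by (auto intro: continuous_on_subset)
next
  case (Suc k)
  obtain f' where "\<And>z. z \<in> S \<Longrightarrow> (f has_derivative f' z) (at z within S)"
    "\<And>v. Ck_on k S (\<lambda>z. f' z v)"
    using Ck_on_SucE[OF Suc.prems(1)] by blast
  then show ?case unfolding Ck_on.simps
    using Suc.IH[OF _ Suc.prems(2)] Suc.prems(2)
    by (intro exI[of _ f'] conjI ballI allI) (blast intro: has_derivative_subset)+
qed

lemma Ck_on_lower: "Ck_on (Suc k) S f \<Longrightarrow> Ck_on k S f"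
proof (induction k arbitrary: f)
  case 0
  then show ?case by (auto intro: has_derivative_continuous_on)
next
  case (Suc k)
  then show ?case unfolding Ck_on.simps(2)[of "Suc k"] Ck_on.simps(2)[of k] by blast
qed

lemma Ck_on_const: "Ck_on k S (\<lambda>_. c)"
  by (induction k arbitrary: c) (auto intro!: exI[of _ "\<lambda>_ _. 0"])

lemma Ck_on_add: "Ck_on k S f \<Longrightarrow> Ck_on k S g \<Longrightarrow> Ck_on k S (\<lambda>z. f z + g z)"
proof (induction k arbitrary: f g)
  case 0
  then show ?case by (auto intro: continuous_intros)
next
  case (Suc k)
  obtain f' where
    f: "\<And>z. z \<in> S \<Longrightarrow> (f has_derivative f' z) (at z within S)" "\<And>v. Ck_on k S (\<lambda>z. f' z v)"
    using Ck_on_SucE[OF Suc.prems(1)] by blast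
  obtain g' where
    g: "\<And>z. z \<in> S \<Longrightarrow> (g has_derivative g' z) (at z within S)" "\<And>v. Ck_on k S (\<lambda>z. g' z v)"
    using Ck_on_SucE[OF Suc.prems(2)] by blast
  show ?case unfolding Ck_on.simps
    by (rule exI[of _ "\<lambda>z v. f' z v + g' z v"]) (intro conjI ballI allI has_derivative_add f g Suc.IH)
qed

lemma Ck_on_mult: "Ck_on k S f \<Longrightarrow> Ck_on k S g \<Longrightarrow> Ck_on k S (\<lambda>z. f z * g z)"
proof (induction k arbitrary: f g)
  case 0
  then show ?case by (auto intro: continuous_intros)
next
  case (Suc k)
  obtain f' where
    f: "\<And>z. z \<in> S \<Longrightarrow> (f has_derivative f' z) (at z within S)" "\<And>v. Ck_on k S (\<lambda>z. f' z v)"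
    using Ck_on_SucE[OF Suc.prems(1)] by blast
  obtain g' where
    g: "\<And>z. z \<in> S \<Longrightarrow> (g has_derivative g' z) (at z within S)" "\<And>v. Ck_on k S (\<lambda>z. g' z v)"
    using Ck_on_SucE[OF Suc.prems(2)] by blast
  show ?case unfolding Ck_on.simps
    by (rule exI[of _ "\<lambda>z v. f z * g' z v + f' z v * g z"])
       (intro conjI ballI allI has_derivative_mult f g Ck_on_add Suc.IH
         Suc.prems[THEN Ck_on_lower])
qed

lemma Ck_on_prod: "finite I \<Longrightarrow> (\<And>i. i \<in> I \<Longrightarrow> Ck_on k S (f i)) \<Longrightarrow> Ck_on k S (\<lambda>z. \<Prod>i\<in>I. f i z)"
  by (induction I rule: finite_induct) (auto intro: Ck_on_const Ck_on_mult)

text \<open>The functions \<open>P (1 / x) * exp (- 1 / x)\<close> with a polynomial \<open>P\<close>, extended by zero, form a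
  class that is closed under differentiation, also at the origin.\<close>

definition flat :: "real poly \<Rightarrow> real \<Rightarrow> real" where
  "flat P x = (if 0 < x then poly P (1 / x) * exp (- (1 / x)) else 0)"

lemma poly_exp_tendsto_0: "((\<lambda>y. poly P y * exp (- y)) \<longlongrightarrow> (0::real)) at_top"
proof -
  have "((\<lambda>y. \<Sum>i\<le>degree P. coeff P i * (y ^ i / exp y)) \<longlongrightarrow> (\<Sum>i\<le>degree P. coeff P i * 0)) at_top"
    by (intro tendsto_sum tendsto_mult tendsto_const tendsto_power_div_exp_0)
  then show ?thesis
    by (simp add: poly_altdef sum_distrib_right exp_minus divide_inverse mult.assoc)
qed

lemma flat_tendsto_0: "(flat P \<longlongrightarrow> 0) (at 0)"
proof -
  have "((\<lambda>x. poly P (inverse x) * exp (- inverse x)) \<longlongrightarrow> 0) (at_right (0::real))"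
    by (rule filterlim_compose[OF poly_exp_tendsto_0 filterlim_inverse_at_top_right])
  then have "(flat P \<longlongrightarrow> 0) (at_right 0)"
    by (rule Lim_transform_eventually)
       (auto simp: flat_def eventually_at inverse_eq_divide intro!: exI[of _ 1])
  moreover have "(flat P \<longlongrightarrow> 0) (at_left 0)"
    by (rule Lim_transform_eventually[OF tendsto_const])
       (auto simp: flat_def eventually_at intro!: exI[of _ 1])
  ultimately show ?thesis by (simp add: filterlim_at_split)
qed

lemma flat_has_derivative:
  "(flat P has_real_derivative flat ([:0, 0, 1:] * (P - pderiv P)) x) (at x)"
proof -
  consider "x > 0" | "x < 0" | "x = 0" by linarith
  then show ?thesis
  proof cases
    case 1
    have "((\<lambda>x. poly P (1 / x) * exp (- (1 / x))) has_real_derivative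
        flat ([:0, 0, 1:] * (P - pderiv P)) x) (at x)"
      using 1 by (auto intro!: derivative_eq_intros DERIV_chain2[OF poly_DERIV]
          simp: flat_def power2_eq_square field_simps)
    then show ?thesis
      by (rule has_field_derivative_transform_within_open[where S = "{0<..}"])
         (use 1 in \<open>auto simp: flat_def\<close>)
  next
    case 2
    have "((\<lambda>x. 0) has_real_derivative 0) (at x)" by simp
    then have "(flat P has_real_derivative 0) (at x)"
      by (rule has_field_derivative_transform_within_open[where S = "{..<0}"])
         (use 2 in \<open>auto simp: flat_def\<close>)
    then show ?thesis using 2 by (simp add: flat_def)
  next
    case 3
    have eq: "flat ([:0, 1:] * P) h = (flat P (0 + h) - flat P 0) / h" if "h \<noteq> 0" for h
      using that by (auto simp: flat_def)
    have "((\<lambda>h. (flat P (0 + h) - flat P 0) / h) \<longlongrightarrow> 0) (at 0)"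
      by (rule Lim_transform_within[OF flat_tendsto_0[of "[:0, 1:] * P"] zero_less_one]) (use eq in auto)
    then show ?thesis using 3 by (simp add: DERIV_def flat_def)
  qed
qed

lemma Ck_on_flat: "Ck_on k S (\<lambda>z. flat P (c * (z \<bullet> b) + e))"
proof (induction k arbitrary: P)
  case 0
  have "continuous_on UNIV (flat P)"
    by (intro continuous_at_imp_continuous_on ballI DERIV_isCont[OF flat_has_derivative])
  then show ?case
    by (auto intro!: continuous_on_compose2[of UNIV "flat P"] continuous_intros)
next
  case (Suc k)
  let ?Q = "[:0, 0, 1:] * (P - pderiv P)"
  have "((\<lambda>z. flat P (c * (z \<bullet> b) + e)) has_derivative
      (\<lambda>v. flat ?Q (c * (z \<bullet> b) + e) * (c * (v \<bullet> b)))) (at z within S)" for z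
    by (rule has_derivative_compose[OF _ flat_has_derivative[unfolded has_field_derivative_def]])
       (auto intro!: derivative_eq_intros)
  then show ?case unfolding Ck_on.simps
    by (intro exI[of _ "\<lambda>z v. flat ?Q (c * (z \<bullet> b) + e) * (c * (v \<bullet> b))"])
       (auto intro!: Ck_on_mult Ck_on_const Suc.IH simp del: mult_pCons_left)
qed

text \<open>Smooth functions that increase to the indicator of a box: since \<open>flat 1\<close> is \<open>exp (- 1 / x)\<close>,
  stretching its argument by \<open>n\<close> makes it tend to \<open>1\<close> on the positive half-line.\<close>

definition cutoff :: "nat \<Rightarrow> 'z::euclidean_space \<Rightarrow> 'z \<Rightarrow> 'z \<Rightarrow> real" where
  "cutoff n l u z = (\<Prod>b\<in>Basis. flat 1 (real n * (z \<bullet> b) + - (real n * (l \<bullet> b))) *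
     flat 1 (- real n * (z \<bullet> b) + real n * (u \<bullet> b)))"

lemma flat_1_bounds: "0 \<le> flat 1 x" "flat 1 x \<le> 1"
  by (auto simp: flat_def)

lemma cutoff_smooth: "cutoff n l u \<in> smooth_functions S"
  unfolding smooth_functions_def cutoff_def[abs_def]
  by (intro CollectI allI Ck_on_prod Ck_on_mult Ck_on_flat finite_Basis)

lemma cutoff_outside:
  assumes "z \<notin> box l u"
  shows "cutoff n l u z = 0"
proof -
  obtain b where b: "b \<in> Basis" "z \<bullet> b \<le> l \<bullet> b \<or> u \<bullet> b \<le> z \<bullet> b"
    using assms by (auto simp: mem_box not_less)
  then have "real n * (z \<bullet> b) + - (real n * (l \<bullet> b)) \<le> 0 \<or> - real n * (z \<bullet> b) + real n * (u \<bullet> b) \<le> 0"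
    by (auto intro: mult_left_mono)
  then have "flat 1 (real n * (z \<bullet> b) + - (real n * (l \<bullet> b))) *
     flat 1 (- real n * (z \<bullet> b) + real n * (u \<bullet> b)) = 0"
    by (auto simp: flat_def)
  then show ?thesis unfolding cutoff_def using b(1) by (intro prod_zero) auto
qed

lemma cutoff_abs_le: "\<bar>cutoff n l u z\<bar> \<le> 1"
proof -
  have "0 \<le> cutoff n l u z" unfolding cutoff_def
    by (intro prod_nonneg mult_nonneg_nonneg flat_1_bounds ballI)
  moreover have "cutoff n l u z \<le> 1" unfolding cutoff_def
    by (intro prod_le_1 conjI mult_nonneg_nonneg mult_le_one flat_1_bounds)
  ultimately show ?thesis by simp
qed

lemma flat_1_scaled_tendsto:
  assumes "0 < x"
  shows "(\<lambda>n. flat 1 (real n * x)) \<longlonglongrightarrow> 1"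
proof -
  have "(\<lambda>n. exp (- (inverse (real n) * (1 / x)))) \<longlonglongrightarrow> exp (- (0 * (1 / x)))"
    by (intro tendsto_intros lim_inverse_n)
  then have "(\<lambda>n. exp (- (inverse (real n) * (1 / x)))) \<longlonglongrightarrow> 1" by simp
  then show ?thesis
    by (rule Lim_transform_eventually)
       (use assms in \<open>auto simp: flat_def field_simps intro!: eventually_sequentiallyI[of 1]\<close>)
qed

lemma cutoff_tendsto: "(\<lambda>n. cutoff n l u z) \<longlonglongrightarrow> indicator (box l u) z"
proof (cases "z \<in> box l u")
  case True
  have "(\<lambda>n. \<Prod>b\<in>Basis. flat 1 (real n * (z \<bullet> b - l \<bullet> b)) * flat 1 (real n * (u \<bullet> b - z \<bullet> b)))
      \<longlonglongrightarrow> (\<Prod>b\<in>(Basis::'a set). 1 * 1)"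
    by (intro tendsto_prod tendsto_mult flat_1_scaled_tendsto) (use True in \<open>auto simp: mem_box\<close>)
  then show ?thesis using True by (simp add: cutoff_def algebra_simps)
qed (simp add: cutoff_outside)

text \<open>The densities given by the positive and by the negative part of \<open>F\<close> agree on boxes, which
  form a generator stable under intersection; hence they are equal.\<close>

lemma AE_zero_if_box_integrals_zero:
  fixes F :: "'z::euclidean_space \<Rightarrow> real"
  assumes int: "integrable lborel F"
    and zero: "\<And>l u. (LINT z|lborel. indicator (box l u) z * F z) = 0"
  shows "AE z in lborel. F z = 0"
proof -
  have [measurable]: "F \<in> borel_measurable borel" using int by auto
  define M where "M = (\<lambda>\<sigma>. density lborel (\<lambda>z. ennreal (\<sigma> * F z)))"
  have fin: "(\<integral>\<^sup>+z. ennreal (\<sigma> * F z) \<partial>lborel) < \<infinity>" for \<sigma>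
  proof -
    have I: "integrable lborel (\<lambda>z. \<sigma> * F z)" using int by simp
    have "(\<integral>\<^sup>+z. ennreal (norm (\<sigma> * F z)) \<partial>lborel) < \<infinity>"
      by (rule integrable_iff_bounded[THEN iffD1, OF I, THEN conjunct2])
    moreover have "(\<integral>\<^sup>+z. ennreal (\<sigma> * F z) \<partial>lborel) \<le> (\<integral>\<^sup>+z. ennreal (norm (\<sigma> * F z)) \<partial>lborel)"
      by (intro nn_integral_mono ennreal_leI) auto
    ultimately show ?thesis by order
  qed
  have "M 1 = M (-1)"
  proof (rule measure_eqI_generator_eq)
    let ?E = "range (\<lambda>(a, b). box a b::'z set)"
    show "Int_stable ?E"
      by (auto simp: Int_stable_def box_Int_box)
    show "?E \<subseteq> Pow UNIV" "sets (M 1) = sigma_sets UNIV ?E" "sets (M (-1)) = sigma_sets UNIV ?E"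
      by (simp_all add: borel_eq_box M_def)
    let ?A = "\<lambda>n::nat. box (- (real n *\<^sub>R One)) (real n *\<^sub>R One) :: 'z set"
    show "range ?A \<subseteq> ?E" "(\<Union>i. ?A i) = UNIV"
      unfolding UN_box_eq_UNIV by auto
    have em: "emeasure (M \<sigma>) (box l u) = (\<integral>\<^sup>+z. ennreal (\<sigma> * (indicator (box l u) z * F z)) \<partial>lborel)" for \<sigma> l u
      unfolding M_def
      by (subst emeasure_density) (auto intro!: nn_integral_cong simp: indicator_def)
    show "emeasure (M 1) (?A i) \<noteq> \<infinity>" for i
    proof -
      have "emeasure (M 1) (?A i) \<le> emeasure (M 1) UNIV" by (intro emeasure_mono) (auto simp: M_def)
      also have "\<dots> < \<infinity>" unfolding M_def by (subst emeasure_density) (use fin[of 1] in auto)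
      finally show ?thesis by simp
    qed
    show "emeasure (M 1) X = emeasure (M (-1)) X" if "X \<in> ?E" for X
    proof -
      obtain l u where X: "X = box l u" using \<open>X \<in> ?E\<close> by auto
      have I: "integrable lborel (\<lambda>z. indicator (box l u) z * F z)"
        using integrable_real_mult_indicator[of "box l u" lborel F] int by (simp add: mult.commute)
      have f1: "(\<integral>\<^sup>+z. ennreal (\<sigma> * (indicator (box l u) z * F z)) \<partial>lborel) < \<infinity>" for \<sigma>
        using em[of \<sigma> l u] fin[of \<sigma>] emeasure_mono[of "box l u" UNIV "M \<sigma>"]
        by (simp add: M_def emeasure_density)
      have "enn2real (\<integral>\<^sup>+z. ennreal (indicator (box l u) z * F z) \<partial>lborel) =
          enn2real (\<integral>\<^sup>+z. ennreal (- (indicator (box l u) z * F z)) \<partial>lborel)"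
        using zero[of l u] real_lebesgue_integral_def[OF I] by simp
      then show ?thesis
        using f1[of 1] f1[of "-1"] unfolding X em
        by (metis (no_types, lifting) ennreal_enn2real_if infinity_ennreal_def mult_1 mult_minus1 order_less_irrefl nn_integral_cong)
    qed
  qed
  then have "AE z in lborel. ennreal (1 * F z) = ennreal (-1 * F z)"
    unfolding M_def by (subst (asm) finite_density_unique) (use fin[of 1] in auto)
  then show ?thesis
  proof eventually_elim
    case (elim z)
    then show ?case
      by (cases "F z \<ge> 0") (auto simp: ennreal_neg ennreal_eq_0_iff)
  qed
qed

text \<open>The cut-off functions of boxes inside \<open>D\<close> turn the hypothesis into vanishing integrals over boxes,
  and countably many boxes cover \<open>D\<close>.\<close>

lemma fundamental_lemma:
  fixes F :: "'z::euclidean_space \<Rightarrow> real"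
  assumes D: "open D" and [measurable]: "F \<in> borel_measurable borel"
    and int: "\<And>l u. cbox l u \<subseteq> D \<Longrightarrow> integrable lborel (\<lambda>z. indicator (cbox l u) z * F z)"
    and zero: "\<And>\<phi> l u. cbox l u \<subseteq> D \<Longrightarrow> \<phi> \<in> smooth_functions UNIV \<Longrightarrow>
      (\<And>z. z \<notin> cbox l u \<Longrightarrow> \<phi> z = 0) \<Longrightarrow> (LINT z|lborel. F z * \<phi> z) = 0"
  shows "AE z in lborel. z \<in> D \<longrightarrow> F z = 0"
proof -
  have box0: "(LINT z|lborel. indicator (box l u) z * F z) = 0" if lu: "cbox l u \<subseteq> D" for l u
  proof -
    have [measurable]: "cutoff n l u \<in> borel_measurable borel" for n
    proof -
      have "Ck_on 0 UNIV (cutoff n l u)"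
        using cutoff_smooth[of n l u UNIV] unfolding smooth_functions_def by blast
      then show ?thesis by (intro borel_measurable_continuous_onI) simp
    qed
    have "(\<lambda>n. LINT z|lborel. F z * cutoff n l u z) \<longlonglongrightarrow> (LINT z|lborel. F z * indicator (box l u) z)"
    proof (rule integral_dominated_convergence)
      show "integrable lborel (\<lambda>z. norm (indicator (cbox l u) z * F z))"
        using int[OF lu] by (rule integrable_norm)
      show "AE z in lborel. (\<lambda>n. F z * cutoff n l u z) \<longlonglongrightarrow> F z * indicator (box l u) z"
        by (intro AE_I2 tendsto_mult tendsto_const cutoff_tendsto)
      show "AE z in lborel. norm (F z * cutoff n l u z) \<le> norm (indicator (cbox l u) z * F z)" for n
      proof (intro AE_I2)
        fix z
        show "norm (F z * cutoff n l u z) \<le> norm (indicator (cbox l u) z * F z)"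
          using cutoff_abs_le[of n l u z] cutoff_outside[of z l u n] box_subset_cbox[of l u]
            mult_left_mono[of "\<bar>cutoff n l u z\<bar>" 1 "\<bar>F z\<bar>"]
          by (cases "z \<in> box l u") (auto simp: abs_mult)
      qed
    qed measurable
    moreover have "(LINT z|lborel. F z * cutoff n l u z) = 0" for n
      by (rule zero[OF lu cutoff_smooth]) (use cutoff_outside box_subset_cbox in blast)
    ultimately have "(LINT z|lborel. F z * indicator (box l u) z) = 0"
      by (simp add: LIMSEQ_const_iff)
    then show ?thesis by (simp add: mult.commute)
  qed
  obtain \<D> where \<D>: "countable \<D>" "\<D> \<subseteq> Pow D" "\<And>X. X \<in> \<D> \<Longrightarrow> \<exists>a b. X = cbox a b" "\<Union>\<D> = D"
    using open_countable_Union_open_cbox[OF D] by blast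
  have "AE z in lborel. \<forall>X\<in>\<D>. z \<in> X \<longrightarrow> F z = 0"
  proof (subst AE_ball_countable[OF \<D>(1)], intro ballI)
    fix X assume X: "X \<in> \<D>"
    then obtain l u where lu: "X = cbox l u" "cbox l u \<subseteq> D" using \<D> by blast
    have "AE z in lborel. indicator (cbox l u) z * F z = 0"
    proof (rule AE_zero_if_box_integrals_zero[OF int[OF lu(2)]])
      fix l' u' :: 'z
      let ?l = "\<Sum>i\<in>Basis. max (l \<bullet> i) (l' \<bullet> i) *\<^sub>R i" and ?u = "\<Sum>i\<in>Basis. min (u \<bullet> i) (u' \<bullet> i) *\<^sub>R i"
      have "cbox ?l ?u \<subseteq> D" using lu(2) Int_interval[of l u l' u'] by blast
      then have "0 = (LINT z|lborel. indicator (box ?l ?u) z * F z)" by (simp add: box0)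
      also have "\<dots> = (LINT z|lborel. indicator (box l' u') z * (indicator (cbox l u) z * F z))"
      proof (rule integral_cong_AE)
        have "negligible (cbox l u - box l u)" by (rule negligible_frontier_interval)
        then have "cbox l u - box l u \<in> null_sets lebesgue" by (simp add: negligible_iff_null_sets)
        then have "AE z in lebesgue. z \<notin> cbox l u - box l u" by (rule AE_not_in)
        then have "AE z in lborel. z \<notin> cbox l u - box l u" by (simp add: AE_completion_iff)
        then show "AE z in lborel. indicator (box ?l ?u) z * F z =
            indicator (box l' u') z * (indicator (cbox l u) z * F z)"
          by eventually_elim
            (use box_subset_cbox[of l u] in \<open>auto simp: box_Int_box[symmetric] indicator_def\<close>)
      qed measurable
      finally show "(LINT z|lborel. indicator (box l' u') z * (indicator (cbox l u) z * F z)) = 0" by simp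
    qed
    then show "AE z in lborel. z \<in> X \<longrightarrow> F z = 0"
      by eventually_elim (auto simp: lu(1) indicator_def split: if_splits)
  qed
  then show ?thesis
    by eventually_elim (use \<D>(4) in blast)
qed

lemma test_functions_cbox:
  assumes "\<phi> \<in> smooth_functions UNIV" "\<And>z. z \<notin> cbox l u \<Longrightarrow> \<phi> z = 0" "cbox l u \<subseteq> S"
  shows "\<phi> \<in> test_functions S"
proof -
  have "closure {z \<in> S. \<phi> z \<noteq> 0} \<subseteq> cbox l u"
    by (intro closure_minimal closed_cbox) (use assms(2) in blast)
  moreover have "\<phi> \<in> smooth_functions S"
    using assms(1) Ck_on_subset unfolding smooth_functions_def by blast
  ultimately show ?thesis
    unfolding test_functions_def
    using assms(3) closed_Int_compact[OF closed_closure compact_cbox, of "{z \<in> S. \<phi> z \<noteq> 0}" l u]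
    by (auto simp: Int_absorb2)
qed

section \<open>Lebesgue measurable functions and integration by parts\<close>

text \<open>Functions that are only Lebesgue measurable are replaced by Borel ones, to which
  Fubini's theorem applies; Lebesgue measure being complete, \<open>f\<close> inherits measurability from \<open>g\<close>.\<close>

lemma
  fixes f g :: "'z::euclidean_space \<Rightarrow> real"
  assumes A [measurable]: "A \<in> sets borel" and g [measurable]: "g \<in> borel_measurable borel"
    and ae: "AE z in lborel. z \<in> A \<longrightarrow> f z = g z"
  shows integrable_lebesgue_on_AE:
      "integrable (lebesgue_on A) f \<longleftrightarrow> integrable lborel (\<lambda>z. indicator A z * g z)"
    and integral_lebesgue_on_AE:
      "(LINT z|lebesgue_on A. f z) = (LINT z|lborel. indicator A z * g z)"
proof -
  let ?f = "\<lambda>z. indicator A z *\<^sub>R f z" and ?g = "\<lambda>z. indicator A z * g z"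
  have A': "A \<inter> space lebesgue \<in> sets lebesgue" by simp
  have g': "?g \<in> borel_measurable lborel" by measurable
  then have g'': "?g \<in> borel_measurable lebesgue" by (rule measurable_completion)
  have ae': "AE z in lebesgue. ?g z = ?f z"
    by (rule AE_completion) (use ae in \<open>auto elim!: eventually_mono simp: indicator_def\<close>)
  have f': "?f \<in> borel_measurable lebesgue" by (rule borel_measurable_AE[OF g'' ae'])
  have "integrable lebesgue ?f = integrable lebesgue ?g"
    by (rule integrable_cong_AE[OF f' g'']) (use ae' in \<open>auto elim!: eventually_mono\<close>)
  then show "integrable (lebesgue_on A) f \<longleftrightarrow> integrable lborel ?g"
    by (simp add: integrable_restrict_space[OF A'] integrable_completion[OF g'])
  have "integral\<^sup>L lebesgue ?f = integral\<^sup>L lebesgue ?g"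
    by (rule integral_cong_AE[OF f' g'']) (use ae' in \<open>auto elim!: eventually_mono\<close>)
  then show "(LINT z|lebesgue_on A. f z) = (LINT z|lborel. ?g z)"
    by (simp add: integral_restrict_space[OF A'] integral_completion[OF g'])
qed

lemma lebesgue_on_borel_representative:
  fixes f :: "'z::euclidean_space \<Rightarrow> real"
  assumes A [measurable]: "A \<in> sets borel" and f: "f \<in> borel_measurable (lebesgue_on A)"
  obtains g where "g \<in> borel_measurable borel" "AE z in lborel. z \<in> A \<longrightarrow> f z = g z"
    "\<And>z. z \<notin> A \<Longrightarrow> g z = 0"
proof -
  have A': "A \<inter> space lebesgue \<in> sets lebesgue" by simp
  have "(\<lambda>z. indicator A z *\<^sub>R f z) \<in> borel_measurable lebesgue"
    using f by (subst (asm) borel_measurable_restrict_space_iff[OF A'])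
  then obtain g where g: "g \<in> borel_measurable lborel" "AE z in lborel. indicator A z *\<^sub>R f z = g z"
    using completion_ex_borel_measurable_real by blast
  note [measurable] = g(1)
  show ?thesis
  proof (rule that[of "\<lambda>z. indicator A z * g z"])
    show "(\<lambda>z. indicator A z * g z) \<in> borel_measurable borel" by measurable
    show "AE z in lborel. z \<in> A \<longrightarrow> f z = indicator A z * g z"
      using g(2) by (auto elim!: eventually_mono)
  qed simp
qed

lemma nn_integral_lebesgue_on:
  assumes "A \<in> sets borel"
  shows "(\<integral>\<^sup>+z. f z \<partial>lebesgue_on A) = (\<integral>\<^sup>+z. f z * indicator A z \<partial>lborel)"
  using assms by (subst nn_integral_restrict_space) (auto simp: nn_integral_completion)

text \<open>\<open>RL 1 h\<close> is merely absolutely continuous; exchanging the integrals reduces the claim to the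
  fundamental theorem of calculus for \<open>\<eta>\<close>. The boundary terms vanish by \<open>RL 1 h 0 = 0\<close>
  and \<open>\<eta> T = 0\<close>.\<close>

lemma RL_1_by_parts:
  fixes h \<eta> \<eta>' :: "real \<Rightarrow> real"
  assumes [measurable]: "h \<in> borel_measurable borel" and W: "\<And>s. \<bar>h s\<bar> \<le> W"
    and der: "\<And>t. (\<eta> has_real_derivative \<eta>' t) (at t)" and cont: "continuous_on UNIV \<eta>'"
    and T: "\<eta> T = 0"
  shows "(LINT t|lborel. indicator {0<..<T} t * (RL 1 h t * \<eta>' t)) =
    - (LINT s|lborel. indicator {0<..<T} s * (h s * \<eta> s))"
proof -
  have [measurable]: "\<eta>' \<in> borel_measurable borel" by (rule borel_measurable_continuous_onI[OF cont])
  define F where "F = (\<lambda>t s. indicator {0<..<T} t * \<eta>' t * (indicator {0<..<t} s * h s))"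
  have Fm: "case_prod F \<in> borel_measurable (lborel \<Otimes>\<^sub>M lborel)"
    unfolding F_def greaterThanLessThan_def lessThan_def greaterThan_def by measurable
  obtain M where M: "\<And>t. t \<in> {0..T} \<Longrightarrow> \<bar>\<eta>' t\<bar> \<le> M"
    using compact_continuous_abs_bound[OF compact_Icc[of 0 T] continuous_on_subset[OF cont subset_UNIV]] by blast
  have W0: "0 \<le> W" using W[of 0] by linarith
  have int: "integrable (lborel \<Otimes>\<^sub>M lborel) (case_prod F)"
  proof (rule integrableI_bounded_set[where A = "{0<..<T} \<times> {0<..<T}" and B = "M * W", OF _ Fm])
    show "{0<..<T} \<times> {0<..<T} \<in> sets (lborel \<Otimes>\<^sub>M lborel)" by simp
    have "emeasure (lborel \<Otimes>\<^sub>M lborel) ({0<..<T} \<times> {0<..<T}) =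
        emeasure lborel {0<..<T} * emeasure lborel {0<..<T}"
      by (subst lborel.emeasure_pair_measure_Times) auto
    also have "\<dots> < \<infinity>" by (cases "0 \<le> T") (auto simp: ennreal_mult_less_top)
    finally show "emeasure (lborel \<Otimes>\<^sub>M lborel) ({0<..<T} \<times> {0<..<T}) < \<infinity>" .
    show "AE z in lborel \<Otimes>\<^sub>M lborel. z \<in> {0<..<T} \<times> {0<..<T} \<longrightarrow> norm (case_prod F z) \<le> M * W"
    proof (intro AE_I2 impI)
      fix z assume "z \<in> {0<..<T} \<times> {0<..<T}"
      then have z: "fst z \<in> {0..T}" by auto
      then have "0 \<le> M" using M[OF z] by linarith
      have "norm (case_prod F z) \<le> \<bar>\<eta>' (fst z)\<bar> * \<bar>h (snd z)\<bar>"
        by (auto simp: F_def abs_mult indicator_def case_prod_beta)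
      also have "\<dots> \<le> M * W" using M[OF z] W \<open>0 \<le> M\<close> by (intro mult_mono) auto
      finally show "norm (case_prod F z) \<le> M * W" .
    qed
    show "AE z in lborel \<Otimes>\<^sub>M lborel. z \<notin> {0<..<T} \<times> {0<..<T} \<longrightarrow> case_prod F z = 0"
      by (intro AE_I2) (auto simp: F_def indicator_def)
  qed
  have "(LINT t|lborel. indicator {0<..<T} t * (RL 1 h t * \<eta>' t)) = (LINT t|lborel. LINT s|lborel. F t s)"
  proof (intro Bochner_Integration.integral_cong refl)
    fix t
    have "RL 1 h t = (LINT s|lborel. indicator {0<..<t} s * h s)"
      unfolding RL_def by (intro Bochner_Integration.integral_cong refl) (auto simp: indicator_def)
    then have "(LINT s|lborel. F t s) = indicator {0<..<T} t * \<eta>' t * RL 1 h t"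
      unfolding F_def by simp
    then show "indicator {0<..<T} t * (RL 1 h t * \<eta>' t) = (LINT s|lborel. F t s)"
      by (simp only: mult_ac)
  qed
  also have "\<dots> = (LINT s|lborel. LINT t|lborel. F t s)"
    using lborel_pair.Fubini_integral[OF int] by simp
  also have "\<dots> = (LINT s|lborel. - (indicator {0<..<T} s * (h s * \<eta> s)))"
  proof (intro Bochner_Integration.integral_cong refl)
    fix s
    show "(LINT t|lborel. F t s) = - (indicator {0<..<T} s * (h s * \<eta> s))"
    proof (cases "s \<in> {0<..<T}")
      case True
      have "(LINT t|lborel. F t s) = (LINT t|lborel. h s * (\<eta>' t * indicator {s..T} t))"
      proof (rule integral_cong_AE)
        have "AE t in lborel. t \<noteq> s \<and> t \<noteq> T"
          using AE_lborel_singleton[of s] AE_lborel_singleton[of T] by auto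
        then show "AE t in lborel. F t s = h s * (\<eta>' t * indicator {s..T} t)"
          by eventually_elim (use True in \<open>auto simp: F_def indicator_def\<close>)
        show "(\<lambda>t. F t s) \<in> borel_measurable lborel"
          unfolding F_def greaterThanLessThan_def lessThan_def greaterThan_def by measurable
      qed measurable
      also have "\<dots> = h s * (\<eta> T - \<eta> s)"
        using True der cont
        by (simp add: integral_FTC_Icc_real[where F = \<eta>] continuous_on_eq_continuous_at)
      finally show ?thesis using True T by simp
    next
      case False
      then have "F t s = 0" for t by (auto simp: F_def indicator_def)
      then show ?thesis using False by simp
    qed
  qed
  finally show ?thesis by simp
qed

text \<open>Difference quotients integrate to zero by translation invariance, and they converge
  boundedly to the derivative.\<close>

lemma integral_derivative_eq_0:
  fixes \<Psi> :: "'z::euclidean_space \<Rightarrow> real"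
  assumes der: "\<And>z. (\<Psi> has_derivative \<Psi>' z) (at z)"
    and cont: "continuous_on UNIV (\<lambda>z. \<Psi>' z e)"
    and supp: "\<And>z. z \<notin> cbox l u \<Longrightarrow> \<Psi> z = 0"
  shows "(LINT z|lborel. \<Psi>' z e) = 0"
proof -
  have cont\<Psi>: "continuous_on UNIV \<Psi>"
    by (intro continuous_at_imp_continuous_on ballI has_derivative_continuous[OF der])
  have [measurable]: "\<Psi> \<in> borel_measurable borel" "(\<lambda>z. \<Psi>' z e) \<in> borel_measurable borel"
    by (rule borel_measurable_continuous_onI, fact)+
  have bcb: "bounded (cbox l u)" by (rule bounded_cbox)
  then obtain R where R: "\<And>z. z \<in> cbox l u \<Longrightarrow> norm z \<le> R" unfolding bounded_iff by blast
  have supp': "\<Psi>' z e = 0" if "z \<notin> cbox l u" for z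
  proof -
    have "((\<lambda>_. 0) has_derivative (\<lambda>_. 0)) (at z)" by simp
    then have "(\<Psi> has_derivative (\<lambda>_. 0)) (at z)"
      by (rule has_derivative_transform_within_open[where s = "- cbox l u"])
         (use that supp in auto)
    then have "\<Psi>' z = (\<lambda>_. 0)" using der has_derivative_unique by blast
    then show ?thesis by simp
  qed
  obtain M where M0: "0 \<le> M" "\<And>z. z \<in> cbox l u \<Longrightarrow> \<bar>\<Psi>' z e\<bar> \<le> M"
    using compact_continuous_abs_bound[OF compact_cbox[of l u] continuous_on_subset[OF cont subset_UNIV]] by blast
  have M: "\<bar>\<Psi>' z e\<bar> \<le> M" for z
    using M0(1) M0(2)[of z] supp'[of z] by (cases "z \<in> cbox l u") auto
  define c where "c = (\<lambda>n. inverse (real (Suc n)))"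
  have c: "0 < c n" "c n \<le> 1" for n by (auto simp: c_def divide_simps)
  define q where "q = (\<lambda>n z. (\<Psi> (c n *\<^sub>R e + z) - \<Psi> z) / c n)"
  have line: "((\<lambda>s. \<Psi> (s *\<^sub>R e + z)) has_real_derivative \<Psi>' (s *\<^sub>R e + z) e) (at s)" for s z
  proof -
    have "((\<lambda>s. s *\<^sub>R e + z) has_derivative (\<lambda>h. h *\<^sub>R e)) (at s)"
      by (auto intro!: derivative_eq_intros)
    from has_derivative_compose[OF this der]
    have "((\<lambda>s. \<Psi> (s *\<^sub>R e + z)) has_derivative (\<lambda>h. \<Psi>' (s *\<^sub>R e + z) (h *\<^sub>R e))) (at s)" .
    moreover have "linear (\<Psi>' (s *\<^sub>R e + z))" using der has_derivative_linear by blast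
    ultimately show ?thesis by (simp add: has_field_derivative_def linear_cmul mult_commute_abs)
  qed
  have int\<Psi>: "integrable lborel \<Psi>"
  proof -
    have "integrable lborel (\<lambda>z. indicator (cbox l u) z *\<^sub>R \<Psi> z)"
      by (intro borel_integrable_compact continuous_on_subset[OF cont\<Psi>]) auto
    moreover have "indicator (cbox l u) z *\<^sub>R \<Psi> z = \<Psi> z" for z
      using supp[of z] by (auto simp: indicator_def)
    ultimately show ?thesis by (simp only:)
  qed
  have trans: "has_bochner_integral lborel (\<lambda>z. \<Psi> (w + z)) (LINT z|lborel. \<Psi> z)" for w
  proof -
    have "integrable (distr lborel borel ((+) w)) \<Psi>" using int\<Psi> by (simp add: lborel_distr_plus)
    then have "integrable lborel (\<lambda>z. \<Psi> (w + z))" by (subst (asm) integrable_distr_eq) auto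
    moreover have "(LINT z|lborel. \<Psi> (w + z)) = (LINT z|distr lborel borel ((+) w). \<Psi> z)"
      by (subst integral_distr) auto
    ultimately show ?thesis by (simp add: has_bochner_integral_iff lborel_distr_plus)
  qed
  have q0: "(LINT z|lborel. q n z) = 0" for n
    unfolding q_def using trans[of "c n *\<^sub>R e"] int\<Psi> by (simp add: has_bochner_integral_iff)
  have "(\<lambda>n. LINT z|lborel. q n z) \<longlonglongrightarrow> (LINT z|lborel. \<Psi>' z e)"
  proof (rule integral_dominated_convergence)
    show "integrable lborel (\<lambda>z. indicator (cball (0::'z) (R + norm e)) z *\<^sub>R M)"
      by (intro borel_integrable_compact continuous_intros) auto
    show "AE z in lborel. (\<lambda>n. q n z) \<longlonglongrightarrow> \<Psi>' z e"
    proof (intro AE_I2)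
      fix z
      have "((\<lambda>s. (\<Psi> ((0 + s) *\<^sub>R e + z) - \<Psi> (0 *\<^sub>R e + z)) / s) \<longlongrightarrow> \<Psi>' (0 *\<^sub>R e + z) e) (at 0)"
        using line[where s = 0] unfolding DERIV_def .
      then have "((\<lambda>s. (\<Psi> (s *\<^sub>R e + z) - \<Psi> z) / s) \<longlongrightarrow> \<Psi>' z e) (at 0)" by simp
      moreover have "filterlim c (at 0) sequentially"
        unfolding filterlim_at using LIMSEQ_inverse_real_of_nat c by (auto simp: c_def)
      ultimately show "(\<lambda>n. q n z) \<longlonglongrightarrow> \<Psi>' z e"
        unfolding q_def by (rule filterlim_compose)
    qed
    show "AE z in lborel. norm (q n z) \<le> indicator (cball (0::'z) (R + norm e)) z *\<^sub>R M" for n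
    proof (intro AE_I2)
      fix z :: 'z
      obtain s where s: "\<Psi> (c n *\<^sub>R e + z) - \<Psi> (0 *\<^sub>R e + z) = (c n - 0) * \<Psi>' (s *\<^sub>R e + z) e"
        using MVT2[OF c(1)[of n], of "\<lambda>s. \<Psi> (s *\<^sub>R e + z)" "\<lambda>s. \<Psi>' (s *\<^sub>R e + z) e"] line by blast
      then have "q n z = \<Psi>' (s *\<^sub>R e + z) e" using c[of n] by (simp add: q_def)
      then have 1: "\<bar>q n z\<bar> \<le> M" using M by simp
      show "norm (q n z) \<le> indicator (cball (0::'z) (R + norm e)) z *\<^sub>R M"
      proof (cases "q n z = 0")
        case False
        have "c n *\<^sub>R e + z \<in> cbox l u \<or> z \<in> cbox l u"
        proof (rule ccontr)
          assume "\<not> (c n *\<^sub>R e + z \<in> cbox l u \<or> z \<in> cbox l u)"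
          then have "\<Psi> (c n *\<^sub>R e + z) = 0" "\<Psi> z = 0" using supp by blast+
          then show False using False by (simp add: q_def)
        qed
        then have "norm z \<le> R + norm e"
        proof
          assume "c n *\<^sub>R e + z \<in> cbox l u"
          then have "norm (c n *\<^sub>R e + z) \<le> R" by (rule R)
          moreover have "norm z \<le> norm (c n *\<^sub>R e + z) + norm (c n *\<^sub>R e)"
            by (metis add_diff_cancel_left' norm_triangle_ineq4)
          moreover have "norm (c n *\<^sub>R e) \<le> norm e"
            using c[of n] mult_right_mono[of "c n" 1 "norm e"] by simp
          ultimately show ?thesis by simp
        qed (use R[of z] in \<open>auto intro: add_increasing2\<close>)
        then show ?thesis using 1 by simp
      qed (simp add: M0(1) indicator_def)
    qed
  qed (simp_all add: q_def)
  then show ?thesis using q0 by (simp add: LIMSEQ_const_iff)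
qed

section \<open>Linearity of the weak derivatives\<close>

text \<open>The class contains the test functions and their first derivatives; pairing with its members
  is all that enters the definitions of the weak derivatives.\<close>

definition test_weight :: "'z::euclidean_space set \<Rightarrow> ('z \<Rightarrow> real) \<Rightarrow> bool" where
  "test_weight D k \<longleftrightarrow> continuous_on D k \<and> (\<exists>M. \<forall>z\<in>D. \<bar>k z\<bar> \<le> M) \<and> (\<exists>R. \<forall>z\<in>D. R < norm z \<longrightarrow> k z = 0)"

lemma test_weight_cong: "(\<And>z. z \<in> D \<Longrightarrow> k z = k' z) \<Longrightarrow> test_weight D k \<longleftrightarrow> test_weight D k'"
  unfolding test_weight_def by (simp cong: continuous_on_cong)

lemma test_weightI:
  assumes K: "compact K" "K \<subseteq> S" and k: "continuous_on S k" and D: "D \<subseteq> S"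
    and supp: "\<And>z. z \<in> D - K \<Longrightarrow> k z = 0"
  shows "test_weight D k"
proof -
  obtain M where M: "0 \<le> M" "\<And>z. z \<in> K \<Longrightarrow> \<bar>k z\<bar> \<le> M"
    using compact_continuous_abs_bound[OF K(1) continuous_on_subset[OF k K(2)]] by blast
  have "\<bar>k z\<bar> \<le> M" if "z \<in> D" for z
    using M(1) M(2)[of z] supp[of z] that by (cases "z \<in> K") auto
  moreover have "bounded K" using K(1) by (rule compact_imp_bounded)
  then obtain R where "\<And>z. z \<in> K \<Longrightarrow> norm z \<le> R" unfolding bounded_iff by blast
  then have "\<forall>z\<in>D. R < norm z \<longrightarrow> k z = 0" using supp by force
  ultimately show ?thesis unfolding test_weight_def using continuous_on_subset[OF k D] by blast
qed

lemma test_function_derivative: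
  assumes \<phi>: "\<phi> \<in> test_functions S" and D: "open D" "D \<subseteq> S"
  obtains \<phi>' where "\<And>z. z \<in> D \<Longrightarrow> (\<phi> has_derivative \<phi>' z) (at z)"
    "\<And>v. test_weight D (\<lambda>z. \<phi>' z v)" "test_weight D \<phi>"
proof -
  define K where "K = closure {z \<in> S. \<phi> z \<noteq> 0}"
  have K: "compact K" "K \<subseteq> S" using \<phi> by (auto simp: test_functions_def K_def)
  have \<phi>0: "\<phi> z = 0" if "z \<in> D - K" for z
  proof (rule ccontr)
    assume "\<phi> z \<noteq> 0"
    then have "z \<in> {z \<in> S. \<phi> z \<noteq> 0}" using that D(2) by blast
    then have "z \<in> K" unfolding K_def by (rule subsetD[OF closure_subset])
    then show False using that by blast
  qed
  have "Ck_on (Suc 0) S \<phi>" and C0: "Ck_on 0 S \<phi>"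
    using \<phi> unfolding test_functions_def smooth_functions_def by blast+
  then obtain \<phi>' where \<phi>': "\<And>z. z \<in> S \<Longrightarrow> (\<phi> has_derivative \<phi>' z) (at z within S)"
      "\<And>v. Ck_on 0 S (\<lambda>z. \<phi>' z v)"
    using Ck_on_SucE by blast
  have der: "(\<phi> has_derivative \<phi>' z) (at z)" if "z \<in> D" for z
  proof -
    have "(\<phi> has_derivative \<phi>' z) (at z within D)"
      using that D \<phi>' has_derivative_subset by blast
    then show ?thesis by (simp only: at_within_open[OF that D(1)])
  qed
  have \<phi>'0: "\<phi>' z v = 0" if "z \<in> D - K" for z v
  proof -
    have "open (D - K)" using D K by (simp add: compact_imp_closed open_Diff)
    have "((\<lambda>_. 0) has_derivative (\<lambda>_. 0)) (at z)" by simp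
    then have "(\<phi> has_derivative (\<lambda>_. 0)) (at z)"
      by (rule has_derivative_transform_within_open[OF _ \<open>open (D - K)\<close> that])
         (use \<phi>0 in auto)
    then have "\<phi>' z = (\<lambda>_. 0)" using der[of z] that has_derivative_unique by blast
    then show ?thesis by simp
  qed
  show ?thesis
  proof (rule that[OF der])
    show "test_weight D (\<lambda>z. \<phi>' z v)" for v
      by (rule test_weightI[OF K _ D(2)]) (use \<phi>'(2) \<phi>'0 in auto)
    show "test_weight D \<phi>"
      by (rule test_weightI[OF K _ D(2)]) (use C0 \<phi>0 in auto)
  qed
qed

lemma has_real_derivative_time_slice:
  fixes \<phi> :: "real \<times> 'a::euclidean_space \<Rightarrow> real"
  assumes "(\<phi> has_derivative \<phi>') (at (t, x))"
  shows "((\<lambda>s. \<phi> (s, x)) has_real_derivative \<phi>' (1, 0)) (at t)"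
proof -
  have "((\<lambda>s. (s, x)) has_derivative (\<lambda>h. (h, 0))) (at t)"
    by (auto intro!: derivative_eq_intros)
  from has_derivative_compose[OF this assms]
  have "((\<lambda>s. \<phi> (s, x)) has_derivative (\<lambda>h. \<phi>' (h, 0))) (at t)" .
  moreover have "linear \<phi>'" using assms by (rule has_derivative_linear)
  then have "\<phi>' (h, 0) = \<phi>' (1, 0) * h" for h
    using linear_cmul[of \<phi>' h "(1, 0)"] by simp
  then have "(\<lambda>h. \<phi>' (h, 0)) = (*) (\<phi>' (1, 0))" by (rule ext)
  ultimately show ?thesis by (simp only: has_field_derivative_def)
qed

lemma time_deriv_eq:
  fixes \<phi> :: "real \<times> 'a::euclidean_space \<Rightarrow> real"
  assumes "(\<phi> has_derivative \<phi>') (at z)"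
  shows "time_deriv \<phi> z = \<phi>' (1, 0)"
  using assms has_real_derivative_time_slice[of \<phi> \<phi>' "fst z" "snd z"]
  by (simp add: time_deriv_def case_prod_unfold DERIV_imp_deriv)

lemma space_deriv_eq:
  fixes \<phi> :: "real \<times> 'a::euclidean_space \<Rightarrow> real"
  assumes "(\<phi> has_derivative \<phi>') (at z)"
  shows "space_deriv b \<phi> z = \<phi>' (0, b)"
proof -
  obtain t x where z: "z = (t, x)" by (cases z)
  have "((\<lambda>h. (t, x + h *\<^sub>R b)) has_derivative (\<lambda>h. (0, h *\<^sub>R b))) (at 0)"
    by (auto intro!: derivative_eq_intros)
  from has_derivative_compose[OF this, of \<phi> \<phi>'] assms
  have "((\<lambda>h. \<phi> (t, x + h *\<^sub>R b)) has_derivative (\<lambda>h. \<phi>' (0, h *\<^sub>R b))) (at 0)" by (simp add: z)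
  moreover have "linear \<phi>'" using assms by (rule has_derivative_linear)
  then have "\<phi>' (0, h *\<^sub>R b) = \<phi>' (0, b) * h" for h
    using linear_cmul[of \<phi>' h "(0, b)"] by simp
  then have "(\<lambda>h. \<phi>' (0, h *\<^sub>R b)) = (*) (\<phi>' (0, b))" by (rule ext)
  ultimately have "((\<lambda>h. \<phi> (t, x + h *\<^sub>R b)) has_real_derivative \<phi>' (0, b)) (at 0)"
    by (simp only: has_field_derivative_def)
  then show ?thesis by (simp add: space_deriv_def z DERIV_imp_deriv)
qed

lemma open_cylinder: "open (cylinder T (UNIV :: 'a::euclidean_space set))"
  by (simp add: cylinder_def open_Times)

lemma sets_cylinder [measurable]: "cylinder T (UNIV :: 'a::euclidean_space set) \<in> sets borel"
  using open_cylinder by (rule borel_open)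

lemma
  fixes S :: "(real \<times> 'a::euclidean_space) set"
  assumes \<phi>: "\<phi> \<in> test_functions S" and S: "cylinder T UNIV \<subseteq> S"
  shows test_weight_test_function: "test_weight (cylinder T UNIV) \<phi>"
    and test_weight_time_deriv: "test_weight (cylinder T UNIV) (time_deriv \<phi>)"
    and test_weight_space_deriv: "test_weight (cylinder T UNIV) (space_deriv b \<phi>)"
proof -
  obtain \<phi>' where \<phi>': "\<And>z. z \<in> cylinder T UNIV \<Longrightarrow> (\<phi> has_derivative \<phi>' z) (at z)"
    "\<And>v. test_weight (cylinder T UNIV) (\<lambda>z. \<phi>' z v)" "test_weight (cylinder T UNIV) \<phi>"
    using test_function_derivative[OF \<phi> open_cylinder S] by blast
  show "test_weight (cylinder T UNIV) \<phi>" by fact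
  show "test_weight (cylinder T UNIV) (time_deriv \<phi>)"
    using \<phi>'(2)[of "(1, 0)"] by (subst test_weight_cong[OF time_deriv_eq[OF \<phi>'(1)]])
  show "test_weight (cylinder T UNIV) (space_deriv b \<phi>)"
    using \<phi>'(2)[of "(0, b)"] by (subst test_weight_cong[OF space_deriv_eq[OF \<phi>'(1)]])
qed

lemma le_one_plus_powr:
  fixes x p :: real
  assumes "0 \<le> x" "1 \<le> p"
  shows "x \<le> 1 + x powr p"
proof (cases "x \<le> 1")
  case False
  then show ?thesis using powr_mono[of 1 p x] assms by simp
qed (use assms in \<open>auto intro: add_increasing2\<close>)

lemma powr_add_le:
  fixes x y p :: real
  assumes "0 \<le> x" "0 \<le> y" "0 \<le> p"
  shows "(x + y) powr p \<le> 2 powr p * (x powr p + y powr p)"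
proof -
  have "(x + y) powr p \<le> (2 * max x y) powr p"
    using assms by (intro powr_mono2) auto
  also have "\<dots> = 2 powr p * (max x y) powr p"
    using assms by (subst powr_mult) auto
  also have "\<dots> \<le> 2 powr p * (x powr p + y powr p)"
    by (intro mult_left_mono) (auto simp: max_def)
  finally show ?thesis .
qed

lemma Lp_space_add:
  assumes p: "0 \<le> p" and f: "f \<in> Lp_space p D" and g: "g \<in> Lp_space p D"
  shows "(\<lambda>z. f z + g z) \<in> Lp_space p D"
proof -
  have [measurable]: "f \<in> borel_measurable (lebesgue_on D)" "g \<in> borel_measurable (lebesgue_on D)"
    using f g by (auto simp: Lp_space_def)
  have "integrable (lebesgue_on D) (\<lambda>z. norm (f z + g z) powr p)"
  proof (rule Bochner_Integration.integrable_bound)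
    show "integrable (lebesgue_on D) (\<lambda>z. 2 powr p * (norm (f z) powr p + norm (g z) powr p))"
      using f g by (auto simp: Lp_space_def)
    show "AE z in lebesgue_on D. norm (norm (f z + g z) powr p)
        \<le> norm (2 powr p * (norm (f z) powr p + norm (g z) powr p))"
    proof (intro AE_I2)
      fix z
      have "norm (f z + g z) powr p \<le> (norm (f z) + norm (g z)) powr p"
        using p by (intro powr_mono2 norm_triangle_ineq) auto
      also have "\<dots> \<le> 2 powr p * (norm (f z) powr p + norm (g z) powr p)"
        by (rule powr_add_le) (use p in auto)
      finally show "norm (norm (f z + g z) powr p) \<le> norm (2 powr p * (norm (f z) powr p + norm (g z) powr p))"
        by (simp add: abs_mult)
    qed
  qed measurable
  then show ?thesis by (simp add: Lp_space_def)
qed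

lemma Lp_space_uminus: "f \<in> Lp_space p D \<Longrightarrow> (\<lambda>z. - f z) \<in> Lp_space p D"
  by (simp add: Lp_space_def)

lemma Lp_space_inner:
  assumes p: "0 \<le> p" and f: "f \<in> Lp_space p D" and b: "b \<in> Basis"
  shows "(\<lambda>z. f z \<bullet> b) \<in> Lp_space p D"
proof -
  have [measurable]: "f \<in> borel_measurable (lebesgue_on D)" using f by (auto simp: Lp_space_def)
  have "integrable (lebesgue_on D) (\<lambda>z. norm (f z \<bullet> b) powr p)"
  proof (rule Bochner_Integration.integrable_bound)
    show "integrable (lebesgue_on D) (\<lambda>z. norm (f z) powr p)" using f by (auto simp: Lp_space_def)
    show "AE z in lebesgue_on D. norm (norm (f z \<bullet> b) powr p) \<le> norm (norm (f z) powr p)"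
      using p b by (intro AE_I2) (auto intro!: powr_mono2 Basis_le_norm)
  qed measurable
  then show ?thesis by (simp add: Lp_space_def)
qed

lemma test_weight_measurable:
  "open D \<Longrightarrow> test_weight D k \<Longrightarrow> k \<in> borel_measurable (lebesgue_on D)"
  unfolding test_weight_def
  by (intro continuous_imp_measurable_on_sets_lebesgue) (auto simp: lmeasurable_iff_integrable)

lemma test_weight_indicator_measurable:
  "open D \<Longrightarrow> test_weight D k \<Longrightarrow> (\<lambda>z. indicator D z * k z) \<in> borel_measurable borel"
  unfolding test_weight_def
  using borel_measurable_continuous_on_indicator[of D k] by auto

lemma integrable_Lp_times_test_weight:
  fixes f k :: "'z::euclidean_space \<Rightarrow> real"
  assumes p: "1 \<le> p" and D: "open D" and f: "f \<in> Lp_space p D" and k: "test_weight D k"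
  shows "integrable (lebesgue_on D) (\<lambda>z. f z * k z)"
proof -
  have [measurable]: "f \<in> borel_measurable (lebesgue_on D)" "k \<in> borel_measurable (lebesgue_on D)"
    using f test_weight_measurable[OF D k] by (auto simp: Lp_space_def)
  obtain M R where M: "\<And>z. z \<in> D \<Longrightarrow> \<bar>k z\<bar> \<le> M" and R: "\<And>z. z \<in> D \<Longrightarrow> R < norm z \<Longrightarrow> k z = 0"
    using k unfolding test_weight_def by blast
  show ?thesis
  proof (rule Bochner_Integration.integrable_bound)
    have "integrable lborel (\<lambda>z. indicator D z * indicator (cball 0 R) z :: real)"
      using D emeasure_bounded_finite[of "D \<inter> cball 0 R"]
      by (simp add: indicator_inter_arith[symmetric] integrable_indicator_iff bounded_Int)
    then have "integrable (lebesgue_on D) (\<lambda>z. indicator (cball 0 R) z :: real)"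
      using D by (subst integrable_lebesgue_on_AE[where g = "indicator (cball 0 R)"])
        (auto intro!: borel_measurable_indicator)
    then show "integrable (lebesgue_on D) (\<lambda>z. M * (norm (f z) powr p) + M * indicator (cball 0 R) z)"
      using f by (intro Bochner_Integration.integrable_add integrable_mult_right) (auto simp: Lp_space_def)
    show "AE z in lebesgue_on D. norm (f z * k z) \<le> norm (M * (norm (f z) powr p) + M * indicator (cball 0 R) z)"
    proof (intro AE_I2)
      fix z assume "z \<in> space (lebesgue_on D)"
      then have z: "z \<in> D" by simp
      then have M0: "0 \<le> M" using M[of z] by linarith
      show "norm (f z * k z) \<le> norm (M * (norm (f z) powr p) + M * indicator (cball 0 R) z)"
      proof (cases "R < norm z")
        case False
        have "\<bar>f z\<bar> * \<bar>k z\<bar> \<le> (1 + \<bar>f z\<bar> powr p) * M"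
          using M[OF z] p by (intro mult_mono le_one_plus_powr) auto
        then show ?thesis using False M0 by (simp add: abs_mult algebra_simps)
      qed (simp add: R z)
    qed
  qed measurable
qed

text \<open>Almost every value of the fractional integral of an \<open>L\<^sub>p\<close> function is given by an absolutely
  convergent integral; this is where the integrability of the kernel enters, through Tonelli.\<close>

lemma
  fixes u :: "real \<times> 'a::euclidean_space \<Rightarrow> real"
  assumes al: "\<alpha> < 1" and p: "1 \<le> p"
    and u: "u \<in> Lp_space p (cylinder T UNIV)"
  shows AE_integrable_frac_integral: "AE z in lborel. z \<in> cylinder T UNIV \<longrightarrow>
      integrable (lebesgue_on {0<..<fst z}) (\<lambda>s. (fst z - s) powr (- \<alpha>) * u (s, snd z))"
    and integrable_frac_integral_times_test_weight: "test_weight (cylinder T UNIV) k \<Longrightarrow>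
      integrable (lebesgue_on (cylinder T UNIV)) (\<lambda>z. frac_integral \<alpha> u z * k z)"
proof -
  let ?Q = "cylinder T (UNIV :: 'a set)"
  have inQ: "(t, x) \<in> ?Q \<longleftrightarrow> t \<in> {0<..<T}" for t x by (simp add: cylinder_def)
  have "u \<in> borel_measurable (lebesgue_on ?Q)" using u by (simp add: Lp_space_def)
  then obtain u' where u'm: "u' \<in> borel_measurable borel"
      and u'ae: "AE z in lborel. z \<in> ?Q \<longrightarrow> u z = u' z" and u'0: "\<And>z. z \<notin> ?Q \<Longrightarrow> u' z = 0"
    using lebesgue_on_borel_representative[OF sets_cylinder] by blast
  have [measurable]: "u' \<in> borel_measurable (borel \<Otimes>\<^sub>M borel)" using u'm by (simp add: borel_prod)

  have slices: "AE z in lborel. AE s in lborel. s \<in> {0<..<T} \<longrightarrow> u (s, snd (z :: real \<times> 'a)) = u' (s, snd z)"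
  proof -
    obtain N where N: "{z. \<not> (z \<in> ?Q \<longrightarrow> u z = u' z)} \<subseteq> N" "N \<in> sets lborel" "emeasure lborel N = 0"
      using u'ae by (auto elim!: AE_E)
    have [measurable]: "N \<in> sets (borel \<Otimes>\<^sub>M borel)" using N(2) unfolding borel_prod by simp
    have "(\<integral>\<^sup>+x. (\<integral>\<^sup>+s. indicator N (s, x) \<partial>lborel) \<partial>lborel) = (\<integral>\<^sup>+z. indicator N z \<partial>(lborel \<Otimes>\<^sub>M lborel))"
      by (rule lborel_pair.nn_integral_snd) measurable
    also have "\<dots> = 0" using N by (simp add: lborel_prod)
    finally have "AE x in lborel. (\<integral>\<^sup>+s. indicator N (s, x :: 'a) \<partial>lborel) = 0"
      by (subst (asm) nn_integral_0_iff_AE) measurable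
    moreover have "(AE s in lborel. (s, x) \<notin> N) \<longleftrightarrow> (\<integral>\<^sup>+s. indicator N (s, x) \<partial>lborel) = 0" for x :: 'a
      by (subst nn_integral_0_iff_AE) (auto simp: indicator_eq_0_iff)
    ultimately have "AE x in lborel. (\<integral>\<^sup>+s. indicator N (s, x :: 'a) \<partial>lborel) = 0" by simp
    moreover have "{z \<in> space (lborel \<Otimes>\<^sub>M lborel). (\<integral>\<^sup>+s. indicator N (s, snd (z :: real \<times> 'a)) \<partial>lborel) = 0}
        \<in> sets (lborel \<Otimes>\<^sub>M lborel)"
    proof -
      have "(\<lambda>z. \<integral>\<^sup>+s. indicator N (s, snd (z :: real \<times> 'a)) \<partial>lborel) \<in> borel_measurable (lborel \<Otimes>\<^sub>M lborel)"
        by measurable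
      from measurable_sets[OF this, of "{0}"] show ?thesis
        by (simp add: vimage_def Int_def conj_commute)
    qed
    ultimately have "AE z in (lborel :: real measure) \<Otimes>\<^sub>M (lborel :: 'a measure). (\<integral>\<^sup>+s. indicator N (s, snd z) \<partial>lborel) = 0"
      by (intro lborel_pair.AE_pair_measure) simp_all
    then have "AE z in lborel. (\<integral>\<^sup>+s. indicator N (s, snd (z :: real \<times> 'a)) \<partial>lborel) = 0"
      by (simp only: lborel_prod)
    then show ?thesis
    proof eventually_elim
      case (elim z)
      then have "AE s in lborel. indicator N (s, snd z) = (0::ennreal)"
        by (subst (asm) nn_integral_0_iff_AE) auto
      then show ?case
        by eventually_elim (use N(1) in \<open>force simp: inQ indicator_eq_0_iff\<close>)
    qed
  qed

  define k1 where "k1 = (\<lambda>t s. indicator {0<..<t} s * (t - s) powr (- \<alpha>) :: real)"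
  have [measurable]: "case_prod k1 \<in> borel_measurable (borel \<Otimes>\<^sub>M borel)"
    unfolding k1_def greaterThanLessThan_def lessThan_def greaterThan_def by measurable
  define K where "K = (\<lambda>(t, x). \<integral>\<^sup>+s. ennreal (k1 t s * \<bar>u' (s, x)\<bar>) \<partial>lborel)"
  have Km [measurable]: "K \<in> borel_measurable (borel \<Otimes>\<^sub>M borel)" unfolding K_def by measurable
  have K_loc: "(\<integral>\<^sup>+z. indicator ({0<..<T} \<times> cball (0::'a) R) z * K z \<partial>lborel) < \<infinity>" for R
  proof -
    have ker: "(\<integral>\<^sup>+t. indicator {0<..<T} t * ennreal (k1 t s) \<partial>lborel) \<le> ennreal (T powr (1 - \<alpha>) / (1 - \<alpha>)) * indicator {0<..<T} s"
      for s
    proof (cases "s \<in> {0<..<T}")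
      case True
      have "(\<integral>\<^sup>+t. indicator {0<..<T} t * ennreal (k1 t s) \<partial>lborel) =
          (\<integral>\<^sup>+t. ennreal (indicator {s<..<T} t * ((T - t) powr (1 - 1) * (t - s) powr (1 - \<alpha> - 1))) \<partial>lborel)"
        by (intro nn_integral_cong) (use True in \<open>auto simp: k1_def indicator_def\<close>)
      also have "\<dots> = ennreal ((T - s) powr (1 - \<alpha>) / (1 - \<alpha>))"
        using True al nn_integral_Beta_interval[of 1 "1 - \<alpha>" s T]
        by (simp add: Beta_commute[of 1] Beta_1_right)
      also have "\<dots> \<le> ennreal (T powr (1 - \<alpha>) / (1 - \<alpha>))"
        using True al by (intro ennreal_leI divide_right_mono powr_mono2) auto
      finally show ?thesis using True by simp
    next
      case False
      then have "indicator {0<..<T} t * ennreal (k1 t s) = 0" for t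
        by (auto simp: k1_def indicator_def)
      then have "(\<integral>\<^sup>+t. indicator {0<..<T} t * ennreal (k1 t s) \<partial>lborel) = 0"
        by (simp only: nn_integral_const mult_zero_left)
      then show ?thesis by simp
    qed
    have "(\<integral>\<^sup>+z. indicator ({0<..<T} \<times> cball (0::'a) R) z * K z \<partial>lborel) =
        (\<integral>\<^sup>+z. indicator ({0<..<T} \<times> cball (0::'a) R) z * K z \<partial>(lborel \<Otimes>\<^sub>M lborel))"
      by (simp add: lborel_prod)
    also have "\<dots> = (\<integral>\<^sup>+x. \<integral>\<^sup>+t. indicator ({0<..<T} \<times> cball (0::'a) R) (t, x) * K (t, x) \<partial>lborel \<partial>lborel)"
      by (rule lborel_pair.nn_integral_snd[symmetric]) measurable
    also have "\<dots> \<le> (\<integral>\<^sup>+x. \<integral>\<^sup>+s. ennreal (T powr (1 - \<alpha>) / (1 - \<alpha>)) *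
        (indicator ({0<..<T} \<times> cball (0::'a) R) (s, x) * ennreal \<bar>u' (s, x)\<bar>) \<partial>lborel \<partial>lborel)"
    proof (rule nn_integral_mono)
      fix x :: 'a
      have "(\<integral>\<^sup>+t. indicator ({0<..<T} \<times> cball (0::'a) R) (t, x) * K (t, x) \<partial>lborel) =
          (\<integral>\<^sup>+t. \<integral>\<^sup>+s. indicator ({0<..<T} \<times> cball (0::'a) R) (t, x) * ennreal (k1 t s * \<bar>u' (s, x)\<bar>) \<partial>lborel \<partial>lborel)"
        unfolding K_def prod.case by (intro nn_integral_cong nn_integral_cmult[symmetric]) measurable
      also have "\<dots> = (\<integral>\<^sup>+s. \<integral>\<^sup>+t. indicator ({0<..<T} \<times> cball (0::'a) R) (t, x) * ennreal (k1 t s * \<bar>u' (s, x)\<bar>) \<partial>lborel \<partial>lborel)"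
        by (rule lborel_pair.Fubini'[symmetric]) measurable
      also have "\<dots> = (\<integral>\<^sup>+s. \<integral>\<^sup>+t. (indicator (cball 0 R) x * ennreal \<bar>u' (s, x)\<bar>) * (indicator {0<..<T} t * ennreal (k1 t s)) \<partial>lborel \<partial>lborel)"
        by (intro nn_integral_cong) (auto simp: indicator_def k1_def ennreal_mult' mult_ac)
      also have "\<dots> = (\<integral>\<^sup>+s. (indicator (cball 0 R) x * ennreal \<bar>u' (s, x)\<bar>) * (\<integral>\<^sup>+t. indicator {0<..<T} t * ennreal (k1 t s) \<partial>lborel) \<partial>lborel)"
        by (intro nn_integral_cong nn_integral_cmult) measurable
      also have "\<dots> \<le> (\<integral>\<^sup>+s. (indicator (cball 0 R) x * ennreal \<bar>u' (s, x)\<bar>) * (ennreal (T powr (1 - \<alpha>) / (1 - \<alpha>)) * indicator {0<..<T} s) \<partial>lborel)"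
        by (intro nn_integral_mono mult_left_mono ker) simp
      also have "\<dots> = (\<integral>\<^sup>+s. ennreal (T powr (1 - \<alpha>) / (1 - \<alpha>)) *
          (indicator ({0<..<T} \<times> cball (0::'a) R) (s, x) * ennreal \<bar>u' (s, x)\<bar>) \<partial>lborel)"
        by (intro nn_integral_cong) (auto simp: indicator_def mult_ac)
      finally show "(\<integral>\<^sup>+t. indicator ({0<..<T} \<times> cball (0::'a) R) (t, x) * K (t, x) \<partial>lborel) \<le>
          (\<integral>\<^sup>+s. ennreal (T powr (1 - \<alpha>) / (1 - \<alpha>)) *
          (indicator ({0<..<T} \<times> cball (0::'a) R) (s, x) * ennreal \<bar>u' (s, x)\<bar>) \<partial>lborel)" .
    qed
    also have "\<dots> = (\<integral>\<^sup>+z. ennreal (T powr (1 - \<alpha>) / (1 - \<alpha>)) *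
        (indicator ({0<..<T} \<times> cball (0::'a) R) z * ennreal \<bar>u' z\<bar>) \<partial>(lborel \<Otimes>\<^sub>M lborel))"
      by (rule lborel_pair.nn_integral_snd) measurable
    also have "\<dots> = ennreal (T powr (1 - \<alpha>) / (1 - \<alpha>)) *
        (\<integral>\<^sup>+z. (indicator ({0<..<T} \<times> cball (0::'a) R) z * ennreal \<bar>u' z\<bar>) \<partial>(lborel \<Otimes>\<^sub>M lborel))"
      by (rule nn_integral_cmult) measurable
    also have "\<dots> < \<infinity>"
    proof -
      have "(\<integral>\<^sup>+z. indicator ({0<..<T} \<times> cball (0::'a) R) z * ennreal \<bar>u' z\<bar> \<partial>(lborel \<Otimes>\<^sub>M lborel)) =
          (\<integral>\<^sup>+z. indicator ({0<..<T} \<times> cball (0::'a) R) z * ennreal \<bar>u z\<bar> \<partial>lborel)"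
        unfolding lborel_prod
        by (intro nn_integral_cong_AE) (use u'ae in \<open>auto elim!: eventually_mono simp: indicator_def cylinder_def\<close>)
      also have "\<dots> \<le> (\<integral>\<^sup>+z. indicator ({0<..<T} \<times> cball (0::'a) R) z + ennreal (norm (u z) powr p) * indicator ?Q z \<partial>lborel)"
      proof (rule nn_integral_mono)
        fix z
        have "ennreal \<bar>u z\<bar> \<le> ennreal (1 + \<bar>u z\<bar> powr p)"
          by (intro ennreal_leI le_one_plus_powr p) simp
        then have "ennreal \<bar>u z\<bar> \<le> 1 + ennreal (\<bar>u z\<bar> powr p)" by (simp add: ennreal_plus)
        then show "indicator ({0<..<T} \<times> cball (0::'a) R) z * ennreal \<bar>u z\<bar> \<le>
            indicator ({0<..<T} \<times> cball (0::'a) R) z + ennreal (norm (u z) powr p) * indicator ?Q z"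
          by (auto simp: indicator_def cylinder_def)
      qed
      also have "\<dots> = (\<integral>\<^sup>+z. indicator ({0<..<T} \<times> cball (0::'a) R) z + ennreal (norm (u z) powr p) * indicator ?Q z \<partial>lebesgue)"
        by (rule nn_integral_completion[symmetric])
      also have "\<dots> = (\<integral>\<^sup>+z. indicator ({0<..<T} \<times> cball (0::'a) R) z \<partial>lebesgue) +
          (\<integral>\<^sup>+z. ennreal (norm (u z) powr p) * indicator ?Q z \<partial>lebesgue)"
      proof (rule nn_integral_add)
        have "(\<lambda>z. norm (u z) powr p) \<in> borel_measurable (lebesgue_on ?Q)"
          using u by (auto simp: Lp_space_def)
        then have "(\<lambda>z. indicator ?Q z *\<^sub>R (norm (u z) powr p)) \<in> borel_measurable lebesgue"
          by (subst (asm) borel_measurable_restrict_space_iff) auto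
        then have "(\<lambda>z. ennreal (indicator ?Q z *\<^sub>R (norm (u z) powr p))) \<in> borel_measurable lebesgue"
          by measurable
        moreover have "ennreal (indicator ?Q z *\<^sub>R (norm (u z) powr p)) = ennreal (norm (u z) powr p) * indicator ?Q z" for z
          by (auto simp: indicator_def)
        ultimately show "(\<lambda>z. ennreal (norm (u z) powr p) * indicator ?Q z) \<in> borel_measurable lebesgue"
          by (simp only:)
      qed (auto intro!: borel_measurable_indicator borel_Times sets_completionI_sets)
      also have "\<dots> < \<infinity>"
      proof -
        have b: "bounded ({0<..<T} \<times> cball (0::'a) R)"
          by (intro bounded_Times) (auto simp: bounded_ball intro: bounded_subset[OF bounded_closed_interval])
        have "(\<integral>\<^sup>+z. indicator ({0<..<T} \<times> cball (0::'a) R) z \<partial>lebesgue) < \<infinity>"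
          unfolding nn_integral_completion
          using emeasure_bounded_finite[OF b] by (subst nn_integral_indicator) (auto intro!: borel_Times)
        moreover have "(\<integral>\<^sup>+z. ennreal (norm (u z) powr p) * indicator ?Q z \<partial>lebesgue) < \<infinity>"
        proof -
          have "integrable (lebesgue_on ?Q) (\<lambda>z. norm (u z) powr p)" using u by (simp add: Lp_space_def)
          then have "(\<integral>\<^sup>+z. ennreal (norm (norm (u z) powr p)) \<partial>lebesgue_on ?Q) < \<infinity>"
            by (rule integrable_iff_bounded[THEN iffD1, THEN conjunct2])
          then show ?thesis by (simp add: nn_integral_lebesgue_on nn_integral_completion)
        qed
        ultimately show ?thesis by simp
      qed
      finally show ?thesis by (simp add: ennreal_mult_less_top)
    qed
    finally show ?thesis .
  qed
  have K_fin: "AE z in lborel. z \<in> ?Q \<longrightarrow> K z < \<infinity>"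
  proof -
    have "AE z in lborel. indicator ({0<..<T} \<times> cball (0::'a) (real n)) z * K z \<noteq> \<infinity>" for n
    proof (rule nn_integral_PInf_AE)
      show "(\<lambda>z. indicator ({0<..<T} \<times> cball (0::'a) (real n)) z * K z) \<in> borel_measurable lborel"
        using Km by (auto simp: borel_prod intro!: borel_measurable_times_ennreal borel_measurable_indicator borel_Times)
    qed (use K_loc[of "real n"] in simp)
    then have "AE z in lborel. \<forall>n. indicator ({0<..<T} \<times> cball (0::'a) (real n)) z * K z \<noteq> \<infinity>"
      by (simp add: AE_all_countable)
    then show ?thesis
    proof eventually_elim
      case (elim z)
      obtain n where n: "norm (snd z) \<le> real n" using real_arch_simple by blast
      show ?case
        using elim[rule_format, of n] n by (cases z) (auto simp: cylinder_def indicator_def less_top)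
    qed
  qed
  let ?i = "\<lambda>z. integrable (lebesgue_on {0<..<fst z}) (\<lambda>s. (fst z - s) powr (- \<alpha>) * u (s, snd z))"
  define J where "J = (\<lambda>z. 1 / Gamma (1 - \<alpha>) * RL (1 - \<alpha>) (\<lambda>s. u' (s, snd z)) (fst z))"
  have Jm [measurable]: "J \<in> borel_measurable (borel \<Otimes>\<^sub>M borel)"
    unfolding J_def by measurable
  have J_le: "ennreal \<bar>J z\<bar> \<le> ennreal (1 / Gamma (1 - \<alpha>)) * K z" if "K z < \<infinity>" for z
  proof -
    have G: "0 < Gamma (1 - \<alpha>)" using al by (intro Gamma_real_pos) auto
    obtain t x where z: "z = (t, x)" by (cases z)
    have "ennreal \<bar>RL (1 - \<alpha>) (\<lambda>s. u' (s, x)) t\<bar> \<le>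
        (\<integral>\<^sup>+s. ennreal (norm (indicator {0<..<t} s * ((t - s) powr (1 - \<alpha> - 1) * u' (s, x)))) \<partial>lborel)"
      by (rule ennreal_abs_RL_le)
    also have "\<dots> = K z"
      unfolding K_def z prod.case k1_def by (intro nn_integral_cong) (simp add: abs_mult mult.assoc)
    finally have le: "ennreal \<bar>RL (1 - \<alpha>) (\<lambda>s. u' (s, x)) t\<bar> \<le> K z" .
    have "ennreal \<bar>J z\<bar> = ennreal (1 / Gamma (1 - \<alpha>)) * ennreal \<bar>RL (1 - \<alpha>) (\<lambda>s. u' (s, x)) t\<bar>"
      using G by (simp add: J_def z abs_mult flip: ennreal_mult)
    then show ?thesis using mult_left_mono[OF le] by simp
  qed
  have both: "AE z in lborel. z \<in> ?Q \<longrightarrow> K z < \<infinity> \<and> ?i z \<and> frac_integral \<alpha> u z = J z"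
    using slices K_fin
  proof eventually_elim
    case (elim z)
    show ?case
    proof
      assume zQ: "z \<in> ?Q"
      obtain t x where z: "z = (t, x)" by (cases z)
      have t: "t \<in> {0<..<T}" using zQ by (simp add: z inQ)
      have fin: "K z < \<infinity>" using elim(2) zQ by simp
      have ae: "AE s in lborel. s \<in> {0<..<t} \<longrightarrow> (t - s) powr (- \<alpha>) * u (s, x) = (t - s) powr (- \<alpha>) * u' (s, x)"
        using elim(1) by eventually_elim (use t in \<open>auto simp: z\<close>)
      have m: "(\<lambda>s. (t - s) powr (- \<alpha>) * u' (s, x)) \<in> borel_measurable borel" by measurable
      have m': "(\<lambda>s. indicator {0<..<t} s * ((t - s) powr (- \<alpha>) * u' (s, x))) \<in> borel_measurable lborel"
        by measurable
      have "(\<integral>\<^sup>+s. ennreal (norm (indicator {0<..<t} s * ((t - s) powr (- \<alpha>) * u' (s, x)))) \<partial>lborel) = K z"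
        unfolding K_def z prod.case k1_def by (intro nn_integral_cong) (simp add: abs_mult mult.assoc)
      then have "integrable lborel (\<lambda>s. indicator {0<..<t} s * ((t - s) powr (- \<alpha>) * u' (s, x)))"
        using fin by (intro integrableI_bounded[OF m']) simp
      then have "?i z"
        using integrable_lebesgue_on_AE[OF _ m ae] by (simp add: z)
      moreover have "frac_integral \<alpha> u z = J z"
        using integral_lebesgue_on_AE[OF _ m ae] by (simp add: z frac_integral_def J_def RL_def)
      ultimately show "K z < \<infinity> \<and> ?i z \<and> frac_integral \<alpha> u z = J z" using fin by blast
    qed
  qed
  then show "AE z in lborel. z \<in> ?Q \<longrightarrow> ?i z" by eventually_elim blast

  assume k: "test_weight ?Q k"
  define k' where "k' = (\<lambda>z. indicator ?Q z * k z)"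
  have k'm: "k' \<in> borel_measurable borel"
    unfolding k'_def by (rule test_weight_indicator_measurable[OF open_cylinder k])
  have Jb: "J \<in> borel_measurable borel" using Jm by (simp add: borel_prod)
  obtain M R where M: "\<And>z. z \<in> ?Q \<Longrightarrow> \<bar>k z\<bar> \<le> M" and R: "\<And>z. z \<in> ?Q \<Longrightarrow> R < norm z \<Longrightarrow> k z = 0"
    using k unfolding test_weight_def by blast
  have Jk: "(\<lambda>z. J z * k' z) \<in> borel_measurable borel" using Jb k'm by measurable
  have ae: "AE z in lborel. z \<in> ?Q \<longrightarrow> frac_integral \<alpha> u z * k z = J z * k' z"
    using both by eventually_elim (auto simp: k'_def)
  have "integrable lborel (\<lambda>z. indicator ?Q z * (J z * k' z))"
  proof (rule integrableI_bounded)
    show "(\<lambda>z. indicator ?Q z * (J z * k' z)) \<in> borel_measurable lborel" using Jk by measurable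
    have "(\<integral>\<^sup>+z. ennreal (norm (indicator ?Q z * (J z * k' z))) \<partial>lborel) \<le>
        (\<integral>\<^sup>+z. ennreal (\<bar>M\<bar> * (1 / Gamma (1 - \<alpha>))) * (indicator ({0<..<T} \<times> cball (0::'a) R) z * K z) \<partial>lborel)"
    proof (rule nn_integral_mono_AE)
      show "AE z in lborel. ennreal (norm (indicator ?Q z * (J z * k' z))) \<le>
          ennreal (\<bar>M\<bar> * (1 / Gamma (1 - \<alpha>))) * (indicator ({0<..<T} \<times> cball (0::'a) R) z * K z)"
        using K_fin
      proof eventually_elim
        case (elim z)
        show ?case
        proof (cases "z \<in> ?Q \<and> norm z \<le> R")
          case True
          have G: "0 < Gamma (1 - \<alpha>)" using al by (intro Gamma_real_pos) auto
          have "norm (snd z) \<le> norm z" by (cases z) (simp add: norm_snd_le)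
          then have zi: "z \<in> {0<..<T} \<times> cball (0::'a) R" using True by (cases z) (auto simp: cylinder_def)
          have "ennreal (norm (indicator ?Q z * (J z * k' z))) = ennreal \<bar>k z\<bar> * ennreal \<bar>J z\<bar>"
            using True by (simp add: k'_def abs_mult mult.commute flip: ennreal_mult)
          also have "\<dots> \<le> ennreal \<bar>M\<bar> * (ennreal (1 / Gamma (1 - \<alpha>)) * K z)"
            using True M[of z] elim by (intro mult_mono ennreal_leI J_le) auto
          also have "\<dots> = ennreal (\<bar>M\<bar> * (1 / Gamma (1 - \<alpha>))) * K z"
            using G by (subst ennreal_mult) (auto simp: mult.assoc)
          finally show ?thesis using zi by simp
        next
          case False
          then have "indicator ?Q z * (J z * k' z) = 0" using R[of z] by (auto simp: k'_def indicator_def)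
          then show ?thesis by (simp only: norm_zero ennreal_0 zero_le)
        qed
      qed
    qed
    also have "\<dots> = ennreal (\<bar>M\<bar> * (1 / Gamma (1 - \<alpha>))) * (\<integral>\<^sup>+z. indicator ({0<..<T} \<times> cball (0::'a) R) z * K z \<partial>lborel)"
      using Km by (intro nn_integral_cmult)
        (auto simp: borel_prod intro!: borel_measurable_times_ennreal borel_measurable_indicator borel_Times)
    also have "\<dots> < \<infinity>" using K_loc[of R] by (simp add: ennreal_mult_less_top)
    finally show "(\<integral>\<^sup>+z. ennreal (norm (indicator ?Q z * (J z * k' z))) \<partial>lborel) < \<infinity>" .
  qed
  then show "integrable (lebesgue_on ?Q) (\<lambda>z. frac_integral \<alpha> u z * k z)"
    using integrable_lebesgue_on_AE[OF sets_cylinder Jk ae] by simp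
qed

lemma AE_lebesgue_on_iff:
  assumes "A \<in> sets borel"
  shows "(AE z in lebesgue_on A. P z) \<longleftrightarrow> (AE z in lborel. z \<in> A \<longrightarrow> P z)"
  using assms by (subst AE_restrict_space_iff) (auto simp: AE_completion_iff intro: sets_completionI_sets)

lemma has_frac_deriv_add:
  fixes u w :: "real \<times> 'a::euclidean_space \<Rightarrow> real"
  assumes al: "\<alpha> < 1" and p: "1 \<le> p"
    and u: "u \<in> Lp_space p (cylinder T UNIV)" "has_frac_deriv p \<alpha> T UNIV u g"
    and w: "w \<in> Lp_space p (cylinder T UNIV)" "has_frac_deriv p \<alpha> T UNIV w h"
  shows "has_frac_deriv p \<alpha> T UNIV (\<lambda>z. u z + w z) (\<lambda>z. g z + h z)"
proof -
  let ?Q = "cylinder T (UNIV :: 'a set)"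
  have gh: "g \<in> Lp_space p ?Q" "h \<in> Lp_space p ?Q"
    using u w by (auto simp: has_frac_deriv_def)
  have p0: "0 \<le> p" using p by simp
  have "(LINT z|lebesgue_on ?Q. (g z + h z) * \<phi> z) =
      - (LINT z|lebesgue_on ?Q. frac_integral \<alpha> (\<lambda>z. u z + w z) z * time_deriv \<phi> z)"
    if \<phi>: "\<phi> \<in> test_functions ({0..<T} \<times> UNIV)" for \<phi>
  proof -
    have sub: "?Q \<subseteq> {0..<T} \<times> UNIV" by (auto simp: cylinder_def)
    note k = test_weight_test_function[OF \<phi> sub] test_weight_time_deriv[OF \<phi> sub]
    note I = integrable_frac_integral_times_test_weight[OF al p _ k(2)]
    note I1 = I[OF u(1)] and I2 = I[OF w(1)] and I3 = I[OF Lp_space_add[OF p0 u(1) w(1)]]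
    have "AE z in lborel. z \<in> ?Q \<longrightarrow> frac_integral \<alpha> (\<lambda>z. u z + w z) z = frac_integral \<alpha> u z + frac_integral \<alpha> w z"
      using AE_integrable_frac_integral[OF al p u(1)] AE_integrable_frac_integral[OF al p w(1)]
    proof eventually_elim
      case (elim z)
      then show ?case by (cases z) (auto simp: frac_integral_def distrib_left add_divide_distrib)
    qed
    then have "AE z in lebesgue_on ?Q. frac_integral \<alpha> (\<lambda>z. u z + w z) z * time_deriv \<phi> z =
        frac_integral \<alpha> u z * time_deriv \<phi> z + frac_integral \<alpha> w z * time_deriv \<phi> z"
      by (subst AE_lebesgue_on_iff) (auto elim!: eventually_mono simp: distrib_right)
    then have "(LINT z|lebesgue_on ?Q. frac_integral \<alpha> (\<lambda>z. u z + w z) z * time_deriv \<phi> z) =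
        (LINT z|lebesgue_on ?Q. frac_integral \<alpha> u z * time_deriv \<phi> z + frac_integral \<alpha> w z * time_deriv \<phi> z)"
      using I1 I2 I3 by (intro integral_cong_AE borel_measurable_add borel_measurable_integrable)
    also have "\<dots> = (LINT z|lebesgue_on ?Q. frac_integral \<alpha> u z * time_deriv \<phi> z) +
        (LINT z|lebesgue_on ?Q. frac_integral \<alpha> w z * time_deriv \<phi> z)"
      by (rule Bochner_Integration.integral_add[OF I1 I2])
    also have "\<dots> = - ((LINT z|lebesgue_on ?Q. g z * \<phi> z) + (LINT z|lebesgue_on ?Q. h z * \<phi> z))"
      using u(2) w(2) \<phi> by (simp add: has_frac_deriv_def)
    also have "(LINT z|lebesgue_on ?Q. g z * \<phi> z) + (LINT z|lebesgue_on ?Q. h z * \<phi> z) =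
        (LINT z|lebesgue_on ?Q. g z * \<phi> z + h z * \<phi> z)"
      by (intro Bochner_Integration.integral_add[symmetric]
          integrable_Lp_times_test_weight[OF p open_cylinder _ k(1)] gh)
    finally show ?thesis by (simp add: distrib_right)
  qed
  then show ?thesis using Lp_space_add[OF p0 gh] by (simp add: has_frac_deriv_def)
qed

lemma has_frac_deriv_uminus:
  assumes "has_frac_deriv p \<alpha> T \<Omega> u g"
  shows "has_frac_deriv p \<alpha> T \<Omega> (\<lambda>z. - u z) (\<lambda>z. - g z)"
proof -
  have "frac_integral \<alpha> (\<lambda>z. - u z) = (\<lambda>z. - frac_integral \<alpha> u z)"
    by (auto simp: frac_integral_def)
  then show ?thesis using assms by (auto simp: has_frac_deriv_def Lp_space_uminus)
qed

lemma has_weak_gradient_add: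
  fixes u w :: "real \<times> 'a::euclidean_space \<Rightarrow> real"
  assumes p: "1 \<le> p"
    and u: "u \<in> Lp_space p (cylinder T UNIV)" "has_weak_gradient p T UNIV u G"
    and w: "w \<in> Lp_space p (cylinder T UNIV)" "has_weak_gradient p T UNIV w H"
  shows "has_weak_gradient p T UNIV (\<lambda>z. u z + w z) (\<lambda>z. G z + H z)"
proof -
  let ?Q = "cylinder T (UNIV :: 'a set)"
  have p0: "0 \<le> p" using p by simp
  have GH: "G \<in> Lp_space p ?Q" "H \<in> Lp_space p ?Q"
    using u w by (auto simp: has_weak_gradient_def)
  have "(LINT z|lebesgue_on ?Q. ((G z + H z) \<bullet> b) * \<phi> z) =
      - (LINT z|lebesgue_on ?Q. (u z + w z) * space_deriv b \<phi> z)"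
    if \<phi>: "\<phi> \<in> test_functions ?Q" and b: "b \<in> Basis" for \<phi> b
  proof -
    note k = test_weight_test_function[OF \<phi> order_refl] test_weight_space_deriv[OF \<phi> order_refl, of b]
    note I = integrable_Lp_times_test_weight[OF p open_cylinder]
    have "(LINT z|lebesgue_on ?Q. (u z + w z) * space_deriv b \<phi> z) =
        (LINT z|lebesgue_on ?Q. u z * space_deriv b \<phi> z) + (LINT z|lebesgue_on ?Q. w z * space_deriv b \<phi> z)"
      unfolding distrib_right
      by (rule Bochner_Integration.integral_add[OF I[OF u(1) k(2)] I[OF w(1) k(2)]])
    moreover have "(LINT z|lebesgue_on ?Q. ((G z + H z) \<bullet> b) * \<phi> z) =
        (LINT z|lebesgue_on ?Q. (G z \<bullet> b) * \<phi> z) + (LINT z|lebesgue_on ?Q. (H z \<bullet> b) * \<phi> z)"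
      unfolding distrib_right inner_add_left
      by (intro Bochner_Integration.integral_add I k(1) Lp_space_inner p0 GH b)
    ultimately show ?thesis using u(2) w(2) \<phi> b by (simp add: has_weak_gradient_def)
  qed
  then show ?thesis using Lp_space_add[OF p0 GH] by (simp add: has_weak_gradient_def)
qed

lemma has_weak_gradient_uminus:
  assumes "has_weak_gradient p T \<Omega> u G"
  shows "has_weak_gradient p T \<Omega> (\<lambda>z. - u z) (\<lambda>z. - G z)"
  using assms by (auto simp: has_weak_gradient_def Lp_space_uminus)

section \<open>Smooth approximants: the weak derivatives are the classical ones\<close>

lemma Lp_locally_integrable:
  fixes f g :: "'z::euclidean_space \<Rightarrow> real"
  assumes p: "1 \<le> p" and D: "open D" and f: "f \<in> Lp_space p D"
    and g [measurable]: "g \<in> borel_measurable borel" "AE z in lborel. z \<in> D \<longrightarrow> f z = g z"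
    and lu: "cbox l u \<subseteq> D"
  shows "integrable lborel (\<lambda>z. indicator (cbox l u) z * g z)"
proof -
  obtain R where R: "\<And>z. z \<in> cbox l u \<Longrightarrow> norm z \<le> R"
    using bounded_cbox[of l u] unfolding bounded_iff by blast
  define k where "k = (\<lambda>z::'z. max 0 (min 1 (R + 1 - norm z)))"
  have kc: "continuous_on UNIV k" unfolding k_def by (intro continuous_intros)
  then have [measurable]: "k \<in> borel_measurable borel" by (rule borel_measurable_continuous_onI)
  have "test_weight D k"
    unfolding test_weight_def
  proof (intro conjI)
    show "continuous_on D k" by (rule continuous_on_subset[OF kc]) auto
    show "\<exists>M. \<forall>z\<in>D. \<bar>k z\<bar> \<le> M" by (intro exI[of _ 1]) (auto simp: k_def)
    show "\<exists>R. \<forall>z\<in>D. R < norm z \<longrightarrow> k z = 0" by (intro exI[of _ "R + 1"]) (auto simp: k_def)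
  qed
  then have "integrable (lebesgue_on D) (\<lambda>z. f z * k z)"
    by (rule integrable_Lp_times_test_weight[OF p D f])
  then have "integrable lborel (\<lambda>z. indicator D z * (g z * k z))"
    by (subst (asm) integrable_lebesgue_on_AE[where g = "\<lambda>z. g z * k z"])
       (use D g in \<open>auto elim!: eventually_mono\<close>)
  then have "integrable lborel (\<lambda>z. indicator (cbox l u) z *\<^sub>R (indicator D z * (g z * k z)))"
    by (rule integrable_mult_indicator[rotated]) simp
  moreover have "indicator (cbox l u) z *\<^sub>R (indicator D z * (g z * k z)) = indicator (cbox l u) z * g z" for z
    using R[of z] lu by (auto simp: indicator_def k_def)
  ultimately show ?thesis by (simp only:)
qed

lemma integrable_bounded_on_cbox:
  fixes g :: "'z::euclidean_space \<Rightarrow> real"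
  assumes [measurable]: "g \<in> borel_measurable borel"
    and "\<And>z. z \<in> cbox l u \<Longrightarrow> \<bar>g z\<bar> \<le> M" "\<And>z. z \<notin> cbox l u \<Longrightarrow> g z = 0"
  shows "integrable lborel g"
  by (rule integrableI_bounded_set[where A = "cbox l u" and B = M])
     (use assms emeasure_bounded_finite[OF bounded_cbox, of l u] in auto)

lemma smooth_function_derivative:
  assumes "\<phi> \<in> smooth_functions UNIV" and supp: "\<And>z. z \<notin> cbox l u \<Longrightarrow> \<phi> z = 0"
  obtains \<phi>' where "\<And>z. (\<phi> has_derivative \<phi>' z) (at z)" "\<And>e. continuous_on UNIV (\<lambda>z. \<phi>' z e)"
    "\<And>z e. z \<notin> cbox l u \<Longrightarrow> \<phi>' z e = 0"
proof -
  have "Ck_on (Suc 0) UNIV \<phi>" using assms unfolding smooth_functions_def by blast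
  then obtain \<phi>' where \<phi>': "\<And>z. (\<phi> has_derivative \<phi>' z) (at z)" "\<And>e. continuous_on UNIV (\<lambda>z. \<phi>' z e)"
    using Ck_on_SucE[of 0 UNIV \<phi>] by auto
  have "\<phi>' z e = 0" if "z \<notin> cbox l u" for z e
  proof -
    have "((\<lambda>_. 0) has_derivative (\<lambda>_. 0)) (at z)" by simp
    then have "(\<phi> has_derivative (\<lambda>_. 0)) (at z)"
      by (rule has_derivative_transform_within_open[where s = "- cbox l u"])
         (use that supp in auto)
    then have "\<phi>' z = (\<lambda>_. 0)" using \<phi>'(1) has_derivative_unique by blast
    then show ?thesis by simp
  qed
  then show ?thesis using \<phi>' that by blast
qed

locale smooth_approximant =
  fixes \<alpha> T R :: real and v :: "real \<times> 'a::euclidean_space \<Rightarrow> real"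
    and v' :: "real \<times> 'a \<Rightarrow> real \<times> 'a \<Rightarrow> real"
  assumes al: "0 < \<alpha>" "\<alpha> < 1" and T: "0 < T"
    and der: "\<And>z. z \<in> {0..T} \<times> UNIV \<Longrightarrow> (v has_derivative v' z) (at z within {0..T} \<times> UNIV)"
    and cont: "\<And>e. continuous_on ({0..T} \<times> UNIV) (\<lambda>z. v' z e)"
    and supp: "\<And>t x. t \<in> {0..T} \<Longrightarrow> R < norm x \<Longrightarrow> v (t, x) = 0"
    and init: "\<And>x. v (0, x) = 0"
begin

abbreviation "Q \<equiv> cylinder T (UNIV :: 'a set)"

lemma inQ: "(t, x) \<in> Q \<longleftrightarrow> t \<in> {0<..<T}"
  by (simp add: cylinder_def)

lemma Q_subset: "Q \<subseteq> {0..T} \<times> UNIV"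
  by (auto simp: cylinder_def)

lemma der_Q:
  assumes z: "z \<in> Q"
  shows "(v has_derivative v' z) (at z)"
proof -
  have "(v has_derivative v' z) (at z within Q)"
    by (rule has_derivative_subset[OF der Q_subset]) (use z Q_subset in blast)
  then show ?thesis by (simp only: at_within_open[OF z open_cylinder])
qed

lemma cont_v: "continuous_on ({0..T} \<times> UNIV) v"
  using der has_derivative_continuous_on by blast

text \<open>The cut-off makes the classical time derivative globally bounded; as \<open>v\<close> vanishes for
  \<open>R < norm x\<close>, it changes the derivative on a null set at most.\<close>

definition "w = (\<lambda>z. indicator ({0<..<T} \<times> cball 0 R) z * v' z (1, 0))"

lemma w_measurable [measurable]: "w \<in> borel_measurable borel"
proof -
  have "(\<lambda>z. indicator ({0<..<T} \<times> cball 0 R) z *\<^sub>R v' z (1, 0)) \<in> borel_measurable borel"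
    by (rule borel_measurable_continuous_on_indicator)
       (auto intro!: borel_Times continuous_on_subset[OF cont])
  then show ?thesis by (simp add: w_def)
qed

lemma w_measurable_pair [measurable]: "w \<in> borel_measurable (borel \<Otimes>\<^sub>M borel)"
  using w_measurable by (simp add: borel_prod)

lemma w_bounded: obtains W where "\<And>z. \<bar>w z\<bar> \<le> W"
proof -
  have c: "continuous_on ({0..T} \<times> cball 0 R) (\<lambda>z. v' z (1, 0))"
    by (rule continuous_on_subset[OF cont]) auto
  obtain M where M: "0 \<le> M" "\<And>z. z \<in> {0..T} \<times> cball 0 R \<Longrightarrow> \<bar>v' z (1, 0)\<bar> \<le> M"
    using compact_continuous_abs_bound[OF compact_Times[OF compact_Icc compact_cball] c] by blast
  have "\<bar>w z\<bar> \<le> M" for z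
  proof (cases "z \<in> {0<..<T} \<times> cball 0 R")
    case True
    then have "z \<in> {0..T} \<times> cball 0 R" by auto
    then show ?thesis using M(2)[of z] True by (simp add: w_def)
  qed (simp add: w_def M(1))
  then show ?thesis using that by blast
qed

lemma v_eq_RL_w:
  assumes t: "t \<in> {0..T}"
  shows "v (t, x) = RL 1 (\<lambda>s. w (s, x)) t"
proof (cases "R < norm x")
  case True
  then show ?thesis using supp[OF t True] by (simp add: RL_def w_def)
next
  case False
  have "(LINT s|lborel. indicator {0..t} s *\<^sub>R v' (s, x) (1, 0)) = v (t, x) - v (0, x)"
  proof (rule integral_FTC_Icc)
    fix s assume s: "0 \<le> s" "s \<le> t"
    have 1: "((\<lambda>s. (s, x)) has_derivative (\<lambda>h. (h, 0))) (at s within {0..t})"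
      by (auto intro!: derivative_eq_intros)
    have 2: "(v has_derivative v' (s, x)) (at (s, x) within (\<lambda>s. (s, x)) ` {0..t})"
      by (rule has_derivative_subset[OF der]) (use s t in auto)
    have "((\<lambda>s. v (s, x)) has_derivative (\<lambda>h. v' (s, x) (h, 0))) (at s within {0..t})"
      by (rule has_derivative_in_compose[OF 1 2])
    moreover have "linear (v' (s, x))" using 2 by (rule has_derivative_linear)
    then have "v' (s, x) (h, 0) = h *\<^sub>R v' (s, x) (1, 0)" for h
      using linear_cmul[of "v' (s, x)" h "(1, 0)"] by simp
    then have "(\<lambda>h. v' (s, x) (h, 0)) = (\<lambda>h. h *\<^sub>R v' (s, x) (1, 0))" by (rule ext)
    ultimately show "((\<lambda>s. v (s, x)) has_vector_derivative v' (s, x) (1, 0)) (at s within {0..t})"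
      by (simp only: has_vector_derivative_def)
  next
    show "continuous_on {0..t} (\<lambda>s. v' (s, x) (1, 0))"
      by (rule continuous_on_compose2[OF cont]) (use t in \<open>auto intro!: continuous_intros\<close>)
  qed (use t in auto)
  also have "(LINT s|lborel. indicator {0..t} s *\<^sub>R v' (s, x) (1, 0)) = RL 1 (\<lambda>s. w (s, x)) t"
    unfolding RL_def
  proof (rule integral_cong_AE)
    have "(\<lambda>s. v' (s, x) (1, 0)) \<in> borel_measurable (restrict_space borel {0..t})"
      by (intro borel_measurable_continuous_on_restrict continuous_on_compose2[OF cont])
         (use t in \<open>auto intro!: continuous_intros\<close>)
    then show "(\<lambda>s. indicator {0..t} s *\<^sub>R v' (s, x) (1, 0)) \<in> borel_measurable lborel"
      by (subst (asm) borel_measurable_restrict_space_iff) auto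
    have "AE s in lborel. s \<noteq> 0 \<and> s \<noteq> t"
      using AE_lborel_singleton[of 0] AE_lborel_singleton[of t] by auto
    then show "AE s in lborel. indicator {0..t} s *\<^sub>R v' (s, x) (1, 0) =
        indicator {0<..<t} s * ((t - s) powr (1 - 1) * w (s, x))"
      by eventually_elim (use t False in \<open>auto simp: indicator_def w_def\<close>)
  qed measurable
  finally show ?thesis using init by simp
qed

text \<open>The fractional integral of the time derivative. It equals the time derivative of the fractional
  integral, because \<open>v\<close> vanishes at time \<open>0\<close>.\<close>

definition "h = (\<lambda>z. indicator Q z * (1 / Gamma (1 - \<alpha>) * RL (1 - \<alpha>) (\<lambda>s. w (s, snd z)) (fst z)))"

lemma h_measurable [measurable]: "h \<in> borel_measurable borel"
proof -
  have "(\<lambda>z. RL (1 - \<alpha>) (\<lambda>s. w (s, snd z)) (fst z)) \<in> borel_measurable (borel \<Otimes>\<^sub>M borel)"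
    by measurable
  then have [measurable]: "(\<lambda>z. RL (1 - \<alpha>) (\<lambda>s. w (s, snd z)) (fst z)) \<in> borel_measurable borel"
    by (simp add: borel_prod)
  show ?thesis unfolding h_def by measurable
qed

lemma h_measurable_pair [measurable]: "h \<in> borel_measurable (borel \<Otimes>\<^sub>M borel)"
  using h_measurable by (simp add: borel_prod)

lemma h_bounded: obtains W where "\<And>z. \<bar>h z\<bar> \<le> W"
proof -
  obtain W where W: "\<And>z. \<bar>w z\<bar> \<le> W" using w_bounded by blast
  have W0: "0 \<le> W" using W[of 0] by linarith
  have G: "0 < Gamma (1 - \<alpha>)" using al by (intro Gamma_real_pos) auto
  have "\<bar>h z\<bar> \<le> 1 / Gamma (1 - \<alpha>) * (W * (T powr (1 - \<alpha>) / (1 - \<alpha>)))" for z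
  proof (cases "z \<in> Q")
    case True
    obtain t x where z: "z = (t, x)" by (cases z)
    have t: "0 < t" "t < T" using True by (auto simp: z inQ)
    have "\<bar>RL (1 - \<alpha>) (\<lambda>s. w (s, x)) t\<bar> \<le> W * (t powr (1 - \<alpha>) / (1 - \<alpha>))"
      by (rule RL_abs_le) (use W t al in auto)
    also have "\<dots> \<le> W * (T powr (1 - \<alpha>) / (1 - \<alpha>))"
      using t al W0 by (intro mult_left_mono divide_right_mono powr_mono2) auto
    finally have "\<bar>RL (1 - \<alpha>) (\<lambda>s. w (s, x)) t\<bar> \<le> W * (T powr (1 - \<alpha>) / (1 - \<alpha>))" .
    from mult_left_mono[OF this, of "1 / Gamma (1 - \<alpha>)"] show ?thesis
      using True G by (simp add: h_def z abs_mult)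
  qed (use G W0 al in \<open>simp add: h_def\<close>)
  then show ?thesis using that by blast
qed

lemma RL_h:
  assumes a: "0 < a" and t: "t \<le> T"
  shows "RL a (\<lambda>s. h (s, x)) t = Beta a (1 - \<alpha>) / Gamma (1 - \<alpha>) * RL (a + 1 - \<alpha>) (\<lambda>s. w (s, x)) t"
proof -
  obtain W where W: "\<And>z. \<bar>w z\<bar> \<le> W" using w_bounded by blast
  have "RL a (\<lambda>s. h (s, x)) t = RL a (\<lambda>s. 1 / Gamma (1 - \<alpha>) * RL (1 - \<alpha>) (\<lambda>s. w (s, x)) s) t"
    by (rule RL_cong) (use t in \<open>auto simp: h_def inQ\<close>)
  also have "\<dots> = 1 / Gamma (1 - \<alpha>) * RL a (RL (1 - \<alpha>) (\<lambda>s. w (s, x))) t"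
    by (rule RL_cmult)
  also have "RL a (RL (1 - \<alpha>) (\<lambda>s. w (s, x))) t = Beta a (1 - \<alpha>) * RL (a + (1 - \<alpha>)) (\<lambda>s. w (s, x)) t"
    by (rule RL_RL) (use W a al in auto)
  finally show ?thesis by (simp add: algebra_simps)
qed

lemma v_eq_RL_h:
  assumes t: "t \<in> {0<..<T}"
  shows "v (t, x) = 1 / Gamma \<alpha> * RL \<alpha> (\<lambda>s. h (s, x)) t"
proof -
  have "0 < Gamma \<alpha>" "0 < Gamma (1 - \<alpha>)" using al by (auto intro!: Gamma_real_pos)
  then have G: "Gamma \<alpha> \<noteq> 0" and "Beta \<alpha> (1 - \<alpha>) / Gamma (1 - \<alpha>) = Gamma \<alpha>"
    by (auto simp: Beta_def)
  then show ?thesis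
    using v_eq_RL_w[of t x] RL_h[of \<alpha> t x] t al by simp
qed

lemma frac_integral_eq:
  assumes t: "t \<in> {0<..<T}"
  shows "frac_integral \<alpha> v (t, x) = RL 1 (\<lambda>s. h (s, x)) t"
proof -
  obtain W where W: "\<And>z. \<bar>w z\<bar> \<le> W" using w_bounded by blast
  have "frac_integral \<alpha> v (t, x) =
      1 / Gamma (1 - \<alpha>) * (LINT s|lborel. indicator {0<..<t} s * ((t - s) powr (- \<alpha>) * RL 1 (\<lambda>s. w (s, x)) s))"
    unfolding frac_integral_def prod.case
    by (subst integral_lebesgue_on_AE[where g = "\<lambda>s. (t - s) powr (- \<alpha>) * RL 1 (\<lambda>s. w (s, x)) s"])
       (use t in \<open>auto intro!: AE_I2 simp: v_eq_RL_w\<close>)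
  also have "\<dots> = 1 / Gamma (1 - \<alpha>) * RL (1 - \<alpha>) (RL 1 (\<lambda>s. w (s, x))) t"
    by (simp add: RL_def)
  also have "RL (1 - \<alpha>) (RL 1 (\<lambda>s. w (s, x))) t = Beta (1 - \<alpha>) 1 * RL (1 - \<alpha> + 1) (\<lambda>s. w (s, x)) t"
    by (rule RL_RL) (use W al in auto)
  also have "1 / Gamma (1 - \<alpha>) * \<dots> = RL 1 (\<lambda>s. h (s, x)) t"
    using t by (subst RL_h) (auto simp: Beta_commute[of 1] algebra_simps)
  finally show ?thesis .
qed

text \<open>The fractional integral of \<open>v\<close> is the primitive of \<open>h\<close>, so integrating by parts in time turns the
  defining identity of \<open>g\<close> into \<open>\<integral> (g - h) \<phi> = 0\<close>.\<close>

lemma frac_deriv_unique: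
  assumes p: "1 \<le> p" and v: "v \<in> Lp_space p Q" and g: "has_frac_deriv p \<alpha> T UNIV v g"
  shows "AE z in lborel. z \<in> Q \<longrightarrow> g z = h z"
proof -
  have gL: "g \<in> Lp_space p Q" using g by (simp add: has_frac_deriv_def)
  then obtain g' where [measurable]: "g' \<in> borel_measurable borel"
    and g'ae: "AE z in lborel. z \<in> Q \<longrightarrow> g z = g' z" and g'0: "\<And>z. z \<notin> Q \<Longrightarrow> g' z = 0"
    using lebesgue_on_borel_representative[OF sets_cylinder, of g T] by (auto simp: Lp_space_def)
  obtain W where W: "\<And>z. \<bar>h z\<bar> \<le> W" using h_bounded by blast
  have "AE z in lborel. z \<in> Q \<longrightarrow> g' z - h z = 0"
  proof (rule fundamental_lemma[OF open_cylinder])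
    show "(\<lambda>z. g' z - h z) \<in> borel_measurable borel" by measurable
    fix l u :: "real \<times> 'a" assume lu: "cbox l u \<subseteq> Q"
    have ig: "integrable lborel (\<lambda>z. indicator (cbox l u) z * g' z)"
      by (rule Lp_locally_integrable[OF p open_cylinder gL _ g'ae lu]) measurable
    have ih: "integrable lborel (\<lambda>z. indicator (cbox l u) z * h z)"
      by (rule integrable_bounded_on_cbox[where l = l and u = u and M = W]) (use W in auto)
    show "integrable lborel (\<lambda>z. indicator (cbox l u) z * (g' z - h z))"
      using Bochner_Integration.integrable_diff[OF ig ih] by (simp add: right_diff_distrib)
    fix \<phi> :: "real \<times> 'a \<Rightarrow> real"
    assume \<phi>: "\<phi> \<in> smooth_functions UNIV" and \<phi>0: "\<And>z. z \<notin> cbox l u \<Longrightarrow> \<phi> z = 0"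
    obtain \<phi>' where \<phi>': "\<And>z. (\<phi> has_derivative \<phi>' z) (at z)" "\<And>e. continuous_on UNIV (\<lambda>z. \<phi>' z e)"
        "\<And>z e. z \<notin> cbox l u \<Longrightarrow> \<phi>' z e = 0"
      using smooth_function_derivative[OF \<phi> \<phi>0] by blast
    have cont\<phi>: "continuous_on UNIV \<phi>"
      by (intro continuous_at_imp_continuous_on ballI has_derivative_continuous[OF \<phi>'(1)])
    have [measurable]: "\<phi> \<in> borel_measurable borel" "(\<lambda>z. \<phi>' z (1, 0)) \<in> borel_measurable borel"
      by (intro borel_measurable_continuous_onI cont\<phi> \<phi>'(2))+
    have [measurable]: "(\<lambda>z. \<phi>' z (1, 0)) \<in> borel_measurable (borel \<Otimes>\<^sub>M borel)"
      "\<phi> \<in> borel_measurable (borel \<Otimes>\<^sub>M borel)"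
      unfolding borel_prod by measurable
    have sub: "Q \<subseteq> {0..<T} \<times> UNIV" by (auto simp: cylinder_def)
    have \<phi>t: "\<phi> \<in> test_functions ({0..<T} \<times> UNIV)"
      by (rule test_functions_cbox[OF \<phi> \<phi>0]) (use lu sub in auto)
    note k = test_weight_test_function[OF \<phi>t sub] test_weight_time_deriv[OF \<phi>t sub]
    have td: "time_deriv \<phi> z = \<phi>' z (1, 0)" for z by (rule time_deriv_eq[OF \<phi>'(1)])
    have ae1: "AE z in lborel. z \<in> Q \<longrightarrow> g z * \<phi> z = g' z * \<phi> z"
      using g'ae by eventually_elim auto
    have i1: "integrable lborel (\<lambda>z. g' z * \<phi> z)"
    proof -
      have "integrable lborel (\<lambda>z. indicator Q z * (g' z * \<phi> z))"
        using integrable_Lp_times_test_weight[OF p open_cylinder gL k(1)]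
        by (subst (asm) integrable_lebesgue_on_AE[OF sets_cylinder _ ae1]) simp_all
      moreover have "indicator Q z * (g' z * \<phi> z) = g' z * \<phi> z" for z
        using g'0[of z] by (auto simp: indicator_def)
      ultimately show ?thesis by (simp only:)
    qed
    have e1: "(LINT z|lebesgue_on Q. g z * \<phi> z) = (LINT z|lborel. g' z * \<phi> z)"
    proof -
      have "(LINT z|lebesgue_on Q. g z * \<phi> z) = (LINT z|lborel. indicator Q z * (g' z * \<phi> z))"
        by (rule integral_lebesgue_on_AE[OF sets_cylinder _ ae1]) simp
      also have "\<dots> = (LINT z|lborel. g' z * \<phi> z)"
        by (intro Bochner_Integration.integral_cong refl) (use g'0 in \<open>auto simp: indicator_def\<close>)
      finally show ?thesis .
    qed
    obtain M where M: "\<And>z. \<bar>\<phi> z\<bar> \<le> M"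
    proof -
      obtain M where "0 \<le> M" "\<And>z. z \<in> cbox l u \<Longrightarrow> \<bar>\<phi> z\<bar> \<le> M"
        using compact_continuous_abs_bound[OF compact_cbox[of l u] continuous_on_subset[OF cont\<phi> subset_UNIV]] by blast
      then have "\<bar>\<phi> z\<bar> \<le> M" for z
        using \<phi>0[of z] by (cases "z \<in> cbox l u") auto
      then show ?thesis using that by blast
    qed
    have i2: "integrable lborel (\<lambda>z. h z * \<phi> z)"
    proof (rule integrable_bounded_on_cbox[where l = l and u = u and M = "W * M"])
      show "\<bar>h z * \<phi> z\<bar> \<le> W * M" for z
        unfolding abs_mult using W[of z] M[of z] by (intro mult_mono) auto
    qed (use \<phi>0 in auto)
    define J where "J = (\<lambda>z. RL 1 (\<lambda>s. h (s, snd z)) (fst z) * \<phi>' z (1, 0))"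
    have Jm2: "J \<in> borel_measurable (borel \<Otimes>\<^sub>M borel)" unfolding J_def by measurable
    then have Jm: "J \<in> borel_measurable borel" by (simp add: borel_prod)
    have ae2: "AE z in lborel. z \<in> Q \<longrightarrow> frac_integral \<alpha> v z * time_deriv \<phi> z = J z"
      by (rule AE_I2) (auto simp: J_def td frac_integral_eq cylinder_def)
    have i3: "integrable lborel (\<lambda>z. indicator Q z * J z)"
      using integrable_frac_integral_times_test_weight[OF al(2) p v k(2)]
      by (subst (asm) integrable_lebesgue_on_AE[OF sets_cylinder Jm ae2])
    have e2: "(LINT z|lebesgue_on Q. frac_integral \<alpha> v z * time_deriv \<phi> z) = (LINT z|lborel. indicator Q z * J z)"
      by (rule integral_lebesgue_on_AE[OF sets_cylinder Jm ae2])
    have "(LINT z|lborel. indicator Q z * J z) = (LINT x|lborel. LINT t|lborel. indicator Q (t, x) * J (t, x))"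
      using lborel_pair.integral_snd[of "\<lambda>t x. indicator Q (t, x) * J (t, x)"] i3
      by (simp add: lborel_prod case_prod_beta')
    also have "\<dots> = (LINT x|lborel. LINT t|lborel. - (h (t, x) * \<phi> (t, x)))"
    proof (rule Bochner_Integration.integral_cong[OF refl])
      fix x :: 'a
      have "(LINT t|lborel. indicator Q (t, x) * J (t, x)) =
          (LINT t|lborel. indicator {0<..<T} t * (RL 1 (\<lambda>s. h (s, x)) t * \<phi>' (t, x) (1, 0)))"
        by (intro Bochner_Integration.integral_cong refl) (simp add: J_def indicator_def inQ)
      also have "\<dots> = - (LINT s|lborel. indicator {0<..<T} s * (h (s, x) * \<phi> (s, x)))"
      proof (rule RL_1_by_parts)
        show "((\<lambda>t. \<phi> (t, x)) has_real_derivative \<phi>' (t, x) (1, 0)) (at t)" for t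
          by (rule has_real_derivative_time_slice[OF \<phi>'(1)])
        show "continuous_on UNIV (\<lambda>t. \<phi>' (t, x) (1, 0))"
          by (rule continuous_on_compose2[OF \<phi>'(2)]) (auto intro!: continuous_intros)
        show "\<phi> (T, x) = 0"
        proof (rule \<phi>0)
          have "(T, x) \<notin> Q" by (simp add: inQ)
          then show "(T, x) \<notin> cbox l u" using lu by blast
        qed
      qed (use W in auto)
      also have "\<dots> = (LINT t|lborel. - (h (t, x) * \<phi> (t, x)))"
      proof -
        have "(LINT s|lborel. indicator {0<..<T} s * (h (s, x) * \<phi> (s, x))) = (LINT t|lborel. h (t, x) * \<phi> (t, x))"
          by (intro Bochner_Integration.integral_cong refl) (simp add: h_def indicator_def inQ)
        then show ?thesis by simp
      qed
      finally show "(LINT t|lborel. indicator Q (t, x) * J (t, x)) = (LINT t|lborel. - (h (t, x) * \<phi> (t, x)))" .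
    qed
    also have "\<dots> = - (LINT z|lborel. h z * \<phi> z)"
      using lborel_pair.integral_snd[of "\<lambda>t x. h (t, x) * \<phi> (t, x)"] i2
      by (simp add: lborel_prod case_prod_beta')
    finally have "(LINT z|lborel. g' z * \<phi> z) = (LINT z|lborel. h z * \<phi> z)"
      using g \<phi>t e1 e2 by (simp add: has_frac_deriv_def)
    then show "(LINT z|lborel. (g' z - h z) * \<phi> z) = 0"
      using i1 i2 by (simp add: left_diff_distrib)
  qed
  then show ?thesis using g'ae by eventually_elim auto
qed

text \<open>Extended by zero, \<open>v \<phi>\<close> is continuously differentiable on the whole space and has compact
  support, so its derivative in direction \<open>(0, b)\<close> integrates to zero.\<close>

lemma weak_gradient_unique:
  assumes p: "1 \<le> p" and G: "has_weak_gradient p T UNIV v G" and b: "b \<in> Basis"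
  shows "AE z in lborel. z \<in> Q \<longrightarrow> G z \<bullet> b = v' z (0, b)"
proof -
  have GL: "(\<lambda>z. G z \<bullet> b) \<in> Lp_space p Q"
    using G p b by (intro Lp_space_inner) (auto simp: has_weak_gradient_def)
  then obtain g' where [measurable]: "g' \<in> borel_measurable borel"
    and g'ae: "AE z in lborel. z \<in> Q \<longrightarrow> G z \<bullet> b = g' z" and g'0: "\<And>z. z \<notin> Q \<Longrightarrow> g' z = 0"
    using lebesgue_on_borel_representative[OF sets_cylinder, of "\<lambda>z. G z \<bullet> b" T] by (auto simp: Lp_space_def)
  define d where "d = (\<lambda>z. indicator Q z *\<^sub>R v' z (0, b))"
  define v0 where "v0 = (\<lambda>z. indicator Q z *\<^sub>R v z)"
  have contQ: "continuous_on Q (\<lambda>z. v' z e)" "continuous_on Q v" for e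
    by (rule continuous_on_subset[OF cont Q_subset] continuous_on_subset[OF cont_v Q_subset])+
  have [measurable]: "d \<in> borel_measurable borel" "v0 \<in> borel_measurable borel"
    unfolding d_def v0_def by (intro borel_measurable_continuous_on_indicator sets_cylinder contQ)+
  have "AE z in lborel. z \<in> Q \<longrightarrow> g' z - d z = 0"
  proof (rule fundamental_lemma[OF open_cylinder])
    show "(\<lambda>z. g' z - d z) \<in> borel_measurable borel" by measurable
    fix l u :: "real \<times> 'a" assume lu: "cbox l u \<subseteq> Q"
    have bdd: "\<exists>M. \<forall>z\<in>cbox l u. \<bar>f z\<bar> \<le> M" if "continuous_on Q f" for f :: "real \<times> 'a \<Rightarrow> real"
      by (rule compact_continuous_abs_bound[OF compact_cbox continuous_on_subset[OF that lu]]) blast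
    have ig: "integrable lborel (\<lambda>z. indicator (cbox l u) z * g' z)"
      by (rule Lp_locally_integrable[OF p open_cylinder GL _ g'ae lu]) measurable
    obtain Md where Md: "\<And>z. z \<in> cbox l u \<Longrightarrow> \<bar>v' z (0, b)\<bar> \<le> Md" using bdd[OF contQ(1)] by blast
    have ih: "integrable lborel (\<lambda>z. indicator (cbox l u) z * d z)"
      by (rule integrable_bounded_on_cbox[where l = l and u = u and M = Md], measurable)
         (use Md lu in \<open>auto simp: d_def\<close>)
    show "integrable lborel (\<lambda>z. indicator (cbox l u) z * (g' z - d z))"
      using Bochner_Integration.integrable_diff[OF ig ih] by (simp add: right_diff_distrib)
    fix \<phi> :: "real \<times> 'a \<Rightarrow> real"
    assume \<phi>: "\<phi> \<in> smooth_functions UNIV" and \<phi>0: "\<And>z. z \<notin> cbox l u \<Longrightarrow> \<phi> z = 0"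
    obtain \<phi>' where \<phi>': "\<And>z. (\<phi> has_derivative \<phi>' z) (at z)" "\<And>e. continuous_on UNIV (\<lambda>z. \<phi>' z e)"
        "\<And>z e. z \<notin> cbox l u \<Longrightarrow> \<phi>' z e = 0"
      using smooth_function_derivative[OF \<phi> \<phi>0] by blast
    have cont\<phi>: "continuous_on UNIV \<phi>"
      by (intro continuous_at_imp_continuous_on ballI has_derivative_continuous[OF \<phi>'(1)])
    have [measurable]: "\<phi> \<in> borel_measurable borel" "(\<lambda>z. \<phi>' z (0, b)) \<in> borel_measurable borel"
      by (intro borel_measurable_continuous_onI cont\<phi> \<phi>'(2))+
    have \<phi>t: "\<phi> \<in> test_functions Q"
      by (rule test_functions_cbox[OF \<phi> \<phi>0 lu])
    note k = test_weight_test_function[OF \<phi>t order_refl]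
    have sd: "space_deriv b \<phi> z = \<phi>' z (0, b)" for z by (rule space_deriv_eq[OF \<phi>'(1)])
    have ae1: "AE z in lborel. z \<in> Q \<longrightarrow> (G z \<bullet> b) * \<phi> z = g' z * \<phi> z"
      using g'ae by eventually_elim auto
    have z1: "indicator Q z * (g' z * \<phi> z) = g' z * \<phi> z" for z
      using g'0[of z] by (auto simp: indicator_def)
    have "integrable lborel (\<lambda>z. indicator Q z * (g' z * \<phi> z))"
      using integrable_Lp_times_test_weight[OF p open_cylinder GL k]
      by (subst (asm) integrable_lebesgue_on_AE[OF sets_cylinder _ ae1]) simp_all
    then have i1: "integrable lborel (\<lambda>z. g' z * \<phi> z)" by (simp only: z1)
    have "(LINT z|lebesgue_on Q. (G z \<bullet> b) * \<phi> z) = (LINT z|lborel. indicator Q z * (g' z * \<phi> z))"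
      by (rule integral_lebesgue_on_AE[OF sets_cylinder _ ae1]) simp
    then have e1: "(LINT z|lebesgue_on Q. (G z \<bullet> b) * \<phi> z) = (LINT z|lborel. g' z * \<phi> z)"
      by (simp only: z1)
    have ae2: "AE z in lborel. z \<in> Q \<longrightarrow> v z * space_deriv b \<phi> z = v0 z * \<phi>' z (0, b)"
      by (rule AE_I2) (auto simp: v0_def sd)
    have *: "(LINT z|lebesgue_on Q. v z * space_deriv b \<phi> z) = (LINT z|lborel. indicator Q z * (v0 z * \<phi>' z (0, b)))"
      by (rule integral_lebesgue_on_AE[OF sets_cylinder _ ae2]) simp
    have e2: "(LINT z|lebesgue_on Q. v z * space_deriv b \<phi> z) = (LINT z|lborel. v0 z * \<phi>' z (0, b))"
    proof -
      have "indicator Q z * (v0 z * \<phi>' z (0, b)) = v0 z * \<phi>' z (0, b)" for z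
        by (auto simp: v0_def indicator_def)
      with * show ?thesis by (simp only:)
    qed
    have i2: "integrable lborel (\<lambda>z. d z * \<phi> z)"
    proof -
      obtain M where "\<And>z. z \<in> cbox l u \<Longrightarrow> \<bar>v' z (0, b) * \<phi> z\<bar> \<le> M"
        using bdd[OF continuous_on_mult[OF contQ(1) continuous_on_subset[OF cont\<phi> subset_UNIV]], of "(0, b)"]
        by blast
      then show ?thesis
        by (intro integrable_bounded_on_cbox[where l = l and u = u and M = M], measurable)
           (use \<phi>0 lu in \<open>auto simp: d_def\<close>)
    qed
    have i3: "integrable lborel (\<lambda>z. v0 z * \<phi>' z (0, b))"
    proof -
      obtain M where "\<And>z. z \<in> cbox l u \<Longrightarrow> \<bar>v z * \<phi>' z (0, b)\<bar> \<le> M"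
        using bdd[OF continuous_on_mult[OF contQ(2) continuous_on_subset[OF \<phi>'(2) subset_UNIV]], of "(0, b)"]
        by blast
      then show ?thesis
        by (intro integrable_bounded_on_cbox[where l = l and u = u and M = M], measurable)
           (use \<phi>'(3) lu in \<open>auto simp: v0_def\<close>)
    qed
    define \<Psi>' where "\<Psi>' = (\<lambda>z e. if z \<in> Q then v z * \<phi>' z e + v' z e * \<phi> z else 0)"
    have out: "(\<lambda>z. \<Psi>' z e) z = 0" if "z \<notin> cbox l u" for z e
      using that \<phi>0 \<phi>'(3) by (simp add: \<Psi>'_def)
    have "(LINT z|lborel. \<Psi>' z (0, b)) = 0"
    proof (rule integral_derivative_eq_0[where \<Psi> = "\<lambda>z. if z \<in> Q then v z * \<phi> z else 0" and l = l and u = u])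
      fix z
      show "((\<lambda>z. if z \<in> Q then v z * \<phi> z else 0) has_derivative \<Psi>' z) (at z)"
      proof (cases "z \<in> Q")
        case True
        have "((\<lambda>z. v z * \<phi> z) has_derivative (\<lambda>e. v z * \<phi>' z e + v' z e * \<phi> z)) (at z)"
          by (rule has_derivative_mult[OF der_Q[OF True] \<phi>'(1)])
        then have "((\<lambda>z. v z * \<phi> z) has_derivative \<Psi>' z) (at z)"
          using True by (simp add: \<Psi>'_def)
        then show ?thesis
          by (rule has_derivative_transform_within_open[OF _ open_cylinder True]) simp
      next
        case False
        then have zc: "z \<in> - cbox l u" using lu by blast
        have "((\<lambda>_. 0) has_derivative \<Psi>' z) (at z)" using False by (simp add: \<Psi>'_def)
        then show ?thesis
          by (rule has_derivative_transform_within_open[OF _ _ zc]) (use \<phi>0 in auto)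
      qed
    next
      have 1: "continuous_on Q (\<lambda>z. \<Psi>' z (0, b))"
      proof -
        have "continuous_on Q (\<lambda>z. v z * \<phi>' z (0, b) + v' z (0, b) * \<phi> z)"
          by (intro continuous_intros contQ continuous_on_subset[OF cont\<phi>] continuous_on_subset[OF \<phi>'(2)]) auto
        then show ?thesis by (rule continuous_on_eq) (simp add: \<Psi>'_def)
      qed
      have "continuous_on (- cbox l u) (\<lambda>_. 0 :: real)" by simp
      then have 2: "continuous_on (- cbox l u) (\<lambda>z. \<Psi>' z (0, b))"
        by (rule continuous_on_eq) (use out in auto)
      have "continuous_on (Q \<union> - cbox l u) (\<lambda>z. \<Psi>' z (0, b))"
        by (rule continuous_on_open_Un[OF open_cylinder _ 1 2]) auto
      moreover have "Q \<union> - cbox l u = UNIV" using lu by blast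
      ultimately show "continuous_on UNIV (\<lambda>z. \<Psi>' z (0, b))" by simp
    qed (use \<phi>0 in auto)
    moreover have "\<Psi>' z (0, b) = v0 z * \<phi>' z (0, b) + d z * \<phi> z" for z
      by (simp add: \<Psi>'_def v0_def d_def)
    ultimately have "(LINT z|lborel. v0 z * \<phi>' z (0, b)) + (LINT z|lborel. d z * \<phi> z) = 0"
      using i2 i3 by simp
    then have "(LINT z|lborel. g' z * \<phi> z) = (LINT z|lborel. d z * \<phi> z)"
      using G \<phi>t b e1 e2 by (simp add: has_weak_gradient_def)
    then show "(LINT z|lborel. (g' z - d z) * \<phi> z) = 0"
      using i1 i2 by (simp add: left_diff_distrib)
  qed
  then show ?thesis using g'ae by eventually_elim (auto simp: d_def)
qed

end

section \<open>The inequality for smooth approximants\<close>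

text \<open>The first factor is a power of the constant in the bound of \<open>v\<close> by its fractional derivative, the
  second one a power of the Sobolev constant.\<close>

definition GN_const :: "real \<Rightarrow> real \<Rightarrow> real \<Rightarrow> real \<Rightarrow> real" where
  "GN_const n \<alpha> p q =
     (1 / Gamma \<alpha> * ((p - 1) / (\<alpha> * p - 1)) powr (1 - 1/p)) powr (q - p) *
     (p * (n - 1) / (n - p)) powr (n * (q - p) / p)"

context smooth_approximant
begin

definition "v0 = (\<lambda>z. indicator Q z * v z)"

definition "dn = (\<lambda>z. indicator Q z * norm (\<Sum>b\<in>Basis. v' z (0, b) *\<^sub>R b))"

lemma v0_measurable [measurable]: "v0 \<in> borel_measurable borel"
proof -
  have "(\<lambda>z. indicator Q z *\<^sub>R v z) \<in> borel_measurable borel"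
    by (intro borel_measurable_continuous_on_indicator sets_cylinder continuous_on_subset[OF cont_v Q_subset])
  then show ?thesis by (simp add: v0_def)
qed

lemma dn_measurable [measurable]: "dn \<in> borel_measurable borel"
proof -
  have "(\<lambda>z. indicator Q z *\<^sub>R norm (\<Sum>b\<in>Basis. v' z (0, b) *\<^sub>R b)) \<in> borel_measurable borel"
    by (intro borel_measurable_continuous_on_indicator sets_cylinder continuous_intros
        continuous_on_subset[OF cont Q_subset])
  then show ?thesis by (simp add: dn_def)
qed

lemma v0_dn_measurable_pair [measurable]:
  "v0 \<in> borel_measurable (borel \<Otimes>\<^sub>M borel)" "dn \<in> borel_measurable (borel \<Otimes>\<^sub>M borel)"
  by (simp_all add: borel_prod)

lemma dn_nonneg: "0 \<le> dn z"
  by (simp add: dn_def)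

lemma v0_slice_Sobolev:
  assumes t: "t \<in> {0<..<T}" and p: "1 < p" "p < real DIM('a)"
  defines "n \<equiv> real DIM('a)"
  shows "(\<integral>\<^sup>+x. ennreal (\<bar>v0 (t, x)\<bar> powr (n * p / (n - p))) \<partial>lborel) \<le>
    ennreal ((p * (n - 1) / (n - p)) powr (n * p / (n - p))) *
    epow (\<integral>\<^sup>+x. ennreal (dn (t, x) powr p) \<partial>lborel) (n * p / (n - p) / p)"
  unfolding n_def
proof (rule Sobolev_inequality[where u' = "\<lambda>x e. v' (t, x) (0, e)" and R = R])
  have tQ: "(t, x) \<in> Q" for x using t by (simp add: inQ)
  have v0t: "(\<lambda>x. v0 (t, x)) = (\<lambda>x. v (t, x))" using tQ by (simp add: v0_def)
  show "((\<lambda>x. v0 (t, x)) has_derivative (\<lambda>e. v' (t, x) (0, e))) (at x)" for x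
  proof -
    have "((\<lambda>x. (t, x)) has_derivative (\<lambda>e. (0, e))) (at x)"
      by (auto intro!: derivative_eq_intros)
    from has_derivative_compose[OF this der_Q[OF tQ]] show ?thesis unfolding v0t .
  qed
  show "continuous_on UNIV (\<lambda>x. v' (t, x) (0, e))" for e
    by (rule continuous_on_compose2[OF cont]) (use t in \<open>auto intro!: continuous_intros\<close>)
  show "v0 (t, x) = 0" if "R < norm x" for x
    using supp[OF _ that, of t] t by (simp add: v0_def)
  show "\<bar>v' (t, x) (0, b)\<bar> \<le> dn (t, x)" if b: "b \<in> Basis" for x b
  proof -
    have "\<bar>(\<Sum>i\<in>Basis. v' (t, x) (0, i) *\<^sub>R i) \<bullet> b\<bar> \<le> norm (\<Sum>i\<in>Basis. v' (t, x) (0, i) *\<^sub>R i)"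
      by (rule Basis_le_norm[OF b])
    then show ?thesis using b tQ by (simp add: dn_def)
  qed
qed (use p dn_nonneg in simp_all)

text \<open>The exponents \<open>a\<close>, \<open>b\<close>, \<open>c\<close> below solve \<open>p b + P c = p\<close> and \<open>a + b + c = 1\<close>; then the Sobolev
  inequality turns the power \<open>c\<close> of the \<open>L\<^sub>P\<close> integral into the power \<open>\<theta>\<close> of the integral of the
  gradient, and \<open>b + \<theta> = 1\<close> is what the last Hoelder inequality, in time, requires.\<close>

lemma interpolation_inequality:
  assumes p: "1 < p" "p < real DIM('a)" "1 < \<alpha> * p"
    and q: "p < q" "q \<le> p + p\<^sup>2 / real DIM('a)"
  defines "n \<equiv> real DIM('a)"
  defines "\<theta> \<equiv> n * (q - p) / p\<^sup>2"
  shows "(\<integral>\<^sup>+z. ennreal (\<bar>v0 z\<bar> powr q) \<partial>lborel) \<le>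
    ennreal (GN_const n \<alpha> p q * T powr ((\<alpha> - 1/p) * (q - p))) *
    (epow (\<integral>\<^sup>+z. ennreal (\<bar>h z\<bar> powr p) \<partial>lborel) ((q - p) / p) *
    (epow (\<integral>\<^sup>+z. ennreal (\<bar>v0 z\<bar> powr p) \<partial>lborel) (1 - \<theta>) *
     epow (\<integral>\<^sup>+z. ennreal (dn z powr p) \<partial>lborel) \<theta>))"
proof -
  have np: "1 < p" "p < n" "0 < n" using p by (auto simp: n_def)
  define P where "P = n * p / (n - p)"
  \<comment> \<open>The three exponents with which the powers of \<open>h\<close>, of \<open>v\<close> in \<open>L\<^sub>p\<close> and of \<open>v\<close> in \<open>L\<^sub>P\<close> enter.\<close>
  define a where "a = (q - p) / p"
  define b where "b = 1 - \<theta>"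
  define c where "c = \<theta> * (n - p) / n"
  have \<theta>: "0 < \<theta>" "\<theta> \<le> 1" using np q by (auto simp: \<theta>_def n_def field_simps)
  have abc: "0 < a" "0 \<le> b" "0 < c" using np q \<theta> by (auto simp: a_def b_def c_def)
  have "\<theta> * p = n * a" using np by (simp add: \<theta>_def a_def power2_eq_square)
  then have ap: "a = \<theta> * p / n" using np by (simp add: field_simps)
  have sum1: "a + b + c = 1" using np by (simp add: ap b_def c_def field_simps)
  have Pc: "P * c = \<theta> * p" using np by (simp add: P_def c_def)
  have pbc: "p * b + P * c = p" using Pc by (simp add: b_def algebra_simps)
  have Pc': "P * c = n * (q - p) / p" using np by (simp add: Pc \<theta>_def power2_eq_square)
  define K where "K = 1 / Gamma \<alpha> * ((p - 1) / (\<alpha> * p - 1)) powr (1 - 1/p)"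
  define K' where "K' = K * T powr (\<alpha> - 1/p)"
  have G: "0 < Gamma \<alpha>" using al by (intro Gamma_real_pos) auto
  have K0: "0 \<le> K" using G by (simp add: K_def)
  have K'0: "0 \<le> K'" using K0 by (simp add: K'_def)
  define cs where "cs = p * (n - 1) / (n - p)"
  define F where "F = (\<lambda>x. \<integral>\<^sup>+s. ennreal (\<bar>h (s, x)\<bar> powr p) \<partial>lborel)"
  have [measurable]: "F \<in> borel_measurable borel" unfolding F_def by measurable
  define H where "H = (\<integral>\<^sup>+z. ennreal (\<bar>h z\<bar> powr p) \<partial>lborel)"
  define E where "E = (\<lambda>t. \<integral>\<^sup>+x. ennreal (\<bar>v0 (t, x)\<bar> powr p) \<partial>lborel)"
  define X where "X = (\<lambda>t. \<integral>\<^sup>+x. ennreal (\<bar>v0 (t, x)\<bar> powr P) \<partial>lborel)"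
  define Y where "Y = (\<lambda>t. \<integral>\<^sup>+x. ennreal (dn (t, x) powr p) \<partial>lborel)"
  have [measurable]: "E \<in> borel_measurable borel" "Y \<in> borel_measurable borel"
    unfolding E_def Y_def by measurable
  have F_int: "(\<integral>\<^sup>+x. F x \<partial>lborel) = H"
    unfolding F_def H_def
    using lborel_pair.nn_integral_snd[of "\<lambda>z. ennreal (\<bar>h z\<bar> powr p)"] by (simp add: lborel_prod)
  have EY_int: "(\<integral>\<^sup>+t. E t \<partial>lborel) = (\<integral>\<^sup>+z. ennreal (\<bar>v0 z\<bar> powr p) \<partial>lborel)"
      "(\<integral>\<^sup>+t. Y t \<partial>lborel) = (\<integral>\<^sup>+z. ennreal (dn z powr p) \<partial>lborel)"
    unfolding E_def Y_def
    using lborel.nn_integral_fst[of "\<lambda>z. ennreal (\<bar>v0 z\<bar> powr p)" lborel]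
      lborel.nn_integral_fst[of "\<lambda>z. ennreal (dn z powr p)" lborel] by (simp_all add: lborel_prod)
  have sup: "ennreal \<bar>v0 (t, x)\<bar> \<le> ennreal K' * epow (F x) (1/p)" if t: "t \<in> {0<..<T}" for t x
  proof -
    have "ennreal \<bar>RL \<alpha> (\<lambda>s. h (s, x)) t\<bar> \<le>
      ennreal (((p - 1) / (\<alpha> * p - 1)) powr (1 - 1/p) * T powr (\<alpha> - 1/p)) *
      epow (\<integral>\<^sup>+s. ennreal (indicator {0<..<T} s * \<bar>h (s, x)\<bar> powr p) \<partial>lborel) (1/p)"
      by (rule RL_bound) (use al p t in auto)
    moreover have "(\<integral>\<^sup>+s. ennreal (indicator {0<..<T} s * \<bar>h (s, x)\<bar> powr p) \<partial>lborel) = F x"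
      unfolding F_def by (intro nn_integral_cong) (auto simp: h_def inQ indicator_def)
    ultimately have "ennreal \<bar>RL \<alpha> (\<lambda>s. h (s, x)) t\<bar> \<le>
      ennreal (((p - 1) / (\<alpha> * p - 1)) powr (1 - 1/p) * T powr (\<alpha> - 1/p)) * epow (F x) (1/p)" by simp
    from mult_left_mono[OF this, of "ennreal (1 / Gamma \<alpha>)"]
    have "ennreal (1 / Gamma \<alpha>) * ennreal \<bar>RL \<alpha> (\<lambda>s. h (s, x)) t\<bar> \<le>
      ennreal (1 / Gamma \<alpha>) * ennreal (((p - 1) / (\<alpha> * p - 1)) powr (1 - 1/p) * T powr (\<alpha> - 1/p)) * epow (F x) (1/p)"
      by (simp add: mult.assoc)
    moreover have "ennreal \<bar>v0 (t, x)\<bar> = ennreal (1 / Gamma \<alpha>) * ennreal \<bar>RL \<alpha> (\<lambda>s. h (s, x)) t\<bar>"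
      using t G by (simp add: v0_def inQ v_eq_RL_h[OF t] abs_mult flip: ennreal_mult)
    moreover have "ennreal (1 / Gamma \<alpha>) * ennreal (((p - 1) / (\<alpha> * p - 1)) powr (1 - 1/p) * T powr (\<alpha> - 1/p)) = ennreal K'"
      using G by (simp add: K'_def K_def mult.assoc flip: ennreal_mult)
    ultimately show ?thesis by simp
  qed
  have pw: "ennreal (\<bar>v0 (t, x)\<bar> powr q) \<le> ennreal (K' powr (q - p)) *
      (epow (F x) a * (epow (ennreal (\<bar>v0 (t, x)\<bar> powr p)) b * epow (ennreal (\<bar>v0 (t, x)\<bar> powr P)) c))"
    if t: "t \<in> {0<..<T}" for t x
  proof -
    let ?y = "\<bar>v0 (t, x)\<bar>"
    have 1: "ennreal (?y powr p) = epow (ennreal (?y powr p)) b * epow (ennreal (?y powr P)) c"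
    proof (cases "b = 0")
      case True
      then have "P * c = p" using pbc by simp
      then show ?thesis using True abc by (simp add: epow_ennreal powr_powr)
    next
      case False
      then show ?thesis using abc pbc
        by (simp add: epow_ennreal powr_powr flip: ennreal_mult powr_add)
    qed
    have "ennreal (?y powr q) = epow (ennreal ?y) (q - p) * ennreal (?y powr p)"
      using q by (simp add: epow_ennreal flip: ennreal_mult powr_add)
    also have "\<dots> \<le> epow (ennreal K' * epow (F x) (1/p)) (q - p) * ennreal (?y powr p)"
      using q by (intro mult_right_mono epow_mono sup t) auto
    also have "epow (ennreal K' * epow (F x) (1/p)) (q - p) = ennreal (K' powr (q - p)) * epow (F x) a"
      using q np K'0 by (simp add: epow_mult epow_ennreal epow_epow a_def)
    finally show ?thesis using 1 by (simp add: mult.assoc)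
  qed
  define M where "M = ennreal (K' powr (q - p)) * (epow H a * ennreal (cs powr (P * c)))"
  have slice: "(\<integral>\<^sup>+x. ennreal (\<bar>v0 (t, x)\<bar> powr q) \<partial>lborel) \<le> M * (epow (E t) b * epow (Y t) \<theta>)" for t
  proof (cases "t \<in> {0<..<T}")
    case True
    have "(\<integral>\<^sup>+x. ennreal (\<bar>v0 (t, x)\<bar> powr q) \<partial>lborel) \<le> (\<integral>\<^sup>+x. ennreal (K' powr (q - p)) *
      (epow (F x) a * (epow (ennreal (\<bar>v0 (t, x)\<bar> powr p)) b * epow (ennreal (\<bar>v0 (t, x)\<bar> powr P)) c)) \<partial>lborel)"
      by (intro nn_integral_mono pw True)
    also have "\<dots> = ennreal (K' powr (q - p)) * (\<integral>\<^sup>+x.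
      (epow (F x) a * (epow (ennreal (\<bar>v0 (t, x)\<bar> powr p)) b * epow (ennreal (\<bar>v0 (t, x)\<bar> powr P)) c)) \<partial>lborel)"
      by (rule nn_integral_cmult) measurable
    also have "\<dots> \<le> ennreal (K' powr (q - p)) * (epow (\<integral>\<^sup>+x. F x \<partial>lborel) a * (epow (E t) b * epow (X t) c))"
      unfolding E_def X_def
      by (intro mult_left_mono nn_integral_Holder3) (use abc sum1 in \<open>auto\<close>)
    also have "\<dots> \<le> ennreal (K' powr (q - p)) * (epow H a * (epow (E t) b * (ennreal (cs powr (P * c)) * epow (Y t) \<theta>)))"
    proof -
      have "X t \<le> ennreal (cs powr P) * epow (Y t) (P / p)"
        unfolding X_def Y_def P_def cs_def n_def by (rule v0_slice_Sobolev[OF True p(1,2)])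
      then have "epow (X t) c \<le> epow (ennreal (cs powr P) * epow (Y t) (P / p)) c"
        using abc by (intro epow_mono) auto
      also have "\<dots> = ennreal (cs powr (P * c)) * epow (Y t) \<theta>"
      proof -
        have "0 \<le> P / p" using np by (simp add: P_def)
        moreover have "P / p * c = \<theta>" using Pc np by (simp add: field_simps)
        ultimately show ?thesis using abc by (simp add: epow_mult epow_ennreal epow_epow powr_powr)
      qed
      finally show ?thesis unfolding F_int by (intro mult_left_mono) auto
    qed
    also have "\<dots> = M * (epow (E t) b * epow (Y t) \<theta>)"
      by (simp add: M_def mult_ac)
    finally show ?thesis .
  next
    case False
    then have "v0 (t, x) = 0" for x by (simp add: v0_def inQ)
    then show ?thesis by simp
  qed
  have "(\<integral>\<^sup>+z. ennreal (\<bar>v0 z\<bar> powr q) \<partial>lborel) = (\<integral>\<^sup>+t. \<integral>\<^sup>+x. ennreal (\<bar>v0 (t, x)\<bar> powr q) \<partial>lborel \<partial>lborel)"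
    using lborel.nn_integral_fst[of "\<lambda>z. ennreal (\<bar>v0 z\<bar> powr q)" lborel] by (simp add: lborel_prod)
  also have "\<dots> \<le> (\<integral>\<^sup>+t. M * (epow (E t) b * epow (Y t) \<theta>) \<partial>lborel)"
    by (rule nn_integral_mono) (rule slice)
  also have "\<dots> = M * (\<integral>\<^sup>+t. epow (E t) b * epow (Y t) \<theta> \<partial>lborel)"
    by (rule nn_integral_cmult) measurable
  also have "\<dots> \<le> M * (epow (\<integral>\<^sup>+t. E t \<partial>lborel) b * epow (\<integral>\<^sup>+t. Y t \<partial>lborel) \<theta>)"
    using nn_integral_Holder3[of "\<lambda>_. 0" lborel E Y 0 b \<theta>] abc \<theta>
    by (intro mult_left_mono) (auto simp: b_def)
  also have "M = ennreal (GN_const n \<alpha> p q * T powr ((\<alpha> - 1/p) * (q - p))) * epow H a"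
  proof -
    have "K' powr (q - p) * cs powr (P * c) = GN_const n \<alpha> p q * T powr ((\<alpha> - 1/p) * (q - p))"
    proof -
      have *: "K' powr (q - p) = K powr (q - p) * T powr ((\<alpha> - 1/p) * (q - p))"
        unfolding K'_def using K0 by (simp add: powr_mult powr_powr)
      show ?thesis unfolding * GN_const_def K_def cs_def Pc' by (simp only: mult_ac)
    qed
    then have "ennreal (K' powr (q - p)) * ennreal (cs powr (P * c)) =
        ennreal (GN_const n \<alpha> p q * T powr ((\<alpha> - 1/p) * (q - p)))"
      by (simp flip: ennreal_mult)
    then show ?thesis unfolding M_def by (metis mult.assoc mult.commute)
  qed
  finally show ?thesis
    unfolding EY_int by (simp add: H_def a_def b_def mult.assoc)
qed

end

lemma nn_integral_norm_powr_cylinder: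
  assumes "f' \<in> borel_measurable borel" and "AE z in lborel. z \<in> cylinder T UNIV \<longrightarrow> norm (f z) = \<bar>f' z\<bar>"
    and "\<And>z. z \<notin> cylinder T UNIV \<Longrightarrow> f' z = 0"
  shows "(\<integral>\<^sup>+z. ennreal (norm (f z) powr p) \<partial>lebesgue_on (cylinder T (UNIV :: 'a::euclidean_space set))) =
    (\<integral>\<^sup>+z. ennreal (\<bar>f' z\<bar> powr p) \<partial>lborel)"
  unfolding nn_integral_lebesgue_on[OF sets_cylinder]
  by (intro nn_integral_cong_AE) (use assms in \<open>auto elim!: eventually_mono simp: indicator_def\<close>)

lemma interpolation_inequality_smooth:
  fixes v :: "real \<times> 'a::euclidean_space \<Rightarrow> real"
  assumes al: "0 < \<alpha>" "\<alpha> < 1" and T: "0 < T"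
    and smooth: "v \<in> smooth_functions ({0..T} \<times> UNIV)"
    and supp: "\<And>t x. t \<in> {0..T} \<Longrightarrow> R < norm x \<Longrightarrow> v (t, x) = 0" and init: "\<And>x. v (0, x) = 0"
    and p: "1 < p" "p < real DIM('a)" "1 < \<alpha> * p"
    and q: "p < q" "q \<le> p + p\<^sup>2 / real DIM('a)"
    and v: "v \<in> Lp_space p (cylinder T UNIV)"
    and g: "has_frac_deriv p \<alpha> T UNIV v g" and G: "has_weak_gradient p T UNIV v G"
  defines "n \<equiv> real DIM('a)"
  defines "\<theta> \<equiv> n * (q - p) / p\<^sup>2"
  defines "L \<equiv> lebesgue_on (cylinder T UNIV)"
  shows "(\<integral>\<^sup>+z. ennreal (norm (v z) powr q) \<partial>L) \<le>
    ennreal (GN_const n \<alpha> p q * T powr ((\<alpha> - 1/p) * (q - p))) *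
    (epow (\<integral>\<^sup>+z. ennreal (norm (g z) powr p) \<partial>L) ((q - p) / p) *
    (epow (\<integral>\<^sup>+z. ennreal (norm (v z) powr p) \<partial>L) (1 - \<theta>) *
     epow (\<integral>\<^sup>+z. ennreal (norm (G z) powr p) \<partial>L) \<theta>))"
proof -
  have "Ck_on (Suc 0) ({0..T} \<times> UNIV) v" using smooth unfolding smooth_functions_def by blast
  then obtain v' where v': "\<And>z. z \<in> {0..T} \<times> UNIV \<Longrightarrow> (v has_derivative v' z) (at z within {0..T} \<times> UNIV)"
      "\<And>e. Ck_on 0 ({0..T} \<times> UNIV) (\<lambda>z. v' z e)"
    using Ck_on_SucE by blast
  interpret smooth_approximant \<alpha> T R v v'
    by standard (use al T v' supp init in auto)
  have p1: "1 \<le> p" using p by simp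
  have hg: "AE z in lborel. z \<in> Q \<longrightarrow> norm (g z) = \<bar>h z\<bar>"
    using frac_deriv_unique[OF p1 v g] by eventually_elim simp
  have "AE z in lborel. \<forall>b\<in>Basis. z \<in> Q \<longrightarrow> G z \<bullet> b = v' z (0, b)"
    by (intro AE_finite_allI weak_gradient_unique[OF p1 G]) auto
  then have dG: "AE z in lborel. z \<in> Q \<longrightarrow> norm (G z) = \<bar>dn z\<bar>"
  proof eventually_elim
    case (elim z)
    show ?case
    proof
      assume z: "z \<in> Q"
      have "G z = (\<Sum>b\<in>Basis. (G z \<bullet> b) *\<^sub>R b)" by (simp add: euclidean_representation)
      also have "\<dots> = (\<Sum>b\<in>Basis. v' z (0, b) *\<^sub>R b)" using elim z by (intro sum.cong) auto
      finally show "norm (G z) = \<bar>dn z\<bar>" using z by (simp add: dn_def)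
    qed
  qed
  have vv: "AE z in lborel. z \<in> Q \<longrightarrow> norm (v z) = \<bar>v0 z\<bar>" by (rule AE_I2) (simp add: v0_def)
  have out: "h z = 0" "dn z = 0" "v0 z = 0" if "z \<notin> Q" for z
    using that by (simp_all add: h_def dn_def v0_def)
  have eqs:
    "(\<integral>\<^sup>+z. ennreal (norm (g z) powr r) \<partial>lebesgue_on Q) = (\<integral>\<^sup>+z. ennreal (\<bar>h z\<bar> powr r) \<partial>lborel)"
    "(\<integral>\<^sup>+z. ennreal (norm (v z) powr r) \<partial>lebesgue_on Q) = (\<integral>\<^sup>+z. ennreal (\<bar>v0 z\<bar> powr r) \<partial>lborel)"
    "(\<integral>\<^sup>+z. ennreal (norm (G z) powr r) \<partial>lebesgue_on Q) = (\<integral>\<^sup>+z. ennreal (\<bar>dn z\<bar> powr r) \<partial>lborel)" for r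
    by (rule nn_integral_norm_powr_cylinder; fact h_measurable hg v0_measurable vv dn_measurable dG out)+
  have "\<bar>dn z\<bar> = dn z" for z by (simp add: dn_nonneg)
  then show ?thesis
    using interpolation_inequality[OF p q] by (simp only: L_def n_def \<theta>_def eqs)
qed

section \<open>Passage to the limit\<close>

lemma nn_integral_Lp:
  assumes "f \<in> Lp_space p D"
  shows "(\<integral>\<^sup>+z. ennreal (norm (f z) powr p) \<partial>lebesgue_on D) = ennreal (LINT z|lebesgue_on D. norm (f z) powr p)"
  using assms by (intro nn_integral_eq_integral) (auto simp: Lp_space_def)

lemma integral_norm_powr_eq_Lp_norm:
  assumes "0 < p"
  shows "(LINT z|lebesgue_on D. norm (f z) powr p) = Lp_norm p D f powr p"
proof -
  have "0 \<le> (LINT z|lebesgue_on D. norm (f z) powr p)" by (intro integral_nonneg_AE) auto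
  then show ?thesis using assms by (simp add: Lp_norm_def powr_powr)
qed

lemma integral_norm_powr_add_le:
  assumes p: "0 \<le> p" and f: "f \<in> Lp_space p D" and g: "g \<in> Lp_space p D"
  shows "(LINT z|lebesgue_on D. norm (f z + g z) powr p) \<le>
    2 powr p * ((LINT z|lebesgue_on D. norm (f z) powr p) + (LINT z|lebesgue_on D. norm (g z) powr p))"
proof -
  have i: "integrable (lebesgue_on D) (\<lambda>z. norm (f z) powr p)" "integrable (lebesgue_on D) (\<lambda>z. norm (g z) powr p)"
    using f g by (auto simp: Lp_space_def)
  have "(LINT z|lebesgue_on D. norm (f z + g z) powr p) \<le>
      (LINT z|lebesgue_on D. 2 powr p * (norm (f z) powr p + norm (g z) powr p))"
  proof (rule integral_mono)
    show "integrable (lebesgue_on D) (\<lambda>z. norm (f z + g z) powr p)"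
      using Lp_space_add[OF p f g] by (simp add: Lp_space_def)
    show "integrable (lebesgue_on D) (\<lambda>z. 2 powr p * (norm (f z) powr p + norm (g z) powr p))"
      using i by simp
    fix z
    have "norm (f z + g z) powr p \<le> (norm (f z) + norm (g z)) powr p"
      using p by (intro powr_mono2 norm_triangle_ineq) auto
    also have "\<dots> \<le> 2 powr p * (norm (f z) powr p + norm (g z) powr p)"
      by (rule powr_add_le) (use p in auto)
    finally show "norm (f z + g z) powr p \<le> 2 powr p * (norm (f z) powr p + norm (g z) powr p)" .
  qed
  also have "\<dots> = 2 powr p * ((LINT z|lebesgue_on D. norm (f z) powr p) + (LINT z|lebesgue_on D. norm (g z) powr p))"
    using i by simp
  finally show ?thesis .
qed

lemma has_frac_deriv_frac_deriv:
  "has_frac_deriv p \<alpha> T \<Omega> u g \<Longrightarrow> has_frac_deriv p \<alpha> T \<Omega> u (frac_deriv p \<alpha> T \<Omega> u)"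
  unfolding frac_deriv_def by (rule someI[where P = "has_frac_deriv p \<alpha> T \<Omega> u"])

lemma has_weak_gradient_weak_gradient:
  "has_weak_gradient p T \<Omega> u G \<Longrightarrow> has_weak_gradient p T \<Omega> u (weak_gradient p T \<Omega> u)"
  unfolding weak_gradient_def by (rule someI[where P = "has_weak_gradient p T \<Omega> u"])

text \<open>Up to the factors \<open>2 powr p\<close>, which come from \<open>(x + y) powr p \<le> 2 powr p * (x powr p + y powr p)\<close>, this
  is the bound for the smooth approximants. Their integrals exceed those of \<open>\<psi>\<close> by
  an error \<open>\<delta>\<close> at most, apart from that factor, and Fatou's lemma along an almost everywhere convergent subsequence applies.\<close>

lemma interpolation_inequality_H0:
  fixes \<psi> :: "real \<times> 'a::euclidean_space \<Rightarrow> real"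
  assumes al: "0 < \<alpha>" "\<alpha> < 1" and T: "0 < T"
    and p: "1 < p" "p < real DIM('a)" "1 < \<alpha> * p"
    and q: "p < q" "q \<le> p + p\<^sup>2 / real DIM('a)"
    and \<psi>: "\<psi> \<in> H0_space p \<alpha> T UNIV"
  defines "n \<equiv> real DIM('a)"
  defines "\<theta> \<equiv> n * (q - p) / p\<^sup>2"
  defines "L \<equiv> lebesgue_on (cylinder T (UNIV :: 'a set))"
  shows "(\<integral>\<^sup>+z. ennreal (norm (\<psi> z) powr q) \<partial>L) \<le>
    ennreal (GN_const n \<alpha> p q * T powr ((\<alpha> - 1/p) * (q - p)) *
    ((2 powr p * (LINT z|L. norm (frac_deriv p \<alpha> T UNIV \<psi> z) powr p)) powr ((q - p) / p) *
    ((2 powr p * (LINT z|L. norm (\<psi> z) powr p)) powr (1 - \<theta>) *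
     (2 powr p * (LINT z|L. norm (weak_gradient p T UNIV \<psi> z) powr p)) powr \<theta>)))"
proof -
  let ?Q = "cylinder T (UNIV :: 'a set)"
  have np: "1 < p" "p < n" "0 < n" using p by (auto simp: n_def)
  have p0: "0 \<le> p" "0 < p" "1 \<le> p" using p by auto
  have \<theta>: "0 < \<theta>" "\<theta> \<le> 1" using np q by (auto simp: \<theta>_def n_def field_simps)
  define a where "a = (q - p) / p"
  have a0: "0 < a" using np q by (simp add: a_def)
  define g where "g = frac_deriv p \<alpha> T UNIV \<psi>"
  define G where "G = weak_gradient p T UNIV \<psi>"
  have \<psi>L: "\<psi> \<in> Lp_space p ?Q" and g: "has_frac_deriv p \<alpha> T UNIV \<psi> g" and G: "has_weak_gradient p T UNIV \<psi> G"
    using \<psi> has_frac_deriv_frac_deriv has_weak_gradient_weak_gradient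
    unfolding H0_space_def H_space_def g_def G_def by blast+
  have gL: "g \<in> Lp_space p ?Q" "G \<in> Lp_space p ?Q"
    using g G by (auto simp: has_frac_deriv_def has_weak_gradient_def)
  define I where "I = (\<lambda>f::real \<times> 'a \<Rightarrow> real. LINT z|L. norm (f z) powr p)"
  define I' where "I' = (\<lambda>f::real \<times> 'a \<Rightarrow> 'a. LINT z|L. norm (f z) powr p)"
  have I0: "0 \<le> I f" for f unfolding I_def by (intro integral_nonneg_AE) auto
  have I'0: "0 \<le> I' f" for f unfolding I'_def by (intro integral_nonneg_AE) auto
  define C where "C = GN_const n \<alpha> p q * T powr ((\<alpha> - 1/p) * (q - p))"
  have C0: "0 \<le> C" by (simp add: C_def GN_const_def)
  define bnd where "bnd = (\<lambda>\<delta>. C * ((2 powr p * (\<delta> + I g)) powr a *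
    ((2 powr p * (\<delta> + I \<psi>)) powr (1 - \<theta>) * (2 powr p * (\<delta> + I' G)) powr \<theta>)))"
  have "(\<integral>\<^sup>+z. ennreal (norm (\<psi> z) powr q) \<partial>L) \<le> ennreal (bnd 0)"
  proof (cases "I \<psi> = 0")
    \<comment> \<open>For \<open>\<theta> = 1\<close> the factor \<open>x powr (1 - \<theta>)\<close> jumps to \<open>0\<close> at \<open>x = 0\<close>, so \<open>bnd\<close> need not be
      continuous at \<open>0\<close> in this case.\<close>
    case True
    have [measurable]: "\<psi> \<in> borel_measurable L" using \<psi>L by (simp add: Lp_space_def L_def)
    have "(\<integral>\<^sup>+z. ennreal (norm (\<psi> z) powr p) \<partial>L) = 0"
      using nn_integral_Lp[OF \<psi>L] True by (simp add: I_def L_def)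
    then have "AE z in L. ennreal (norm (\<psi> z) powr p) = 0"
      by (subst (asm) nn_integral_0_iff_AE) auto
    then have "AE z in L. ennreal (norm (\<psi> z) powr q) = 0"
      by eventually_elim (simp add: ennreal_eq_0_iff powr_eq_0_iff)
    then have "(\<integral>\<^sup>+z. ennreal (norm (\<psi> z) powr q) \<partial>L) = 0"
      by (subst nn_integral_0_iff_AE) auto
    then show ?thesis by simp
  next
    case False
    then have E0: "0 < I \<psi>" using I0[of \<psi>] by simp
    obtain v :: "nat \<Rightarrow> real \<times> 'a \<Rightarrow> real" where
      v: "\<forall>k. v k \<in> H_space p \<alpha> T UNIV \<and> v k \<in> smooth_functions ({0..T} \<times> UNIV) \<and>
          (\<exists>R. \<forall>t\<in>{0..T}. \<forall>x\<in>UNIV. R < norm x \<longrightarrow> v k (t, x) = 0) \<and> (\<forall>x\<in>UNIV. v k (0, x) = 0)" and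
      lim: "(\<lambda>k. H_norm p \<alpha> T UNIV (\<lambda>z. v k z - \<psi> z)) \<longlonglongrightarrow> 0"
      using \<psi> unfolding H0_space_def by blast
    have vH: "v k \<in> H_space p \<alpha> T UNIV" and vs: "v k \<in> smooth_functions ({0..T} \<times> UNIV)"
      and vR: "\<exists>R. \<forall>t\<in>{0..T}. \<forall>x\<in>UNIV. R < norm x \<longrightarrow> v k (t, x) = 0" and vi: "v k (0, x) = 0" for k x
      using v by blast+
    define w where "w = (\<lambda>k z. v k z + - \<psi> z)"
    define gw where "gw = (\<lambda>k. frac_deriv p \<alpha> T UNIV (w k))"
    define Gw where "Gw = (\<lambda>k. weak_gradient p T UNIV (w k))"
    have vL: "v k \<in> Lp_space p ?Q" for k using vH[of k] by (simp add: H_space_def)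
    have m\<psi>: "(\<lambda>z. - \<psi> z) \<in> Lp_space p ?Q" by (rule Lp_space_uminus[OF \<psi>L])
    have wL: "w k \<in> Lp_space p ?Q" for k
      unfolding w_def by (rule Lp_space_add[OF p0(1) vL m\<psi>])
    have gw: "has_frac_deriv p \<alpha> T UNIV (w k) (gw k)" for k
    proof -
      obtain g1 where "has_frac_deriv p \<alpha> T UNIV (v k) g1" using vH[of k] by (auto simp: H_space_def)
      from has_frac_deriv_add[OF al(2) p0(3) vL this m\<psi> has_frac_deriv_uminus[OF g]]
      show ?thesis unfolding gw_def w_def by (rule has_frac_deriv_frac_deriv)
    qed
    have Gw: "has_weak_gradient p T UNIV (w k) (Gw k)" for k
    proof -
      obtain G1 where "has_weak_gradient p T UNIV (v k) G1" using vH[of k] by (auto simp: H_space_def)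
      from has_weak_gradient_add[OF p0(3) vL this m\<psi> has_weak_gradient_uminus[OF G]]
      show ?thesis unfolding Gw_def w_def by (rule has_weak_gradient_weak_gradient)
    qed
    have gwL: "gw k \<in> Lp_space p ?Q" "Gw k \<in> Lp_space p ?Q" for k
      using gw[of k] Gw[of k] by (auto simp: has_frac_deriv_def has_weak_gradient_def)
    have v_eq: "v k = (\<lambda>z. w k z + \<psi> z)" for k by (simp add: w_def)
    have vg: "has_frac_deriv p \<alpha> T UNIV (v k) (\<lambda>z. gw k z + g z)" for k
      using has_frac_deriv_add[OF al(2) p0(3) wL gw \<psi>L g] by (simp add: w_def)
    have vG: "has_weak_gradient p T UNIV (v k) (\<lambda>z. Gw k z + G z)" for k
      using has_weak_gradient_add[OF p0(3) wL Gw \<psi>L G] by (simp add: w_def)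
    \<comment> \<open>The three parts of the norm converge separately.\<close>
    have Hn: "H_norm p \<alpha> T UNIV (\<lambda>z. v k z - \<psi> z) =
        Lp_norm p ?Q (gw k) + Lp_norm p ?Q (w k) + Lp_norm p ?Q (Gw k)" for k
      by (simp add: H_norm_def gw_def Gw_def w_def)
    have N0: "0 \<le> Lp_norm p ?Q f" for f :: "real \<times> 'a \<Rightarrow> 'c::euclidean_space" by (simp add: Lp_norm_def)
    have small: "(\<lambda>k. x k powr p) \<longlonglongrightarrow> 0"
      if "\<And>k. 0 \<le> x k" "\<And>k. x k \<le> H_norm p \<alpha> T UNIV (\<lambda>z. v k z - \<psi> z)" for x :: "nat \<Rightarrow> real"
    proof -
      have "x \<longlonglongrightarrow> 0"
        by (rule tendsto_sandwich[OF _ _ tendsto_const lim]) (use that in auto)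
      then have "(\<lambda>k. x k powr p) \<longlonglongrightarrow> 0 powr p"
        by (rule tendsto_powr'[OF _ tendsto_const]) (use p that in auto)
      then show ?thesis by simp
    qed
    have Iw: "(\<lambda>k. I (w k)) \<longlonglongrightarrow> 0"
      unfolding I_def L_def integral_norm_powr_eq_Lp_norm[OF p0(2)]
      by (rule small) (auto simp: Hn N0)
    have Ig: "(\<lambda>k. I (gw k)) \<longlonglongrightarrow> 0"
      unfolding I_def L_def integral_norm_powr_eq_Lp_norm[OF p0(2)]
      by (rule small) (auto simp: Hn N0)
    have IG: "(\<lambda>k. I' (Gw k)) \<longlonglongrightarrow> 0"
      unfolding I'_def L_def integral_norm_powr_eq_Lp_norm[OF p0(2)]
      by (rule small) (auto simp: Hn N0)
    have "\<exists>r::nat\<Rightarrow>nat. strict_mono r \<and> (AE z in L. (\<lambda>k. norm (w (r k) z) powr p) \<longlonglongrightarrow> 0)"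
    proof (rule tendsto_L1_AE_subseq)
      show "integrable L (\<lambda>z. norm (w k z) powr p)" for k
        using wL[of k] by (simp add: Lp_space_def L_def)
      show "(\<lambda>k. LINT z|L. norm (norm (w k z) powr p)) \<longlonglongrightarrow> 0"
        using Iw by (simp add: I_def)
    qed
    then obtain r :: "nat \<Rightarrow> nat" where r: "strict_mono r"
      and rae: "AE z in L. (\<lambda>k. norm (w (r k) z) powr p) \<longlonglongrightarrow> 0" by blast
    have vae: "AE z in L. (\<lambda>k. ennreal (norm (v (r k) z) powr q)) \<longlonglongrightarrow> ennreal (norm (\<psi> z) powr q)"
      using rae
    proof eventually_elim
      case (elim z)
      then have "(\<lambda>k. (norm (w (r k) z) powr p) powr (1/p)) \<longlonglongrightarrow> 0 powr (1/p)"
        by (rule tendsto_powr'[OF _ tendsto_const]) (use p in auto)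
      then have "(\<lambda>k. norm (w (r k) z)) \<longlonglongrightarrow> 0" using p by (simp add: powr_powr)
      then have "(\<lambda>k. w (r k) z) \<longlonglongrightarrow> 0" by (rule tendsto_norm_zero_cancel)
      then have "(\<lambda>k. w (r k) z + \<psi> z) \<longlonglongrightarrow> 0 + \<psi> z" by (intro tendsto_intros)
      then have "(\<lambda>k. v (r k) z) \<longlonglongrightarrow> \<psi> z" by (simp add: v_eq)
      then have "(\<lambda>k. norm (v (r k) z) powr q) \<longlonglongrightarrow> norm (\<psi> z) powr q"
        by (intro tendsto_powr'[OF tendsto_norm tendsto_const]) (use p q in auto)
      then show ?case by (rule tendsto_ennrealI)
    qed
    have step: "(\<integral>\<^sup>+z. ennreal (norm (v k z) powr q) \<partial>L) \<le> ennreal (bnd \<delta>)"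
      if \<delta>: "0 < \<delta>" "I (w k) \<le> \<delta>" "I (gw k) \<le> \<delta>" "I' (Gw k) \<le> \<delta>" for k \<delta>
    proof -
      obtain R where R: "\<And>t x. t \<in> {0..T} \<Longrightarrow> R < norm x \<Longrightarrow> v k (t, x) = 0" using vR[of k] by blast
      let ?g = "\<lambda>z. gw k z + g z" and ?G = "\<lambda>z. Gw k z + G z"
      have vgL: "?g \<in> Lp_space p ?Q" "?G \<in> Lp_space p ?Q"
        by (intro Lp_space_add p0 gwL gL)+
      have le: "I ?g \<le> 2 powr p * (\<delta> + I g)" "I (v k) \<le> 2 powr p * (\<delta> + I \<psi>)" "I' ?G \<le> 2 powr p * (\<delta> + I' G)"
      proof -
        have "I ?g \<le> 2 powr p * (I (gw k) + I g)"
          unfolding I_def L_def by (rule integral_norm_powr_add_le[OF p0(1) gwL(1) gL(1)])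
        also have "\<dots> \<le> 2 powr p * (\<delta> + I g)" using \<delta> by (intro mult_left_mono) auto
        finally show "I ?g \<le> 2 powr p * (\<delta> + I g)" .
        have "I (v k) \<le> 2 powr p * (I (w k) + I \<psi>)"
          unfolding I_def L_def v_eq by (rule integral_norm_powr_add_le[OF p0(1) wL \<psi>L])
        also have "\<dots> \<le> 2 powr p * (\<delta> + I \<psi>)" using \<delta> by (intro mult_left_mono) auto
        finally show "I (v k) \<le> 2 powr p * (\<delta> + I \<psi>)" .
        have "I' ?G \<le> 2 powr p * (I' (Gw k) + I' G)"
          unfolding I'_def L_def by (rule integral_norm_powr_add_le[OF p0(1) gwL(2) gL(2)])
        also have "\<dots> \<le> 2 powr p * (\<delta> + I' G)" using \<delta> by (intro mult_left_mono) auto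
        finally show "I' ?G \<le> 2 powr p * (\<delta> + I' G)" .
      qed
      have pos: "0 < 2 powr p * (\<delta> + I g)" "0 < 2 powr p * (\<delta> + I \<psi>)" "0 < 2 powr p * (\<delta> + I' G)"
        using \<delta>(1) I0[of g] I0[of \<psi>] I'0[of G] by (auto intro!: mult_pos_pos add_pos_nonneg)
      have "(\<integral>\<^sup>+z. ennreal (norm (v k z) powr q) \<partial>L) \<le>
          ennreal C * (epow (ennreal (I ?g)) a * (epow (ennreal (I (v k))) (1 - \<theta>) * epow (ennreal (I' ?G)) \<theta>))"
        using interpolation_inequality_smooth[OF al T vs R vi p q vL vg vG]
        unfolding nn_integral_Lp[OF vgL(1)] nn_integral_Lp[OF vgL(2)] nn_integral_Lp[OF vL]
        by (simp only: C_def I_def I'_def L_def n_def \<theta>_def a_def)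
      also have "\<dots> \<le> ennreal C * (epow (ennreal (2 powr p * (\<delta> + I g))) a *
          (epow (ennreal (2 powr p * (\<delta> + I \<psi>))) (1 - \<theta>) * epow (ennreal (2 powr p * (\<delta> + I' G))) \<theta>))"
        using \<theta> a0 by (intro mult_mono mult_left_mono epow_mono ennreal_leI le) auto
      also have "\<dots> = ennreal (bnd \<delta>)"
        using pos \<theta> a0 C0 by (simp add: epow_ennreal_pos bnd_def flip: ennreal_mult)
      finally show ?thesis .
    qed
    have fatou: "(\<integral>\<^sup>+z. ennreal (norm (\<psi> z) powr q) \<partial>L) \<le> ennreal (bnd \<delta>)" if \<delta>: "0 < \<delta>" for \<delta>
    proof -
      have [measurable]: "v k \<in> borel_measurable L" for k using vL[of k] by (simp add: Lp_space_def L_def)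
      have "eventually (\<lambda>k. I (w k) < \<delta> \<and> I (gw k) < \<delta> \<and> I' (Gw k) < \<delta>) sequentially"
        using order_tendstoD(2)[OF Iw \<delta>] order_tendstoD(2)[OF Ig \<delta>] order_tendstoD(2)[OF IG \<delta>]
        by eventually_elim blast
      then have "eventually (\<lambda>k. (\<integral>\<^sup>+z. ennreal (norm (v k z) powr q) \<partial>L) \<le> ennreal (bnd \<delta>)) sequentially"
        by eventually_elim (intro step \<delta>, auto)
      then have ev: "eventually (\<lambda>k. (\<integral>\<^sup>+z. ennreal (norm (v (r k) z) powr q) \<partial>L) \<le> ennreal (bnd \<delta>)) sequentially"
        by (rule eventually_subseq[OF r])
      have "(\<integral>\<^sup>+z. ennreal (norm (\<psi> z) powr q) \<partial>L) =
          (\<integral>\<^sup>+z. liminf (\<lambda>k. ennreal (norm (v (r k) z) powr q)) \<partial>L)"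
      proof (rule nn_integral_cong_AE)
        show "AE z in L. ennreal (norm (\<psi> z) powr q) = liminf (\<lambda>k. ennreal (norm (v (r k) z) powr q))"
          using vae by eventually_elim (rule lim_imp_Liminf[symmetric], simp)
      qed
      also have "\<dots> \<le> liminf (\<lambda>k. \<integral>\<^sup>+z. ennreal (norm (v (r k) z) powr q) \<partial>L)"
        by (rule nn_integral_liminf) measurable
      also have "\<dots> \<le> limsup (\<lambda>k. \<integral>\<^sup>+z. ennreal (norm (v (r k) z) powr q) \<partial>L)"
        by (rule Liminf_le_Limsup) simp
      also have "\<dots> \<le> ennreal (bnd \<delta>)" by (rule Limsup_bounded[OF ev])
      finally show ?thesis .
    qed
    have "(\<lambda>k. bnd (inverse (real (Suc k)))) \<longlonglongrightarrow> bnd 0"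
      unfolding bnd_def
      by (intro tendsto_mult tendsto_const tendsto_powr' tendsto_add LIMSEQ_inverse_real_of_nat)
         (use E0 I0[of g] I'0[of G] a0 \<theta> in auto)
    then have "(\<lambda>k. ennreal (bnd (inverse (real (Suc k))))) \<longlonglongrightarrow> ennreal (bnd 0)" by (rule tendsto_ennrealI)
    then show ?thesis
      by (rule LIMSEQ_le_const) (intro exI allI impI fatou, simp)
  qed
  then show ?thesis
    by (simp add: bnd_def C_def a_def I_def I'_def g_def G_def)
qed

theorem theoremA4:
  fixes \<alpha> p q d \<theta> :: real
  assumes d: "d = real CARD('n::finite)"
    and \<alpha>: "0 < \<alpha>" "\<alpha> < 1"
    and p: "1 < p" and q: "1 < q"
    and p_bounds: "1 / \<alpha> < p" "p < d"
    and q_bounds: "p < q" "q \<le> p + p\<^sup>2 / d"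
    and \<theta>: "\<theta> = d * (q - p) / p\<^sup>2"
  shows "\<theta> \<in> {0<..1} \<and>
    (\<exists>N>0. \<forall>T>0. \<forall>\<psi> \<in> H0_space p \<alpha> T (UNIV :: (real ^ 'n) set).
       \<psi> \<in> Lp_space q (cylinder T UNIV) \<and>
       Lp_norm q (cylinder T UNIV) \<psi> \<le>
         N * T powr (\<alpha> * (1 - p / q) - 1 / p + 1 / q)
           * Lp_norm p (cylinder T UNIV) (frac_deriv p \<alpha> T UNIV \<psi>) powr (1 - p / q)
           * Lp_norm p (cylinder T UNIV) (weak_gradient p T UNIV \<psi>) powr (\<theta> * p / q)
           * Lp_norm p (cylinder T UNIV) \<psi> powr ((1 - \<theta>) * p / q))"
proof -
  have d': "d = real DIM(real ^ 'n)" by (simp add: d)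
  have d0: "0 < d" using p p_bounds by simp
  have ap: "1 < \<alpha> * p" using \<alpha> p_bounds by (simp add: field_simps)
  have th: "0 < \<theta>" "\<theta> \<le> 1" using p d0 q_bounds by (auto simp: \<theta> field_simps)
  have p0: "0 < p" using p by simp
  define a where "a = (q - p) / p"
  have a0: "0 < a" using p q_bounds by (simp add: a_def)
  define N where "N = (GN_const d \<alpha> p q * ((2 powr p) powr a * ((2 powr p) powr (1 - \<theta>) * (2 powr p) powr \<theta>))) powr (1 / q)"
  have GN: "0 < GN_const d \<alpha> p q"
    using Gamma_real_pos[OF \<alpha>(1)] p p_bounds ap unfolding GN_const_def
    by (intro mult_pos_pos) (auto simp: powr_gt_zero)
  have N: "0 < N" using GN unfolding N_def by simp
  have main: "\<psi> \<in> Lp_space q (cylinder T UNIV) \<and>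
       Lp_norm q (cylinder T UNIV) \<psi> \<le>
         N * T powr (\<alpha> * (1 - p / q) - 1 / p + 1 / q)
           * Lp_norm p (cylinder T UNIV) (frac_deriv p \<alpha> T UNIV \<psi>) powr (1 - p / q)
           * Lp_norm p (cylinder T UNIV) (weak_gradient p T UNIV \<psi>) powr (\<theta> * p / q)
           * Lp_norm p (cylinder T UNIV) \<psi> powr ((1 - \<theta>) * p / q)"
    if T: "0 < T" and \<psi>: "\<psi> \<in> H0_space p \<alpha> T (UNIV :: (real ^ 'n) set)" for T \<psi>
  proof -
    let ?Q = "cylinder T (UNIV :: (real ^ 'n) set)"
    define A where "A = Lp_norm p ?Q (frac_deriv p \<alpha> T UNIV \<psi>)"
    define B where "B = Lp_norm p ?Q (weak_gradient p T UNIV \<psi>)"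
    define E where "E = Lp_norm p ?Q \<psi>"
    have nn: "0 \<le> A" "0 \<le> B" "0 \<le> E" by (auto simp: A_def B_def E_def Lp_norm_def)
    define S where "S = GN_const d \<alpha> p q * T powr ((\<alpha> - 1/p) * (q - p)) *
      ((2 powr p * A powr p) powr a * ((2 powr p * E powr p) powr (1 - \<theta>) * (2 powr p * B powr p) powr \<theta>))"
    have S0: "0 \<le> S" using GN by (simp add: S_def)
    have le: "(\<integral>\<^sup>+z. ennreal (norm (\<psi> z) powr q) \<partial>lebesgue_on ?Q) \<le> ennreal S"
      using interpolation_inequality_H0[OF \<alpha> T p p_bounds(2)[unfolded d'] ap q_bounds(1) q_bounds(2)[unfolded d'] \<psi>]
      unfolding integral_norm_powr_eq_Lp_norm[OF p0]
      by (simp only: S_def A_def B_def E_def a_def \<theta> d')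
    have \<psi>m: "\<psi> \<in> borel_measurable (lebesgue_on ?Q)"
      using \<psi> by (auto simp: H0_space_def H_space_def Lp_space_def)
    have int: "integrable (lebesgue_on ?Q) (\<lambda>z. norm (\<psi> z) powr q)"
    proof (rule integrableI_bounded)
      show "(\<lambda>z. norm (\<psi> z) powr q) \<in> borel_measurable (lebesgue_on ?Q)" using \<psi>m by measurable
      show "(\<integral>\<^sup>+z. ennreal (norm (norm (\<psi> z) powr q)) \<partial>lebesgue_on ?Q) < \<infinity>"
        using le by (simp add: order_le_less_trans)
    qed
    have "ennreal (LINT z|lebesgue_on ?Q. norm (\<psi> z) powr q) \<le> ennreal S"
      using le by (subst (asm) nn_integral_eq_integral[OF int]) auto
    then have "(LINT z|lebesgue_on ?Q. norm (\<psi> z) powr q) \<le> S" using S0 by simp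
    then have "Lp_norm q ?Q \<psi> \<le> S powr (1/q)"
      unfolding Lp_norm_def using q by (intro powr_mono2 integral_nonneg_AE) auto
    also have "S = (GN_const d \<alpha> p q * ((2 powr p) powr a * ((2 powr p) powr (1 - \<theta>) * (2 powr p) powr \<theta>))) *
        T powr ((\<alpha> - 1/p) * (q - p)) * A powr (p * a) * B powr (p * \<theta>) * E powr (p * (1 - \<theta>))"
      unfolding S_def by (simp only: powr_mult powr_powr mult_ac)
    also have "\<dots> powr (1/q) = N * T powr ((\<alpha> - 1/p) * (q - p) * (1/q)) * A powr (p * a * (1/q)) *
        B powr (p * \<theta> * (1/q)) * E powr (p * (1 - \<theta>) * (1/q))"
      unfolding N_def by (simp only: powr_mult powr_powr)
    also have "(\<alpha> - 1/p) * (q - p) * (1/q) = \<alpha> * (1 - p / q) - 1 / p + 1 / q"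
      using p q by (simp add: field_simps)
    also have "p * a * (1/q) = 1 - p / q" using p q by (simp add: a_def field_simps)
    also have "p * \<theta> * (1/q) = \<theta> * p / q" by simp
    also have "p * (1 - \<theta>) * (1/q) = (1 - \<theta>) * p / q" by simp
    finally have "Lp_norm q ?Q \<psi> \<le> N * T powr (\<alpha> * (1 - p / q) - 1 / p + 1 / q) * A powr (1 - p / q) *
        B powr (\<theta> * p / q) * E powr ((1 - \<theta>) * p / q)" .
    moreover have "\<psi> \<in> Lp_space q ?Q" using \<psi>m int by (simp add: Lp_space_def)
    ultimately show ?thesis by (simp add: A_def B_def E_def)
  qed
  show ?thesis
  proof (intro conjI exI[of _ N] allI impI ballI)
    show "\<theta> \<in> {0<..1}" using th by simp
  qed (use N main in auto)
qed

end
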